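(* Fix positive sequences $\delta_n \searrow 0$ and $\Delta_n \searrow 0$, sequences $K_n$, $s=s_n\ge1$, $p=p_n$, and constants $C>0$, $c>0$, $0<c'<1/2$, none of which depend on $\Pr$. Let $\mathbf{P}_n$ be the set of data-generating processes $\Pr$ for which the model and Condition HTE($\Pr$) described in the context hold. Then: (1) For any sequence $\Pr=\Pr_n\in\mathbf{P}_n$, $$\sigma_n^{-1}\sqrt{n}(\check\gamma-\gamma_0)\rightsquigarrow N(0,1),\qquad \sigma_n^2=\mathrm{E}\big[\tilde\varphi^2(\gamma_0,y_i,d_i,g(0,z_i),g(1,z_i),m(z_i),\mu)\big].$$ (2) The conclusion of (1) continues to hold with $\sigma_n^2$ replaced by $\hat\sigma_n^2:=\mathbb{E}_n\big[\tilde\varphi^2(\gamma_0,y_i,d_i,\hat g(0,z_i),\hat g(1,z_i),\hat m(z_i),\mu)\big]$. (3) For every $\xi\in(0,1)$, $$\lim_{n\to\infty}\sup_{\Pr\in\mathbf{P}_n}\Big|\Pr\big(\gamma_0\in[\check\gamma\pm\Phi^{-1}(1-\xi/2)\hat\sigma_n/\sqrt{n}]\big)-(1-\xi)\Big|=0,$$ where $\Phi$ is the standard normal cdf.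
   Context: Data: an i.i.d. sample $(y_i,d_i,z_i)_{i=1}^n$ on a probability space $(\Omega,\mathfrak F,\Pr)$ ($\Pr$ is called the data-generating process), with binary treatment $d_i\in\{0,1\}$, satisfying $$y_i = g(d_i,z_i)+\zeta_i,\ \mathrm{E}[\zeta_i\mid z_i,d_i]=0, \qquad d_i = m(z_i)+v_i,\ \mathrm{E}[v_i\mid z_i]=0.$$ Let $x_i = P(z_i)\in\mathbb{R}^p$ be a vector of technical controls, $\tilde x_i := (d_i x_i', (1-d_i)x_i')'$, and suppose $$y_i = \tilde x_i'\beta_{g0} + r_{gi} + \zeta_i,\qquad d_i = \Lambda(x_i'\beta_{m0}) + r_{mi} + v_i,$$ i.e. $g(d_i,z_i)=\tilde x_i'\beta_{g0}+r_{gi}$ and $m(z_i)=\Lambda(x_i'\beta_{m0})+r_{mi}$, where $\beta_{g0}=(\beta_{g0,1}',\beta_{g0,0}')'$, $r_{gi},r_{mi}$ are approximation errors, and $\Lambda(u)=u$ or $\Lambda(u)=e^u/(1+e^u)$. The target is the average treatment effect on the treated $\gamma_0=\mathrm{E}[g(1,z_i)-g(0,z_i)\mid d_i=1]$; let $\mu=\mathrm{E}[m(z_i)]=\Pr(d_i=1)$. Given estimators $\hat\beta_g=(\hat\beta_{g,1}',\hat\beta_{g,0}')'$ and $\hat\beta_m$ (e.g. post-Lasso estimators), set $\hat g(d,z)=d\,P(z)'\hat\beta_{g,1}+(1-d)P(z)'\hat\beta_{g,0}$, $\hat m(z)=\Lambda(P(z)'\hat\beta_m)$, $\hat\mu=\mathbb{E}_n[d_i]$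 ($\mathbb{E}_n$ = sample average). Define $$\tilde\varphi(\gamma,y,d,g_0,g_1,m,\mu)=\frac{d(y-g_1)}{\mu}-\frac{m(1-d)(y-g_0)}{(1-m)\mu}+\frac{d(g_1-g_0)}{\mu}-\gamma\frac{d}{\mu},$$ and let $\check\gamma$ solve $\mathbb{E}_n[\tilde\varphi(\check\gamma,y_i,d_i,\hat g(0,z_i),\hat g(1,z_i),\hat m(z_i),\hat\mu)]=0$. Notation: $\|w_i\|_{\Pr,q}$ is the $L^q(\Pr)$ norm; $\|w_i\|_{\mathbb{P}_n,q}=(n^{-1}\sum_{i=1}^n|w_i|^q)^{1/q}$; $\|\cdot\|_0$ counts nonzero entries, $\|\cdot\|_1$ is the $\ell_1$ norm. Condition HTE($\Pr$): (i) $\|r_{gi}\|_{\Pr,2}\le\delta_n n^{-1/4}$, $\|r_{gi}\|_{\Pr,\infty}\le\delta_n$, $\|r_{mi}\|_{\Pr,2}\le\delta_n n^{-1/4}$, $\|r_{mi}\|_{\Pr,\infty}\le\delta_n$. (ii) With $\Pr$-probability at least $1-\Delta_n$: $\|\tilde x_i'(\hat\beta_g-\beta_{g0})\|_{\mathbb{P}_n,2}\le\delta_n n^{-1/4}$, $\|x_i'(\hat\beta_m-\beta_{m0})\|_{\mathbb{P}_n,2}\le\delta_n n^{-1/4}$, $K_n\|\hat\beta_g-\beta_{g0}\|_1\le\delta_n$, $K_n\|\hat\beta_m-\beta_{m0}\|_1\le\delta_n$, $\|\hat\beta_g\|_0\le Cs$, $\|\hat\beta_m\|_0\le Cs$; moreover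 $\|\beta_{g0}\|_0\le Cs$, $\|\beta_{m0}\|_0\le Cs$, and $\sup_{\|\delta\|_0\le 2Cs}\big|\|\tilde x_i'\delta\|_{\mathbb{P}_n,2}/\|\tilde x_i'\delta\|_{\Pr,2}-1\big|\le\delta_n$. (iii) $\|x_{ij}\|_{\Pr,\infty}\le K_n$ for each $j$, $\|g\|_{\Pr,\infty}\le C$, $\|y_i\|_{\Pr,\infty}\le C$, $\Pr(c'\le m(z_i)\le1-c')=1$, and $\|\zeta_i^2\|_{\Pr,2}\ge c$. (iv) $(s\log(p\vee n))^2/n\le\delta_n$. *)

theory Defs
  imports "HOL-Probability.Probability"
begin

type_synonym 'z obs = "real \<times> real \<times> 'z"

definition yy :: "'z obs \<Rightarrow> real" where "yy w = fst w"
definition dd :: "'z obs \<Rightarrow> real" where "dd w = fst (snd w)"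
definition zz :: "'z obs \<Rightarrow> 'z" where "zz w = snd (snd w)"

definition obs_space :: "'z measure \<Rightarrow> 'z obs measure" where
  "obs_space Zs = borel \<Otimes>\<^sub>M (borel \<Otimes>\<^sub>M Zs)"

definition sample :: "nat \<Rightarrow> 'z obs measure \<Rightarrow> (nat \<Rightarrow> 'z obs) measure" where
  "sample n Q = PiM {..<n} (\<lambda>_. Q)"

record 'z dgp =
  law :: "'z obs measure"
  gfun :: "real \<Rightarrow> 'z \<Rightarrow> real"
  mfun :: "'z \<Rightarrow> real"
  bg1 :: "nat \<Rightarrow> real"
  bg0 :: "nat \<Rightarrow> real"
  bm :: "nat \<Rightarrow> real"

text \<open>Vectors in R^p are functions nat => real, only entries j < p matter.\<close>
definition ip :: "nat \<Rightarrow> (nat \<Rightarrow> real) \<Rightarrow> (nat \<Rightarrow> real) \<Rightarrow> real" where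
  "ip p x b = (\<Sum>j<p. x j * b j)"

definition l0 :: "nat \<Rightarrow> (nat \<Rightarrow> real) \<Rightarrow> nat" where
  "l0 p b = card {j. j < p \<and> b j \<noteq> 0}"

definition l1 :: "nat \<Rightarrow> (nat \<Rightarrow> real) \<Rightarrow> real" where
  "l1 p b = (\<Sum>j<p. \<bar>b j\<bar>)"

definition xtb :: "nat \<Rightarrow> (nat \<Rightarrow> real) \<Rightarrow> real \<Rightarrow> (nat \<Rightarrow> real) \<Rightarrow> (nat \<Rightarrow> real) \<Rightarrow> real" where
  "xtb p x d b1 b0 = d * ip p x b1 + (1 - d) * ip p x b0"

definition logistic :: "real \<Rightarrow> real" where
  "logistic u = exp u / (1 + exp u)"

definition phi_t :: "real \<Rightarrow> real \<Rightarrow> real \<Rightarrow> real \<Rightarrow> real \<Rightarrow> real \<Rightarrow> real \<Rightarrow> real" where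
  "phi_t \<gamma> y d g0 g1 m \<mu> =
     d * (y - g1) / \<mu> - m * (1 - d) * (y - g0) / ((1 - m) * \<mu>) + d * (g1 - g0) / \<mu> - \<gamma> * d / \<mu>"

definition L2norm :: "'a measure \<Rightarrow> ('a \<Rightarrow> real) \<Rightarrow> real" where
  "L2norm M f = sqrt (\<integral>w. (f w)\<^sup>2 \<partial>M)"

definition En :: "nat \<Rightarrow> (nat \<Rightarrow> 'z obs) \<Rightarrow> ('z obs \<Rightarrow> real) \<Rightarrow> real" where
  "En n \<omega> f = (\<Sum>i<n. f (\<omega> i)) / real n"

definition Pn2norm :: "nat \<Rightarrow> (nat \<Rightarrow> 'z obs) \<Rightarrow> ('z obs \<Rightarrow> real) \<Rightarrow> real" where
  "Pn2norm n \<omega> f = sqrt (En n \<omega> (\<lambda>w. (f w)\<^sup>2))"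

definition mu0 :: "'z dgp \<Rightarrow> real" where
  "mu0 G = (\<integral>w. mfun G (zz w) \<partial>law G)"

definition gamma0 :: "'z dgp \<Rightarrow> real" where
  "gamma0 G = (\<integral>w. indicator {w. dd w = 1} w * (gfun G 1 (zz w) - gfun G 0 (zz w)) \<partial>law G)
              / measure (law G) {w \<in> space (law G). dd w = 1}"

definition sigma2 :: "'z dgp \<Rightarrow> real" where
  "sigma2 G = (\<integral>w. (phi_t (gamma0 G) (yy w) (dd w) (gfun G 0 (zz w)) (gfun G 1 (zz w))
                        (mfun G (zz w)) (mu0 G))\<^sup>2 \<partial>law G)"

definition ghat :: "(nat \<Rightarrow> nat) \<Rightarrow> (nat \<Rightarrow> 'z \<Rightarrow> nat \<Rightarrow> real)
     \<Rightarrow> (nat \<Rightarrow> (nat \<Rightarrow> 'z obs) \<Rightarrow> nat \<Rightarrow> real) \<Rightarrow> (nat \<Rightarrow> (nat \<Rightarrow> 'z obs) \<Rightarrow> nat \<Rightarrow> real)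
     \<Rightarrow> nat \<Rightarrow> (nat \<Rightarrow> 'z obs) \<Rightarrow> real \<Rightarrow> 'z \<Rightarrow> real" where
  "ghat p P bhg1 bhg0 n \<omega> d z = xtb (p n) (P n z) d (bhg1 n \<omega>) (bhg0 n \<omega>)"

definition mhat :: "(real \<Rightarrow> real) \<Rightarrow> (nat \<Rightarrow> nat) \<Rightarrow> (nat \<Rightarrow> 'z \<Rightarrow> nat \<Rightarrow> real)
     \<Rightarrow> (nat \<Rightarrow> (nat \<Rightarrow> 'z obs) \<Rightarrow> nat \<Rightarrow> real) \<Rightarrow> nat \<Rightarrow> (nat \<Rightarrow> 'z obs) \<Rightarrow> 'z \<Rightarrow> real" where
  "mhat \<Lambda> p P bhm n \<omega> z = \<Lambda> (ip (p n) (P n z) (bhm n \<omega>))"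

definition muhat :: "nat \<Rightarrow> (nat \<Rightarrow> 'z obs) \<Rightarrow> real" where
  "muhat n \<omega> = En n \<omega> dd"

definition emp_moment :: "(real \<Rightarrow> real) \<Rightarrow> (nat \<Rightarrow> nat) \<Rightarrow> (nat \<Rightarrow> 'z \<Rightarrow> nat \<Rightarrow> real) \<Rightarrow> (nat \<Rightarrow> (nat \<Rightarrow> 'z obs) \<Rightarrow> nat \<Rightarrow> real) \<Rightarrow> (nat \<Rightarrow> (nat \<Rightarrow> 'z obs) \<Rightarrow> nat \<Rightarrow> real) \<Rightarrow> (nat \<Rightarrow> (nat \<Rightarrow> 'z obs) \<Rightarrow> nat \<Rightarrow> real) \<Rightarrow> nat \<Rightarrow> (nat \<Rightarrow> 'z obs) \<Rightarrow> real \<Rightarrow> real" where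
  "emp_moment \<Lambda> p P bhg1 bhg0 bhm n \<omega> \<gamma> =
     En n \<omega> (\<lambda>w. phi_t \<gamma> (yy w) (dd w) (ghat p P bhg1 bhg0 n \<omega> 0 (zz w))
                   (ghat p P bhg1 bhg0 n \<omega> 1 (zz w)) (mhat \<Lambda> p P bhm n \<omega> (zz w)) (muhat n \<omega>))"

text \<open>gamma_check: the solution of the (affine in gamma) empirical moment equation
  emp_moment ... gamma = 0, written in closed form (see lemma gcheck_solves).\<close>
definition gcheck :: "(real \<Rightarrow> real) \<Rightarrow> (nat \<Rightarrow> nat) \<Rightarrow> (nat \<Rightarrow> 'z \<Rightarrow> nat \<Rightarrow> real) \<Rightarrow> (nat \<Rightarrow> (nat \<Rightarrow> 'z obs) \<Rightarrow> nat \<Rightarrow> real) \<Rightarrow> (nat \<Rightarrow> (nat \<Rightarrow> 'z obs) \<Rightarrow> nat \<Rightarrow> real) \<Rightarrow> (nat \<Rightarrow> (nat \<Rightarrow> 'z obs) \<Rightarrow> nat \<Rightarrow> real) \<Rightarrow> nat \<Rightarrow> (nat \<Rightarrow> 'z obs) \<Rightarrow> real" where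
  "gcheck \<Lambda> p P bhg1 bhg0 bhm n \<omega> =
     emp_moment \<Lambda> p P bhg1 bhg0 bhm n \<omega> 0 / En n \<omega> (\<lambda>w. dd w / muhat n \<omega>)"

definition sigma2hat :: "(real \<Rightarrow> real) \<Rightarrow> (nat \<Rightarrow> nat) \<Rightarrow> (nat \<Rightarrow> 'z \<Rightarrow> nat \<Rightarrow> real) \<Rightarrow> (nat \<Rightarrow> (nat \<Rightarrow> 'z obs) \<Rightarrow> nat \<Rightarrow> real) \<Rightarrow> (nat \<Rightarrow> (nat \<Rightarrow> 'z obs) \<Rightarrow> nat \<Rightarrow> real) \<Rightarrow> (nat \<Rightarrow> (nat \<Rightarrow> 'z obs) \<Rightarrow> nat \<Rightarrow> real) \<Rightarrow> nat \<Rightarrow> (nat \<Rightarrow> 'z obs) \<Rightarrow> 'z dgp \<Rightarrow> real" where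
  "sigma2hat \<Lambda> p P bhg1 bhg0 bhm n \<omega> G =
     En n \<omega> (\<lambda>w. (phi_t (gamma0 G) (yy w) (dd w) (ghat p P bhg1 bhg0 n \<omega> 0 (zz w))
                   (ghat p P bhg1 bhg0 n \<omega> 1 (zz w)) (mhat \<Lambda> p P bhm n \<omega> (zz w)) (mu0 G))\<^sup>2)"

lemma phi_t_affine: "phi_t \<gamma> y d g0 g1 m \<mu> = phi_t 0 y d g0 g1 m \<mu> - \<gamma> * (d / \<mu>)"
  unfolding phi_t_def by (simp add: algebra_simps)
lemma En_affine: "En n \<omega> (\<lambda>w. f w - \<gamma> * h w) = En n \<omega> f - \<gamma> * En n \<omega> h"
  unfolding En_def by (simp add: sum_subtractf sum_distrib_left diff_divide_distrib)

lemma emp_moment_affine: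
  "emp_moment \<Lambda> p P bhg1 bhg0 bhm n \<omega> \<gamma> =
     emp_moment \<Lambda> p P bhg1 bhg0 bhm n \<omega> 0 - \<gamma> * En n \<omega> (\<lambda>w. dd w / muhat n \<omega>)"
  unfolding emp_moment_def phi_t_affine[of \<gamma>] by (rule En_affine)

lemma gcheck_solves:
  assumes "En n \<omega> (\<lambda>w. dd w / muhat n \<omega>) \<noteq> 0"
  shows "emp_moment \<Lambda> p P bhg1 bhg0 bhm n \<omega> (gcheck \<Lambda> p P bhg1 bhg0 bhm n \<omega>) = 0"
  using assms by (subst emp_moment_affine) (simp add: gcheck_def)

definition model :: "'z measure \<Rightarrow> 'z dgp \<Rightarrow> bool" where
  "model Zs G \<longleftrightarrow>
     (let Q = law G;
          \<zeta> = (\<lambda>w. yy w - gfun G (dd w) (zz w));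
          v = (\<lambda>w. dd w - mfun G (zz w)) in
     prob_space Q \<and> sets Q = sets (obs_space Zs) \<and>
     case_prod (gfun G) \<in> borel_measurable (borel \<Otimes>\<^sub>M Zs) \<and>
     mfun G \<in> borel_measurable Zs \<and>
     (AE w in Q. dd w \<in> {0, 1}) \<and>
     integrable Q \<zeta> \<and> integrable Q v \<and>
     (AE w in Q. real_cond_exp Q (vimage_algebra (space Q) (\<lambda>w. (dd w, zz w)) (borel \<Otimes>\<^sub>M Zs)) \<zeta> w = 0) \<and>
     (AE w in Q. real_cond_exp Q (vimage_algebra (space Q) zz Zs) v w = 0))"

definition HTE :: "(nat \<Rightarrow> real) \<Rightarrow> (nat \<Rightarrow> real) \<Rightarrow> (nat \<Rightarrow> real) \<Rightarrow> (nat \<Rightarrow> real) \<Rightarrow> (nat \<Rightarrow> nat) \<Rightarrow> real \<Rightarrow> real \<Rightarrow> real \<Rightarrow> (real \<Rightarrow> real) \<Rightarrow> (nat \<Rightarrow> 'z \<Rightarrow> nat \<Rightarrow> real) \<Rightarrow> (nat \<Rightarrow> (nat \<Rightarrow> 'z obs) \<Rightarrow> nat \<Rightarrow> real) \<Rightarrow> (nat \<Rightarrow> (nat \<Rightarrow> 'z obs) \<Rightarrow> nat \<Rightarrow> real) \<Rightarrow> (nat \<Rightarrow> (nat \<Rightarrow> 'z obs) \<Rightarrow> nat \<Rightarrow> real) \<Rightarrow> nat \<Rightarrow> 'z dgp \<Rightarrow> bool" where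
  "HTE \<delta> \<Delta> K s p C c c' \<Lambda> P bhg1 bhg0 bhm n G \<longleftrightarrow>
     (let Q = law G; x = (\<lambda>w. P n (zz w));
          rg = (\<lambda>w. gfun G (dd w) (zz w) - xtb (p n) (x w) (dd w) (bg1 G) (bg0 G));
          rm = (\<lambda>w. mfun G (zz w) - \<Lambda> (ip (p n) (x w) (bm G)));
          \<zeta> = (\<lambda>w. yy w - gfun G (dd w) (zz w)) in
     \<comment> \<open>(i)\<close>
     L2norm Q rg \<le> \<delta> n * real n powr (-1/4) \<and> (AE w in Q. \<bar>rg w\<bar> \<le> \<delta> n) \<and>
     L2norm Q rm \<le> \<delta> n * real n powr (-1/4) \<and> (AE w in Q. \<bar>rm w\<bar> \<le> \<delta> n) \<and>
     \<comment> \<open>(ii)\<close>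
     (\<exists>A \<in> sets (sample n Q). measure (sample n Q) A \<ge> 1 - \<Delta> n \<and>
        A \<subseteq> {\<omega> \<in> space (sample n Q).
          Pn2norm n \<omega> (\<lambda>w. xtb (p n) (x w) (dd w) (\<lambda>j. bhg1 n \<omega> j - bg1 G j) (\<lambda>j. bhg0 n \<omega> j - bg0 G j))
             \<le> \<delta> n * real n powr (-1/4) \<and>
          Pn2norm n \<omega> (\<lambda>w. ip (p n) (x w) (\<lambda>j. bhm n \<omega> j - bm G j)) \<le> \<delta> n * real n powr (-1/4) \<and>
          K n * (l1 (p n) (\<lambda>j. bhg1 n \<omega> j - bg1 G j) + l1 (p n) (\<lambda>j. bhg0 n \<omega> j - bg0 G j)) \<le> \<delta> n \<and>
          K n * l1 (p n) (\<lambda>j. bhm n \<omega> j - bm G j) \<le> \<delta> n \<and>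
          real (l0 (p n) (bhg1 n \<omega>) + l0 (p n) (bhg0 n \<omega>)) \<le> C * s n \<and>
          real (l0 (p n) (bhm n \<omega>)) \<le> C * s n \<and>
          (\<forall>b1 b0. real (l0 (p n) b1 + l0 (p n) b0) \<le> 2 * C * s n \<and>
                   L2norm Q (\<lambda>w. xtb (p n) (x w) (dd w) b1 b0) \<noteq> 0 \<longrightarrow>
             \<bar>Pn2norm n \<omega> (\<lambda>w. xtb (p n) (x w) (dd w) b1 b0)
                / L2norm Q (\<lambda>w. xtb (p n) (x w) (dd w) b1 b0) - 1\<bar> \<le> \<delta> n)}) \<and>
     real (l0 (p n) (bg1 G) + l0 (p n) (bg0 G)) \<le> C * s n \<and>
     real (l0 (p n) (bm G)) \<le> C * s n \<and>
     \<comment> \<open>(iii)\<close>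
     (\<forall>j < p n. AE w in Q. \<bar>P n (zz w) j\<bar> \<le> K n) \<and>
     (AE w in Q. \<bar>gfun G (dd w) (zz w)\<bar> \<le> C) \<and>
     (AE w in Q. \<bar>yy w\<bar> \<le> C) \<and>
     measure Q {w \<in> space Q. c' \<le> mfun G (zz w) \<and> mfun G (zz w) \<le> 1 - c'} = 1 \<and>
     L2norm Q (\<lambda>w. (\<zeta> w)\<^sup>2) \<ge> c \<and>
     \<comment> \<open>(iv)\<close>
     (s n * ln (max (real (p n)) (real n)))\<^sup>2 / real n \<le> \<delta> n)"

definition Pclass :: "'z measure \<Rightarrow> (nat \<Rightarrow> real) \<Rightarrow> (nat \<Rightarrow> real) \<Rightarrow> (nat \<Rightarrow> real) \<Rightarrow> (nat \<Rightarrow> real) \<Rightarrow> (nat \<Rightarrow> nat) \<Rightarrow> real \<Rightarrow> real \<Rightarrow> real \<Rightarrow> (real \<Rightarrow> real) \<Rightarrow> (nat \<Rightarrow> 'z \<Rightarrow> nat \<Rightarrow> real) \<Rightarrow> (nat \<Rightarrow> (nat \<Rightarrow> 'z obs) \<Rightarrow> nat \<Rightarrow> real) \<Rightarrow> (nat \<Rightarrow> (nat \<Rightarrow> 'z obs) \<Rightarrow> nat \<Rightarrow> real) \<Rightarrow> (nat \<Rightarrow> (nat \<Rightarrow> 'z obs) \<Rightarrow> nat \<Rightarrow> real) \<Rightarrow> nat \<Rightarrow> 'z dgp set" where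
  "Pclass Zs \<delta> \<Delta> K s p C c c' \<Lambda> P bhg1 bhg0 bhm n =
     {G. model Zs G \<and> HTE \<delta> \<Delta> K s p C c c' \<Lambda> P bhg1 bhg0 bhm n G}"

definition Phi_inv :: "real \<Rightarrow> real" where
  "Phi_inv q = (THE x. cdf std_normal_distribution x = q)"

end

theory Submission
  imports Defs
begin

text \<open>
  The regression function of the treated cancels from the score, which is
  \<open>((y - g\<^sub>0) (d - m) / (1 - m) - \<gamma> d) / \<mu>\<close>. Replacing \<open>(g\<^sub>0, m)\<close> by estimates changes it by a term
  that is centred given \<open>(d, z)\<close>, a term that is centred given \<open>z\<close>, and a product of the two
  estimation errors. The product is \<open>o(n\<^sup>-\<^sup>1\<^sup>/\<^sup>2)\<close> in the mean by the \<open>n\<^sup>-\<^sup>1\<^sup>/\<^sup>4\<close> rates. The centred terms are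
  controlled uniformly over all sparse coefficient vectors: after rounding the coordinates there are
  only \<open>exp (O(s log (p \<or> n)))\<close> of them, which is \<open>exp (o(n\<^sup>1\<^sup>/\<^sup>2))\<close>, and since the variances are
  \<open>o(n\<^sup>-\<^sup>1\<^sup>/\<^sup>2)\<close>, a Chernoff bound with exponent \<open>1\<close> and a union bound already beat this number.
  All estimates hold uniformly over the class of data-generating processes, and so does the central
  limit theorem for the bounded scores (Levy continuity along a hypothetical sequence of
  counterexamples); Slutsky's argument then gives all three claims.
\<close>

section \<open>High-probability events and product samples\<close>

text \<open>The estimates come from the same sample over which the score is averaged, so their
  errors cannot be treated as fixed functions; this is what forces uniformity over sparse vectors.
  Small variances are required as well, whereas the first-stage rates are given in the empirical
  norm. The restricted isometry carries them over to the population norm, and overlap removes the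
  factors \<open>d\<close> and \<open>1 - d\<close> that the design \<open>xt\<close> puts in front
  of its two blocks. Uniformity over the class is obtained by letting every constant depend on
  \<open>C\<close>, \<open>c\<close> and \<open>c'\<close> alone and by absorbing all rates into one
  tolerance \<open>\<kappa>\<close> with \<open>\<kappa> ^ 4 = \<delta> n + 1 / n\<close>: the
  logarithm of the number of net points is then of order \<open>\<kappa>^2 * sqrt n\<close>, while
  deviations of size \<open>\<kappa> * sqrt n\<close> are allowed. Probabilities are stated through
  measurable inner events, because the first-stage event quantifies over all coefficient vectors and
  comes without measurability.\<close>

definition whp :: "'a measure \<Rightarrow> real \<Rightarrow> ('a \<Rightarrow> bool) \<Rightarrow> bool" where
  "whp M \<epsilon> R \<longleftrightarrow> (\<exists>E\<in>sets M. measure M E \<ge> 1 - \<epsilon> \<and> (\<forall>\<omega>\<in>E. R \<omega>))"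

lemma whp_mono:
  "whp M \<epsilon> R \<Longrightarrow> \<epsilon> \<le> \<epsilon>' \<Longrightarrow> (\<And>\<omega>. \<omega> \<in> space M \<Longrightarrow> R \<omega> \<Longrightarrow> R' \<omega>) \<Longrightarrow> whp M \<epsilon>' R'"
  unfolding whp_def
proof (elim bexE conjE)
  fix E assume "\<epsilon> \<le> \<epsilon>'" "\<And>\<omega>. \<omega> \<in> space M \<Longrightarrow> R \<omega> \<Longrightarrow> R' \<omega>" "E \<in> sets M"
    "1 - \<epsilon> \<le> measure M E" "\<forall>\<omega>\<in>E. R \<omega>"
  then show "\<exists>E\<in>sets M. measure M E \<ge> 1 - \<epsilon>' \<and> (\<forall>\<omega>\<in>E. R' \<omega>)"
    using sets.sets_into_space[of E M] by (intro bexI[of _ E]) auto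
qed

lemma whp_conj:
  assumes "prob_space M" "whp M \<epsilon> R" "whp M \<epsilon>' R'"
  shows "whp M (\<epsilon> + \<epsilon>') (\<lambda>\<omega>. R \<omega> \<and> R' \<omega>)"
proof -
  interpret prob_space M by fact
  obtain E E' where E: "E \<in> sets M" "prob E \<ge> 1 - \<epsilon>" "\<forall>\<omega>\<in>E. R \<omega>"
    and E': "E' \<in> sets M" "prob E' \<ge> 1 - \<epsilon>'" "\<forall>\<omega>\<in>E'. R' \<omega>"
    using assms by (auto simp: whp_def)
  have "prob (E \<union> E') + prob (E \<inter> E') = prob E + prob E'"
    using measure_Un3[of E M E'] E E' by (simp add: fmeasurable_eq_sets)
  moreover have "prob (E \<union> E') \<le> 1" by simp
  ultimately have "prob (E \<inter> E') \<ge> 1 - (\<epsilon> + \<epsilon>')" using E E' by linarith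
  then show ?thesis using E E' by (auto simp: whp_def intro!: bexI[of _ "E \<inter> E'"])
qed

lemma whp_AE:
  assumes "prob_space M" "AE \<omega> in M. R \<omega>"
  shows "whp M 0 R"
proof -
  interpret prob_space M by fact
  obtain N where N: "{\<omega> \<in> space M. \<not> R \<omega>} \<subseteq> N" "emeasure M N = 0" "N \<in> sets M"
    using assms(2) by (auto elim: AE_E)
  have "prob (space M - N) = 1"
    using N prob_compl[OF N(3)] by (simp add: measure_eq_emeasure_eq_ennreal[of 0] measure_eq_0_null_sets null_sets_def)
  with N show ?thesis unfolding whp_def by (intro bexI[of _ "space M - N"]) auto
qed

lemma whp_prob_le:
  assumes "prob_space M" "{\<omega>\<in>space M. \<not> R \<omega>} \<in> sets M" "measure M {\<omega>\<in>space M. \<not> R \<omega>} \<le> \<epsilon>"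
  shows "whp M \<epsilon> R"
proof -
  interpret prob_space M by fact
  have "prob (space M - {\<omega>\<in>space M. \<not> R \<omega>}) \<ge> 1 - \<epsilon>"
    using assms by (simp add: prob_compl)
  then show ?thesis using assms(2) unfolding whp_def
    by (intro bexI[of _ "space M - {\<omega>\<in>space M. \<not> R \<omega>}"]) auto
qed

section \<open>Exponential moments and deviation bounds for product samples\<close>

text \<open>For negative \<open>x = - y\<close> the lower Taylor bound of \<open>exp y\<close> is
  multiplied by \<open>1 - y + y^2\<close>. The product of the two polynomials has constant term 1,
  no linear term and no negative coefficient, hence is at least 1.\<close>

lemma exp_le_quadratic:
  fixes x :: real assumes "\<bar>x\<bar> \<le> 1" shows "exp x \<le> 1 + x + x\<^sup>2"
proof (cases "0 \<le> x")
  case True then show ?thesis using assms exp_bound[of x] by simp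
next
  case False
  define y where "y = - x"
  have y: "0 \<le> y" "y \<le> 1" using False assms by (auto simp: y_def)
  have q: "1 + y + y\<^sup>2 / 2 \<le> exp y" by (rule exp_lower_Taylor_quadratic[OF y(1)])
  have nn: "0 \<le> 1 - y + y\<^sup>2" using y by simp
  have "1 \<le> 1 + y\<^sup>2 / 2 + y ^ 3 / 2 + y ^ 4 / 2" using y by simp
  also have "\<dots> = (1 - y + y\<^sup>2) * (1 + y + y\<^sup>2 / 2)"
    by (simp add: field_simps power2_eq_square power3_eq_cube power4_eq_xxxx)
  also have "\<dots> \<le> (1 - y + y\<^sup>2) * exp y" by (rule mult_left_mono[OF q nn])
  finally have "exp (- y) \<le> 1 - y + y\<^sup>2" by (simp add: exp_minus field_simps)
  then show ?thesis by (simp add: y_def)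
qed

context prob_space
begin

lemma integrable_AE_bounded:
  fixes f :: "'a \<Rightarrow> real"
  assumes "f \<in> borel_measurable M" "AE x in M. \<bar>f x\<bar> \<le> B"
  shows "integrable M f"
  using assms by (intro integrable_const_bound[where B = B]) auto

lemma integrable_square_AE_bounded:
  fixes f :: "'a \<Rightarrow> real"
  assumes "f \<in> borel_measurable M" "AE x in M. \<bar>f x\<bar> \<le> B"
  shows "integrable M (\<lambda>x. (f x)\<^sup>2)"
proof (rule integrable_AE_bounded[where B = "B\<^sup>2"])
  show "AE x in M. \<bar>(f x)\<^sup>2\<bar> \<le> B\<^sup>2"
    using assms(2) by eventually_elim (use abs_le_square_iff in fastforce)
qed (use assms(1) in measurable)

lemma prob_space_power: "prob_space (Pi\<^sub>M {..<n::nat} (\<lambda>_. M))"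
  by (intro prob_space_PiM prob_space_axioms)

lemma AE_power:
  assumes "AE x in M. R x"
  shows "AE \<omega> in Pi\<^sub>M {..<n::nat} (\<lambda>_. M). \<forall>i<n. R (\<omega> i)"
proof -
  have "AE \<omega> in Pi\<^sub>M {..<n} (\<lambda>_. M). \<forall>i\<in>{..<n}. R (\<omega> i)"
    by (intro AE_finite_allI AE_PiM_component[where I = "{..<n}" and M = "\<lambda>_. M" and P = R]
          assms prob_space_axioms) auto
  then show ?thesis by eventually_elim auto
qed

lemma integral_power_component:
  fixes f :: "'a \<Rightarrow> real"
  assumes [measurable]: "f \<in> borel_measurable M" and "i < n"
  shows "(\<integral>\<omega>. f (\<omega> i) \<partial>Pi\<^sub>M {..<n} (\<lambda>_. M)) = (\<integral>x. f x \<partial>M)"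
proof -
  have "(\<integral>x. f x \<partial>M) = (\<integral>x. f x \<partial>distr (Pi\<^sub>M {..<n} (\<lambda>_. M)) M (\<lambda>\<omega>. \<omega> i))"
    using distr_PiM_component[of "{..<n}" "\<lambda>_. M" i] prob_space_axioms assms(2) by simp
  also have "\<dots> = (\<integral>\<omega>. f (\<omega> i) \<partial>Pi\<^sub>M {..<n} (\<lambda>_. M))"
    using assms(2) by (intro integral_distr) auto
  finally show ?thesis by simp
qed

text \<open>Meant for the squared approximation errors \<open>rg\<close> and \<open>rm\<close>:
  these are fixed functions with a small mean, so a first-moment bound suffices.\<close>

lemma markov_power:
  fixes f :: "'a \<Rightarrow> real"
  assumes [measurable]: "f \<in> borel_measurable M" and bd: "AE x in M. \<bar>f x\<bar> \<le> B"
    and nn: "\<And>x. 0 \<le> f x" and "0 < a"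
  shows "whp (Pi\<^sub>M {..<n} (\<lambda>_. M)) (real n * expectation f / a) (\<lambda>\<omega>. (\<Sum>i<n. f (\<omega> i)) \<le> a)"
proof -
  let ?P = "Pi\<^sub>M {..<n} (\<lambda>_. M)"
  interpret P: prob_space ?P by (rule prob_space_power)
  have int: "integrable ?P (\<lambda>\<omega>. f (\<omega> i))" if "i < n" for i
    using AE_power[OF bd, of n] that
    by (intro P.integrable_AE_bounded[where B = B]) (auto elim: eventually_mono)
  have sint: "integrable ?P (\<lambda>\<omega>. \<Sum>i<n. f (\<omega> i))"
    by (intro Bochner_Integration.integrable_sum int) auto
  have [measurable]: "(\<lambda>\<omega>. \<Sum>i<n. f (\<omega> i)) \<in> borel_measurable ?P" by measurable
  have "P.prob {\<omega>\<in>space ?P. \<not> (\<Sum>i<n. f (\<omega> i)) \<le> a} \<le> P.prob {\<omega>\<in>space ?P. (\<Sum>i<n. f (\<omega> i)) \<ge> a}"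
    by (intro P.finite_measure_mono) auto
  also have "\<dots> \<le> P.expectation (\<lambda>\<omega>. \<Sum>i<n. f (\<omega> i)) / a"
    using assms by (intro integral_Markov_inequality_measure[where A = "space ?P", OF sint, simplified])
      (auto intro!: sum_nonneg)
  also have "P.expectation (\<lambda>\<omega>. \<Sum>i<n. f (\<omega> i)) = real n * expectation f"
    by (subst Bochner_Integration.integral_sum) (auto simp: int integral_power_component)
  finally show ?thesis
    by (intro whp_prob_le prob_space_power) auto
qed

text \<open>Independence turns the exponential moment of the sum into a power of one factor. As the
  mean vanishes and \<open>\<tau> * B \<le> 1\<close> admits the quadratic bound, that factor is at
  most \<open>1 + \<tau>^2 * V\<close>. The exponent stays free because its uses differ: 1 for the
  net, \<open>1 / sqrt n\<close> for the leading sum, the optimal value for averages.\<close>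

lemma chernoff_power:
  fixes f :: "'a \<Rightarrow> real"
  assumes [measurable]: "f \<in> borel_measurable M" and bd: "AE x in M. \<bar>f x\<bar> \<le> B"
    and mean: "expectation f = 0" and var: "expectation (\<lambda>x. (f x)\<^sup>2) \<le> V"
    and \<tau>: "0 < \<tau>" "\<tau> * B \<le> 1"
  shows "measure (Pi\<^sub>M {..<n} (\<lambda>_. M)) {\<omega>\<in>space (Pi\<^sub>M {..<n} (\<lambda>_. M)). (\<Sum>i<n. f (\<omega> i)) \<ge> a}
     \<le> exp (real n * \<tau>\<^sup>2 * V - \<tau> * a)"
proof -
  let ?P = "Pi\<^sub>M {..<n} (\<lambda>_. M)"
  interpret P: prob_space ?P by (rule prob_space_power)
  interpret PS: product_sigma_finite "\<lambda>_::nat. M"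
    by (simp add: product_sigma_finite_def sigma_finite_measure_axioms)
  let ?e = "\<lambda>x. exp (\<tau> * f x)"
  have lf: "AE x in M. \<bar>\<tau> * f x\<bar> \<le> 1"
    using bd
  proof eventually_elim
    case (elim x)
    have "\<bar>\<tau> * f x\<bar> \<le> \<tau> * B" using \<tau> elim by (simp add: abs_mult)
    with \<tau> show ?case by simp
  qed
  have inte: "integrable M ?e"
    using lf by (intro integrable_AE_bounded[where B = "exp 1"]) (auto elim: eventually_mono)
  have intf: "integrable M f" by (rule integrable_AE_bounded[OF _ bd]) simp
  have intf2: "integrable M (\<lambda>x. (f x)\<^sup>2)"
    by (rule integrable_square_AE_bounded[OF _ bd]) simp
  have "expectation ?e \<le> expectation (\<lambda>x. 1 + \<tau> * f x + \<tau>\<^sup>2 * (f x)\<^sup>2)"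
  proof (rule integral_mono_AE[OF inte])
    show "integrable M (\<lambda>x. 1 + \<tau> * f x + \<tau>\<^sup>2 * (f x)\<^sup>2)" using intf intf2 by simp
    show "AE x in M. ?e x \<le> 1 + \<tau> * f x + \<tau>\<^sup>2 * (f x)\<^sup>2"
      using lf by eventually_elim (drule exp_le_quadratic, simp add: power_mult_distrib)
  qed
  also have "\<dots> = 1 + \<tau>\<^sup>2 * expectation (\<lambda>x. (f x)\<^sup>2)"
    using intf intf2 mean by (simp add: prob_space)
  also have "\<dots> \<le> 1 + \<tau>\<^sup>2 * V" using var by (simp add: mult_left_mono)
  also have "\<dots> \<le> exp (\<tau>\<^sup>2 * V)" by (rule exp_ge_add_one_self)
  finally have e1: "expectation ?e \<le> exp (\<tau>\<^sup>2 * V)" .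
  have e0: "0 \<le> expectation ?e" by (intro Bochner_Integration.integral_nonneg) auto
  have eq: "exp (\<tau> * (\<Sum>i<n. f (\<omega> i))) = (\<Prod>i<n. ?e (\<omega> i))" for \<omega> :: "nat \<Rightarrow> 'a"
    by (simp add: sum_distrib_left exp_sum)
  have intP: "integrable ?P (\<lambda>\<omega>. exp (\<tau> * (\<Sum>i<n. f (\<omega> i))))"
    unfolding eq by (intro PS.product_integrable_prod inte) auto
  have [measurable]: "(\<lambda>\<omega>. \<Sum>i<n. f (\<omega> i)) \<in> borel_measurable ?P" by measurable
  have "{\<omega>\<in>space ?P. (\<Sum>i<n. f (\<omega> i)) \<ge> a} = {\<omega>\<in>space ?P. exp (\<tau> * (\<Sum>i<n. f (\<omega> i))) \<ge> exp (\<tau> * a)}"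
    using \<tau> by auto
  also have "P.prob \<dots> \<le> P.expectation (\<lambda>\<omega>. exp (\<tau> * (\<Sum>i<n. f (\<omega> i)))) / exp (\<tau> * a)"
    by (intro integral_Markov_inequality_measure[where A = "space ?P", OF intP, simplified]) auto
  also have "P.expectation (\<lambda>\<omega>. exp (\<tau> * (\<Sum>i<n. f (\<omega> i)))) = (expectation ?e) ^ n"
    unfolding eq by (subst PS.product_integral_prod) (auto simp: inte)
  also have "\<dots> \<le> (exp (\<tau>\<^sup>2 * V)) ^ n" by (rule power_mono[OF e1 e0])
  also have "(exp (\<tau>\<^sup>2 * V)) ^ n = exp (real n * \<tau>\<^sup>2 * V)" by (simp add: exp_of_nat_mult[symmetric] mult.assoc)
  finally show ?thesis by (simp add: exp_diff divide_right_mono)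
qed

text \<open>The factor 2 accounts for the two tails, each covered by the one-sided bound for
  \<open>f b\<close> or its negative; finiteness of \<open>I\<close> makes the exceptional set
  measurable.\<close>

lemma chernoff_power_finite:
  fixes f :: "'b \<Rightarrow> 'a \<Rightarrow> real"
  assumes "finite I"
    and [measurable]: "\<And>b. b \<in> I \<Longrightarrow> f b \<in> borel_measurable M"
    and bd: "\<And>b. b \<in> I \<Longrightarrow> AE x in M. \<bar>f b x\<bar> \<le> B"
    and mean: "\<And>b. b \<in> I \<Longrightarrow> expectation (f b) = 0"
    and var: "\<And>b. b \<in> I \<Longrightarrow> expectation (\<lambda>x. (f b x)\<^sup>2) \<le> V"
    and \<tau>: "0 < \<tau>" "\<tau> * B \<le> 1"
  shows "whp (Pi\<^sub>M {..<n} (\<lambda>_. M)) (2 * real (card I) * exp (real n * \<tau>\<^sup>2 * V - \<tau> * a))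
           (\<lambda>\<omega>. \<forall>b\<in>I. \<bar>\<Sum>i<n. f b (\<omega> i)\<bar> \<le> a)"
proof -
  let ?P = "Pi\<^sub>M {..<n} (\<lambda>_. M)" and ?e = "exp (real n * \<tau>\<^sup>2 * V - \<tau> * a)"
  interpret P: prob_space ?P by (rule prob_space_power)
  let ?U = "\<lambda>b. {\<omega>\<in>space ?P. (\<Sum>i<n. f b (\<omega> i)) \<ge> a}"
  let ?L = "\<lambda>b. {\<omega>\<in>space ?P. (\<Sum>i<n. - f b (\<omega> i)) \<ge> a}"
  have UL: "?U b \<in> sets ?P" "?L b \<in> sets ?P" if [simp]: "b \<in> I" for b
    by measurable
  have "P.prob (?U b \<union> ?L b) \<le> 2 * ?e" if b: "b \<in> I" for b
  proof -
    have "P.prob (?U b \<union> ?L b) \<le> P.prob (?U b) + P.prob (?L b)"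
      using UL[OF b] by (intro measure_Un_le) auto
    also have "P.prob (?U b) \<le> ?e"
      using b bd[OF b] mean var \<tau> by (intro chernoff_power[where B = B]) auto
    also have "P.prob (?L b) \<le> ?e"
      using b bd[OF b] mean var \<tau> by (intro chernoff_power[where B = B and f = "\<lambda>x. - f b x"]) auto
    finally show ?thesis by simp
  qed
  then have "(\<Sum>b\<in>I. P.prob (?U b \<union> ?L b)) \<le> (\<Sum>b\<in>I. 2 * ?e)" by (rule sum_mono)
  moreover have "P.prob (\<Union>b\<in>I. ?U b \<union> ?L b) \<le> (\<Sum>b\<in>I. P.prob (?U b \<union> ?L b))"
    using UL assms(1) by (intro P.finite_measure_subadditive_finite) auto
  moreover have S: "(\<Union>b\<in>I. ?U b \<union> ?L b) \<in> sets ?P"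
    using UL assms(1) by (intro sets.finite_UN) auto
  moreover have "P.prob (space ?P - (\<Union>b\<in>I. ?U b \<union> ?L b)) = 1 - P.prob (\<Union>b\<in>I. ?U b \<union> ?L b)"
    by (rule P.prob_compl[OF S])
  ultimately have "P.prob (space ?P - (\<Union>b\<in>I. ?U b \<union> ?L b)) \<ge> 1 - 2 * real (card I) * ?e" by simp
  then show ?thesis
    unfolding whp_def
  proof (intro bexI[of _ "space ?P - (\<Union>b\<in>I. ?U b \<union> ?L b)"] conjI ballI)
    fix \<omega> b assume "\<omega> \<in> space ?P - (\<Union>b\<in>I. ?U b \<union> ?L b)" "b \<in> I"
    then have "\<omega> \<notin> ?U b" "\<omega> \<notin> ?L b" "\<omega> \<in> space ?P" by blast+
    then show "\<bar>\<Sum>i<n. f b (\<omega> i)\<bar> \<le> a" by (simp add: sum_negf abs_le_iff)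
  qed (use S in auto)
qed

lemma lln_power:
  fixes f :: "'a \<Rightarrow> real"
  assumes [measurable]: "f \<in> borel_measurable M" and bd: "AE x in M. \<bar>f x\<bar> \<le> B"
    and "0 < B" "0 < \<kappa>" "\<kappa> \<le> 4 * B" "0 < n"
  shows "whp (Pi\<^sub>M {..<n} (\<lambda>_. M)) (2 * exp (- real n * \<kappa>\<^sup>2 / (16 * B\<^sup>2)))
           (\<lambda>\<omega>. \<bar>(\<Sum>i<n. f (\<omega> i)) / real n - expectation f\<bar> \<le> \<kappa>)"
proof -
  define h where "h = (\<lambda>x. f x - expectation f)"
  have [measurable]: "h \<in> borel_measurable M" by (simp add: h_def)
  have intf: "integrable M f" by (rule integrable_AE_bounded[OF _ bd]) simp
  have "\<bar>expectation f\<bar> \<le> expectation (\<lambda>x. \<bar>f x\<bar>)"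
    using integral_norm_bound[of M f] by simp
  also have "\<dots> \<le> B" using bd by (intro integral_le_const) (auto simp: intf)
  finally have Ef: "\<bar>expectation f\<bar> \<le> B" .
  have hbd: "AE x in M. \<bar>h x\<bar> \<le> 2 * B" using bd by eventually_elim (use Ef in \<open>auto simp: h_def\<close>)
  have h2bd: "AE x in M. (h x)\<^sup>2 \<le> 4 * B\<^sup>2" using hbd
  proof eventually_elim
    case (elim x)
    have "\<bar>h x\<bar>\<^sup>2 \<le> (2 * B)\<^sup>2" using elim by (intro power_mono) auto
    then show ?case by (simp add: power_mult_distrib)
  qed
  have hm: "expectation h = 0" using intf by (simp add: h_def prob_space)
  have "integrable M (\<lambda>x. (h x)\<^sup>2)"
    using h2bd by (intro integrable_AE_bounded[where B = "4 * B\<^sup>2"]) auto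
  then have hv: "expectation (\<lambda>x. (h x)\<^sup>2) \<le> 4 * B\<^sup>2"
    by (rule integral_le_const) (rule h2bd)
  \<comment> \<open>The exponent \<open>\<kappa> / (8 * B^2)\<close> minimises
    \<open>n * \<tau>^2 * (4 * B^2) - \<tau> * n * \<kappa>\<close>, with minimum
    \<open>- n * \<kappa>^2 / (16 * B^2)\<close>. Since \<open>h\<close> is bounded by
    \<open>2 * B\<close>, its admissibility is the hypothesis
    \<open>\<kappa> \<le> 4 * B\<close>.\<close>
  have "whp (Pi\<^sub>M {..<n} (\<lambda>_. M))
     (2 * real (card {()}) * exp (real n * (\<kappa> / (8 * B\<^sup>2))\<^sup>2 * (4 * B\<^sup>2) - \<kappa> / (8 * B\<^sup>2) * (real n * \<kappa>)))
     (\<lambda>\<omega>. \<forall>b\<in>{()}. \<bar>\<Sum>i<n. h (\<omega> i)\<bar> \<le> real n * \<kappa>)"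
    using assms hbd hm hv by (intro chernoff_power_finite[where B = "2 * B"])
       (auto simp: power2_eq_square field_simps)
  then show ?thesis
  proof (rule whp_mono)
    show "2 * real (card {()}) * exp (real n * (\<kappa> / (8 * B\<^sup>2))\<^sup>2 * (4 * B\<^sup>2) - \<kappa> / (8 * B\<^sup>2) * (real n * \<kappa>))
       \<le> 2 * exp (- real n * \<kappa>\<^sup>2 / (16 * B\<^sup>2))"
      using \<open>0 < B\<close> by (simp add: power2_eq_square field_simps)
    fix \<omega> assume "\<forall>b\<in>{()}. \<bar>\<Sum>i<n. h (\<omega> i)\<bar> \<le> real n * \<kappa>"
    then have "\<bar>(\<Sum>i<n. h (\<omega> i)) / real n\<bar> \<le> \<kappa>"
      using \<open>0 < n\<close> by (simp add: field_simps)
    then show "\<bar>(\<Sum>i<n. f (\<omega> i)) / real n - expectation f\<bar> \<le> \<kappa>"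
      using \<open>0 < n\<close> by (simp add: h_def sum_subtractf diff_divide_distrib)
  qed
qed

end

section \<open>A central limit theorem for bounded arrays\<close>

text \<open>The law may change from row to row and the row lengths need only diverge, because the
  counterexamples to uniformity arrive with such lengths. Boundedness makes the third-order
  remainder of each characteristic function of order \<open>N powr (-3/2)\<close>, so the product of
  \<open>N\<close> factors is off by order \<open>N powr (-1/2)\<close>.\<close>

lemma clt_power_array:
  fixes Q :: "nat \<Rightarrow> 'a measure" and f :: "nat \<Rightarrow> 'a \<Rightarrow> real" and N :: "nat \<Rightarrow> nat"
  assumes N: "filterlim N at_top sequentially"
    and Q: "\<And>k. prob_space (Q k)"
    and meas: "\<And>k. f k \<in> borel_measurable (Q k)"
    and bd: "\<And>k. AE x in Q k. \<bar>f k x\<bar> \<le> B"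
    and mean: "\<And>k. (\<integral>x. f k x \<partial>Q k) = 0"
    and var: "\<And>k. (\<integral>x. (f k x)\<^sup>2 \<partial>Q k) = 1"
  shows "weak_conv_m (\<lambda>k. distr (Pi\<^sub>M {..<N k} (\<lambda>_. Q k)) borel (\<lambda>\<omega>. (\<Sum>i<N k. f k (\<omega> i)) / sqrt (real (N k))))
           std_normal_distribution"
proof (rule levy_continuity)
  let ?P = "\<lambda>k. Pi\<^sub>M {..<N k} (\<lambda>_. Q k)"
  let ?S = "\<lambda>k \<omega>. (\<Sum>i<N k. f k (\<omega> i)) / sqrt (real (N k))"
  note meas[measurable]
  have PP: "prob_space (?P k)" for k by (intro prob_space_PiM Q)
  show "real_distribution (distr (?P k) borel (?S k))" for k
    by (intro prob_space.real_distribution_distr PP) measurable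
  show "real_distribution std_normal_distribution" by (rule real_dist_normal_dist)
  fix t :: real
  let ?u = "\<lambda>k. t / sqrt (real (N k))"
  let ?c = "\<lambda>k. char (distr (Q k) borel (f k)) (?u k)"
  have ceq: "char (distr (?P k) borel (?S k)) t = (?c k) ^ N k" for k
  proof -
    interpret prob_space "Q k" by (rule Q)
    interpret PS: product_sigma_finite "\<lambda>_::nat. Q k"
      by (simp add: product_sigma_finite_def sigma_finite_measure_axioms)
    have int: "integrable (Q k) (\<lambda>x. iexp (?u k * f k x))"
      by (intro integrable_const_bound[where B = 1]) auto
    have "char (distr (?P k) borel (?S k)) t = (CLINT \<omega>|?P k. iexp (t * ?S k \<omega>))"
      unfolding char_def by (rule integral_distr) measurable
    also have "\<dots> = (CLINT \<omega>|?P k. (\<Prod>i<N k. iexp (?u k * f k (\<omega> i))))"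
      by (simp add: sum_distrib_left sum_divide_distrib exp_sum)
    also have "\<dots> = (\<Prod>i<N k. CLINT x|Q k. iexp (?u k * f k x))"
      by (rule PS.product_integral_prod[OF _ int]) simp
    also have "\<dots> = (CLINT x|Q k. iexp (?u k * f k x)) ^ N k" by simp
    also have "(CLINT x|Q k. iexp (?u k * f k x)) = ?c k"
      unfolding char_def by (rule integral_distr[symmetric]) auto
    finally show ?thesis .
  qed
  \<comment> \<open>The condition \<open>N k \<ge> t^2 / 4\<close> puts
    \<open>1 - t^2 / (2 * N k)\<close> into \<open>[-1, 1]\<close>. With both bases in the unit
    disc, the powers differ by at most \<open>N k\<close> times the difference of the bases.\<close>
  have main: "cmod ((?c k) ^ N k - complex_of_real ((1 + (-(t\<^sup>2) / 2) / real (N k)) ^ N k)) \<le> \<bar>t\<bar> ^ 3 * \<bar>B\<bar> ^ 3 / 6 * (1 / sqrt (real (N k)))"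
    if Nk: "real (N k) > 0" "real (N k) \<ge> t\<^sup>2 / 4" for k
  proof -
    interpret prob_space "Q k" by (rule Q)
    interpret D: real_distribution "distr (Q k) borel (f k)" by (rule real_distribution_distr) simp
    let ?s = "sqrt (real (N k))"
    have i1: "integrable (Q k) (f k)" by (rule integrable_AE_bounded[OF _ bd]) simp
    have i2: "integrable (Q k) (\<lambda>x. (f k x)\<^sup>2)" by (rule integrable_square_AE_bounded[OF _ bd]) simp
    have "cmod (?c k - (1 - (?u k)\<^sup>2 * 1 / 2))
      \<le> (?u k)\<^sup>2 / 6 * expectation (\<lambda>x. min (6 * (f k x)\<^sup>2) (\<bar>?u k\<bar> * \<bar>f k x\<bar> ^ 3))"
      using i1 i2 mean var by (intro char_approx3'[where X = "f k"]) auto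
    also have "\<dots> \<le> (?u k)\<^sup>2 / 6 * (\<bar>?u k\<bar> * \<bar>B\<bar> ^ 3)"
    proof (intro mult_left_mono integral_le_const)
      have b3: "AE x in Q k. min (6 * (f k x)\<^sup>2) (\<bar>?u k\<bar> * \<bar>f k x\<bar> ^ 3) \<le> \<bar>?u k\<bar> * \<bar>B\<bar> ^ 3"
        using bd
      proof eventually_elim
        case (elim x)
        then have "\<bar>f k x\<bar> ^ 3 \<le> \<bar>B\<bar> ^ 3" by (intro power_mono) auto
        then have "\<bar>?u k\<bar> * \<bar>f k x\<bar> ^ 3 \<le> \<bar>?u k\<bar> * \<bar>B\<bar> ^ 3" by (intro mult_left_mono) auto
        then show ?case by simp
      qed
      then show "AE x in Q k. min (6 * (f k x)\<^sup>2) (\<bar>?u k\<bar> * \<bar>f k x\<bar> ^ 3) \<le> \<bar>?u k\<bar> * \<bar>B\<bar> ^ 3" .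
      have "AE x in Q k. \<bar>min (6 * (f k x)\<^sup>2) (\<bar>?u k\<bar> * \<bar>f k x\<bar> ^ 3)\<bar> \<le> \<bar>?u k\<bar> * \<bar>B\<bar> ^ 3"
        using b3 by eventually_elim (subst abs_of_nonneg, auto)
      then show "integrable (Q k) (\<lambda>x. min (6 * (f k x)\<^sup>2) (\<bar>?u k\<bar> * \<bar>f k x\<bar> ^ 3))"
        by (rule integrable_AE_bounded[rotated]) measurable
    qed auto
    finally have a: "cmod (?c k - (1 - (?u k)\<^sup>2 / 2)) \<le> (?u k)\<^sup>2 / 6 * (\<bar>?u k\<bar> * \<bar>B\<bar> ^ 3)" by simp
    have u2: "(?u k)\<^sup>2 = t\<^sup>2 / real (N k)" using Nk by (simp add: power_divide)
    have e1: "complex_of_real (1 + (-(t\<^sup>2) / 2) / real (N k)) = 1 - (?u k)\<^sup>2 / 2"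
      unfolding u2 by simp
    have "cmod ((?c k) ^ N k - (complex_of_real (1 + (-(t\<^sup>2) / 2) / real (N k))) ^ N k)
       \<le> real (N k) * cmod (?c k - complex_of_real (1 + (-(t\<^sup>2) / 2) / real (N k)))"
      using Nk by (intro norm_power_diff D.cmod_char_le_1)
        (auto simp del: of_real_diff simp: of_real_diff[symmetric] divide_le_eq intro!: abs_leI)
    also have "\<dots> \<le> real (N k) * ((?u k)\<^sup>2 / 6 * (\<bar>?u k\<bar> * \<bar>B\<bar> ^ 3))"
      unfolding e1 using a by (intro mult_left_mono) auto
    also have "\<dots> = t\<^sup>2 * \<bar>t\<bar> * \<bar>B\<bar> ^ 3 / 6 * (1 / ?s)"
      unfolding u2 using Nk by (simp add: field_simps)
    also have "t\<^sup>2 * \<bar>t\<bar> = \<bar>t\<bar> ^ 3" by (simp add: power3_eq_cube power2_eq_square abs_mult_self_eq)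
    finally show ?thesis by simp
  qed
  have NR: "filterlim (\<lambda>k. real (N k)) at_top sequentially"
    by (rule filterlim_compose[OF filterlim_real_sequentially N])
  have ev: "\<forall>\<^sub>F k in sequentially. cmod ((?c k) ^ N k - complex_of_real ((1 + (-(t\<^sup>2) / 2) / real (N k)) ^ N k))
       \<le> \<bar>t\<bar> ^ 3 * \<bar>B\<bar> ^ 3 / 6 * (1 / sqrt (real (N k)))"
  proof -
    have "\<forall>\<^sub>F k in sequentially. real (N k) \<ge> max 1 (t\<^sup>2 / 4)"
      using NR unfolding filterlim_at_top by blast
    then show ?thesis by eventually_elim (rule main; simp)
  qed
  have z: "(\<lambda>k. \<bar>t\<bar> ^ 3 * \<bar>B\<bar> ^ 3 / 6 * (1 / sqrt (real (N k)))) \<longlonglongrightarrow> 0"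
    by (intro tendsto_mult_right_zero tendsto_divide_0[OF tendsto_const] filterlim_at_top_imp_at_infinity
          filterlim_compose[OF sqrt_at_top NR])
  have "(\<lambda>n::nat. (1 + (-(t\<^sup>2) / 2) / real n) ^ n) \<longlonglongrightarrow> exp (-(t\<^sup>2) / 2)"
    by (rule tendsto_exp_limit_sequentially)
  then have "(\<lambda>k. (1 + (-(t\<^sup>2) / 2) / real (N k)) ^ N k) \<longlonglongrightarrow> exp (-(t\<^sup>2) / 2)"
    using N by (rule filterlim_compose)
  then have "(\<lambda>k. complex_of_real ((1 + (-(t\<^sup>2) / 2) / real (N k)) ^ N k)) \<longlonglongrightarrow> complex_of_real (exp (-(t\<^sup>2) / 2))"
    by (rule tendsto_of_real)
  then have "(\<lambda>k. (?c k) ^ N k) \<longlonglongrightarrow> complex_of_real (exp (-(t\<^sup>2) / 2))"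
    by (rule Lim_transform) (rule Lim_null_comparison[OF ev z])
  then show "(\<lambda>k. char (distr (?P k) borel (?S k)) t) \<longlonglongrightarrow> char std_normal_distribution t"
    by (simp add: ceq char_std_normal_distribution)
qed

section \<open>The standard normal distribution function\<close>

interpretation std_normal: real_distribution std_normal_distribution
  by (rule real_dist_normal_dist)

lemma isCont_cdf_std_normal: "isCont (cdf std_normal_distribution) x"
proof -
  have "emeasure std_normal_distribution {x} = 0"
    by (subst emeasure_density) (auto intro!: nn_integral_null_set simp: null_sets_def nn_integral_null_set)
  then show ?thesis by (simp add: std_normal.isCont_cdf measure_def)
qed

text \<open>The characteristic function is even, so the law is invariant under negation. Reflection
  maps \<open>{..- x}\<close> to the complement of \<open>{..<x}\<close>, and continuity identifies
  the mass of \<open>{..<x}\<close> with the distribution function at \<open>x\<close>.\<close>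

lemma cdf_std_normal_minus: "cdf std_normal_distribution (- x) = 1 - cdf std_normal_distribution x"
proof -
  let ?N = "std_normal_distribution"
  have "distr ?N borel uminus = ?N"
  proof (rule Levy_uniqueness)
    show "real_distribution (distr ?N borel uminus)" by (rule std_normal.real_distribution_distr) simp
    show "real_distribution ?N" by (rule real_dist_normal_dist)
    have "char (distr ?N borel uminus) t = char ?N (- t)" for t
      unfolding char_def by (subst integral_distr) auto
    then show "char (distr ?N borel uminus) = char ?N"
      by (auto simp: char_std_normal_distribution)
  qed
  then have "cdf ?N (- x) = measure (distr ?N borel uminus) {..- x}" by (simp add: cdf_def)
  also have "\<dots> = measure ?N (uminus -` {..- x} \<inter> space ?N)"
    by (rule measure_distr) auto
  also have "uminus -` {..- x} \<inter> space ?N = UNIV - {..<x}" by auto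
  also have "measure ?N (UNIV - {..<x}) = 1 - measure ?N {..<x}"
    using std_normal.prob_compl[of "{..<x}"] by simp
  also have "measure ?N {..<x} = cdf ?N x"
  proof -
    have "(cdf ?N \<longlongrightarrow> cdf ?N x) (at_left x)"
      using isCont_cdf_std_normal[of x] by (simp add: isCont_def filterlim_at_split)
    then show ?thesis using std_normal.cdf_at_left[of x] tendsto_unique[OF trivial_limit_at_left_real] by blast
  qed
  finally show ?thesis .
qed

text \<open>The density is positive everywhere, so an interval of normal measure zero would have
  Lebesgue measure zero.\<close>

lemma cdf_std_normal_strict_mono:
  assumes "x < y" shows "cdf std_normal_distribution x < cdf std_normal_distribution y"
proof -
  let ?N = "std_normal_distribution"
  have "emeasure ?N {x<..y} \<noteq> 0"
  proof
    assume "emeasure ?N {x<..y} = 0"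
    then have "AE t in lborel. t \<notin> {x<..y}"
      by (subst (asm) emeasure_density) (auto simp: nn_integral_0_iff_AE indicator_def normal_density_pos[THEN less_imp_neq, symmetric] split: if_splits)
    then have "emeasure lborel {x<..y} = 0"
      by (subst (asm) AE_iff_measurable[of "{x<..y}"]) auto
    with assms show False by simp
  qed
  then have "measure ?N {x<..y} > 0"
    by (simp add: std_normal.emeasure_eq_measure zero_less_measure_iff)
  then show ?thesis using std_normal.cdf_diff_eq[OF assms] by simp
qed

text \<open>The limits at both ends and the intermediate value theorem give a root; strict
  monotonicity makes it unique, as the definite description in \<open>Phi_inv\<close>
  demands.\<close>

lemma cdf_std_normal_Phi_inv:
  assumes "0 < q" "q < 1" shows "cdf std_normal_distribution (Phi_inv q) = q"
proof -
  let ?F = "cdf std_normal_distribution"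
  have "\<forall>\<^sub>F x in at_bot. ?F x < q"
    using std_normal.cdf_lim_at_bot assms by (auto simp: order_tendsto_iff)
  then obtain a where a: "?F a < q" using eventually_happens[of _ "at_bot::real filter"] by auto
  have "\<forall>\<^sub>F x in at_top. ?F x > q"
    using std_normal.cdf_lim_at_top_prob assms by (auto simp: order_tendsto_iff)
  then obtain b where b: "?F b > q" using eventually_happens[of _ "at_top::real filter"] by auto
  have "a \<le> b" using a b std_normal.cdf_nondecreasing[of b a] by linarith
  then obtain x where x: "?F x = q"
    using IVT[of ?F a q b] a b isCont_cdf_std_normal by auto
  moreover have "z = x" if "?F z = q" for z
    using cdf_std_normal_strict_mono[of x z] cdf_std_normal_strict_mono[of z x] x that by (cases z x rule: linorder_cases) auto
  ultimately show ?thesis unfolding Phi_inv_def by (rule theI[where P = "\<lambda>x. ?F x = q"])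
qed

section \<open>Normal approximation uniform in the law, and Slutsky's argument\<close>

lemma clt_power_uniform:
  fixes B x \<epsilon> :: real
  assumes "\<epsilon> > 0"
  shows "\<forall>\<^sub>F n in sequentially. \<forall>(Q :: 'a measure) f. prob_space Q \<and> f \<in> borel_measurable Q
    \<and> (AE x in Q. \<bar>f x\<bar> \<le> B) \<and> (\<integral>x. f x \<partial>Q) = 0 \<and> (\<integral>x. (f x)\<^sup>2 \<partial>Q) = 1 \<longrightarrow>
      \<bar>measure (Pi\<^sub>M {..<n} (\<lambda>_. Q)) {\<omega> \<in> space (Pi\<^sub>M {..<n} (\<lambda>_. Q)). (\<Sum>i<n. f (\<omega> i)) / sqrt (real n) \<le> x}
        - cdf std_normal_distribution x\<bar> \<le> \<epsilon>"
    (is "\<forall>\<^sub>F n in sequentially. \<forall>Q f. ?H Q f \<longrightarrow> ?R n Q f")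
proof (rule ccontr)
  assume "\<not> ?thesis"
  then have "\<forall>k. \<exists>n Q f. n \<ge> k \<and> ?H Q f \<and> \<not> ?R n Q f"
    unfolding eventually_sequentially by blast
  then obtain N where "\<forall>k. \<exists>Q f. N k \<ge> k \<and> ?H Q f \<and> \<not> ?R (N k) Q f"
    using choice[of "\<lambda>k n. \<exists>Q f. n \<ge> k \<and> ?H Q f \<and> \<not> ?R n Q f"] by blast
  then obtain Q where "\<forall>k. \<exists>f. N k \<ge> k \<and> ?H (Q k) f \<and> \<not> ?R (N k) (Q k) f"
    using choice[of "\<lambda>k Q. \<exists>f. N k \<ge> k \<and> ?H Q f \<and> \<not> ?R (N k) Q f"] by blast
  then obtain f where *: "\<And>k. N k \<ge> k" "\<And>k. ?H (Q k) (f k)" "\<And>k. \<not> ?R (N k) (Q k) (f k)"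
    using choice[of "\<lambda>k f. N k \<ge> k \<and> ?H (Q k) f \<and> \<not> ?R (N k) (Q k) f"] by blast
  let ?P = "\<lambda>k. Pi\<^sub>M {..<N k} (\<lambda>_. Q k)"
  let ?S = "\<lambda>k \<omega>. (\<Sum>i<N k. f k (\<omega> i)) / sqrt (real (N k))"
  have N: "filterlim N at_top sequentially"
    by (rule filterlim_at_top_mono[OF filterlim_ident]) (use *(1) in auto)
  have meas[measurable]: "f k \<in> borel_measurable (Q k)" for k using *(2) by auto
  have "weak_conv_m (\<lambda>k. distr (?P k) borel (?S k)) std_normal_distribution"
    using *(2) by (intro clt_power_array[where B = B] N) auto
  then have "(\<lambda>k. cdf (distr (?P k) borel (?S k)) x) \<longlonglongrightarrow> cdf std_normal_distribution x"
    using isCont_cdf_std_normal by (auto simp: weak_conv_m_def weak_conv_def)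
  then have "\<forall>\<^sub>F k in sequentially. dist (cdf (distr (?P k) borel (?S k)) x) (cdf std_normal_distribution x) < \<epsilon>"
    using assms by (rule tendstoD)
  then obtain k where k: "dist (cdf (distr (?P k) borel (?S k)) x) (cdf std_normal_distribution x) < \<epsilon>"
    using eventually_happens[of _ sequentially] by auto
  have "cdf (distr (?P k) borel (?S k)) x = measure (?P k) (?S k -` {..x} \<inter> space (?P k))"
    unfolding cdf_def by (rule measure_distr) measurable
  also have "?S k -` {..x} \<inter> space (?P k) = {\<omega> \<in> space (?P k). ?S k \<omega> \<le> x}" by auto
  finally show False using k *(3)[of k] by (simp add: dist_real_def)
qed

text \<open>Outside an event of mass \<open>\<eta>\<close>, \<open>Z \<le> x - \<eta>\<close> forces
  \<open>T < x\<close>, and \<open>T \<le> x\<close> forces \<open>Z \<le> x + \<eta>\<close>. Three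
  errors of size \<open>\<epsilon>\<close> add up: the distribution function of \<open>Z\<close>,
  the increment of \<open>F\<close> and the exceptional mass. The bound for the strict event is what
  the left endpoint of a two-sided interval calls for.\<close>

lemma cdf_perturb:
  fixes T Z :: "'a \<Rightarrow> real"
  assumes "prob_space M" and [measurable]: "T \<in> borel_measurable M" "Z \<in> borel_measurable M"
    and w: "whp M \<eta> (\<lambda>\<omega>. \<bar>T \<omega> - Z \<omega>\<bar> < \<eta>)" and "\<eta> \<le> \<epsilon>"
    and u: "\<bar>measure M {\<omega>\<in>space M. Z \<omega> \<le> x + \<eta>} - F (x + \<eta>)\<bar> \<le> \<epsilon>" "\<bar>F (x + \<eta>) - F x\<bar> \<le> \<epsilon>"
    and l: "\<bar>measure M {\<omega>\<in>space M. Z \<omega> \<le> x - \<eta>} - F (x - \<eta>)\<bar> \<le> \<epsilon>" "\<bar>F (x - \<eta>) - F x\<bar> \<le> \<epsilon>"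
  shows "\<bar>measure M {\<omega>\<in>space M. T \<omega> \<le> x} - F x\<bar> \<le> 3 * \<epsilon>" "\<bar>measure M {\<omega>\<in>space M. T \<omega> < x} - F x\<bar> \<le> 3 * \<epsilon>"
proof -
  interpret prob_space M by fact
  obtain E where E[measurable]: "E \<in> sets M" and pE: "prob E \<ge> 1 - \<eta>" and ET: "\<And>\<omega>. \<omega> \<in> E \<Longrightarrow> \<bar>T \<omega> - Z \<omega>\<bar> < \<eta>"
    using w by (auto simp: whp_def)
  have cE: "prob (space M - E) \<le> \<eta>" using pE prob_compl[OF E] by simp
  have "prob {\<omega>\<in>space M. T \<omega> \<le> x} \<le> prob ({\<omega>\<in>space M. Z \<omega> \<le> x + \<eta>} \<union> (space M - E))"
    using ET by (intro finite_measure_mono) (force simp: abs_less_iff)+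
  also have "\<dots> \<le> prob {\<omega>\<in>space M. Z \<omega> \<le> x + \<eta>} + prob (space M - E)"
    by (intro measure_Un_le) auto
  finally have 1: "prob {\<omega>\<in>space M. T \<omega> \<le> x} \<le> prob {\<omega>\<in>space M. Z \<omega> \<le> x + \<eta>} + \<eta>" using cE by simp
  have "prob {\<omega>\<in>space M. Z \<omega> \<le> x - \<eta>} \<le> prob ({\<omega>\<in>space M. T \<omega> < x} \<union> (space M - E))"
    using ET by (intro finite_measure_mono) (force simp: abs_less_iff)+
  also have "\<dots> \<le> prob {\<omega>\<in>space M. T \<omega> < x} + prob (space M - E)"
    by (intro measure_Un_le) auto
  finally have 2: "prob {\<omega>\<in>space M. Z \<omega> \<le> x - \<eta>} \<le> prob {\<omega>\<in>space M. T \<omega> < x} + \<eta>" using cE by simp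
  have 3: "prob {\<omega>\<in>space M. T \<omega> < x} \<le> prob {\<omega>\<in>space M. T \<omega> \<le> x}"
    by (intro finite_measure_mono) auto
  show "\<bar>prob {\<omega>\<in>space M. T \<omega> \<le> x} - F x\<bar> \<le> 3 * \<epsilon>" "\<bar>prob {\<omega>\<in>space M. T \<omega> < x} - F x\<bar> \<le> 3 * \<epsilon>"
    using 1 2 3 u l \<open>\<eta> \<le> \<epsilon>\<close> by linarith+
qed

section \<open>Nets of sparse vectors\<close>

lemma ip_diff: "ip p x (\<lambda>j. a j - b j) = ip p x a - ip p x b"
  by (simp add: ip_def sum_subtractf algebra_simps)

lemma abs_ip_le_l1:
  assumes "\<And>j. j < p \<Longrightarrow> \<bar>x j\<bar> \<le> K"
  shows "\<bar>ip p x b\<bar> \<le> K * l1 p b"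
proof -
  have "\<bar>ip p x b\<bar> \<le> (\<Sum>j<p. \<bar>x j * b j\<bar>)" unfolding ip_def by (rule sum_abs)
  also have "\<dots> \<le> (\<Sum>j<p. K * \<bar>b j\<bar>)"
    using assms by (intro sum_mono) (auto simp: abs_mult intro!: mult_right_mono)
  finally show ?thesis by (simp add: l1_def sum_distrib_left)
qed

lemma l0_diff_le: "l0 p (\<lambda>j. a j - b j) \<le> l0 p a + l0 p b"
proof -
  have "l0 p (\<lambda>j. a j - b j) \<le> card ({j. j < p \<and> a j \<noteq> 0} \<union> {j. j < p \<and> b j \<noteq> 0})"
    unfolding l0_def by (intro card_mono) auto
  also have "\<dots> \<le> l0 p a + l0 p b" unfolding l0_def by (rule card_Un_le)
  finally show ?thesis .
qed

text \<open>Position \<open>p\<close> of the association lists is a dummy that pads them to length exactly \<open>k\<close>.\<close>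
definition sparse_net :: "nat \<Rightarrow> nat \<Rightarrow> real \<Rightarrow> nat \<Rightarrow> (nat \<Rightarrow> real) set" where
  "sparse_net p k h M =
     (\<lambda>xs j. case map_of xs j of None \<Rightarrow> 0 | Some a \<Rightarrow> h * real_of_int a) `
       {xs. set xs \<subseteq> {..p} \<times> {- int M..int M} \<and> length xs = k}"

lemma finite_sparse_net: "finite (sparse_net p k h M)"
  unfolding sparse_net_def by (intro finite_imageI finite_lists_length_eq) simp

lemma card_sparse_net: "card (sparse_net p k h M) \<le> ((p + 1) * (2 * M + 1)) ^ k"
proof -
  have "card (sparse_net p k h M) \<le> card {xs. set xs \<subseteq> {..p} \<times> {- int M..int M} \<and> length xs = k}"
    unfolding sparse_net_def by (intro card_image_le finite_lists_length_eq) simp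
  also have "\<dots> = card ({..p} \<times> {- int M..int M}) ^ k"
    by (intro card_lists_length_eq) simp
  also have "card ({..p} \<times> {- int M..int M}) = (p + 1) * (2 * M + 1)"
    by (simp add: card_cartesian_product nat_add_distrib nat_mult_distrib)
  finally show ?thesis .
qed

text \<open>Coordinates are rounded on the scale of \<open>K * b\<close>, so the error is uniform over all regressors
  bounded by \<open>K\<close>; for \<open>K = 0\<close> the mesh \<open>\<eta> / K\<close> is \<open>0\<close> and both inner products vanish.\<close>
lemma sparse_net_approx:
  assumes l0: "l0 p b \<le> k" and "0 < \<eta>" and K: "0 < p \<Longrightarrow> 0 \<le> K" and l1: "K * l1 p b \<le> \<delta>"
    and M: "\<delta> / \<eta> + 1 \<le> real M"
  obtains b' where "b' \<in> sparse_net p k (\<eta> / K) M"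
    and "\<And>x. (\<And>j. j < p \<Longrightarrow> \<bar>x j\<bar> \<le> K) \<Longrightarrow> \<bar>ip p x b - ip p x b'\<bar> \<le> real k * \<eta>"
proof -
  define S where "S = {j. j < p \<and> b j \<noteq> 0}"
  have finS: "finite S" and cS: "card S \<le> k" using l0 by (auto simp: S_def l0_def)
  obtain js where js: "set js = S" "distinct js" using finite_distinct_list[OF finS] by auto
  have len: "length js = card S" using js distinct_card by force
  \<comment> \<open>Since \<open>K * l1 p b \<le> \<delta>\<close>, the scaled coordinates are at
    most \<open>\<delta> / \<eta>\<close> in absolute value; rounding down shifts them by less than
    one, which the \<open>+ 1\<close> in the hypothesis on \<open>M\<close> covers.\<close>
  define a where "a j = \<lfloor>K * b j / \<eta>\<rfloor>" for j
  have aM: "a j \<in> {- int M..int M}" if "j \<in> S" for j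
  proof -
    have jp: "j < p" using that by (simp add: S_def)
    then have K0: "0 \<le> K" using K by simp
    have "\<bar>b j\<bar> \<le> l1 p b" unfolding l1_def using jp by (intro member_le_sum) auto
    then have "K * \<bar>b j\<bar> \<le> K * l1 p b" using K0 by (rule mult_left_mono)
    then have "\<bar>K * b j\<bar> \<le> \<delta>" using l1 K0 by (simp add: abs_mult)
    then have "\<bar>K * b j / \<eta>\<bar> \<le> \<delta> / \<eta>" using \<open>0 < \<eta>\<close> by (simp add: divide_right_mono)
    then have "\<bar>K * b j / \<eta>\<bar> + 1 \<le> real M" using M by linarith
    then have "- real M \<le> real_of_int (a j)" "real_of_int (a j) \<le> real M"
      unfolding a_def by linarith+
    then have "- int M \<le> a j" "a j \<le> int M" by linarith+
    then show ?thesis by simp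
  qed
  define xs where "xs = map (\<lambda>j. (j, a j)) js @ replicate (k - card S) (p, 0)"
  define b' where "b' = (\<lambda>j. case map_of xs j of None \<Rightarrow> 0 | Some i \<Rightarrow> \<eta> / K * real_of_int i)"
  have "set xs \<subseteq> {..p} \<times> {- int M..int M}"
  proof -
    have "set (map (\<lambda>j. (j, a j)) js) \<subseteq> {..p} \<times> {- int M..int M}"
    proof
      fix t assume "t \<in> set (map (\<lambda>j. (j, a j)) js)"
      then obtain j where j: "j \<in> S" "t = (j, a j)" using js(1) by auto
      then have "j \<le> p" by (simp add: S_def)
      then show "t \<in> {..p} \<times> {- int M..int M}" using j aM[OF j(1)] by simp
    qed
    moreover have "set (replicate (k - card S) (p, 0::int)) \<subseteq> {..p} \<times> {- int M..int M}" by auto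
    ultimately show ?thesis unfolding xs_def set_append by blast
  qed
  moreover have "length xs = k" using cS len by (simp add: xs_def)
  ultimately have in_net: "b' \<in> sparse_net p k (\<eta> / K) M"
    unfolding sparse_net_def b'_def by (intro image_eqI[OF refl]) simp
  have b': "b' j = (if j \<in> S then \<eta> / K * real_of_int (a j) else 0)" if "j < p" for j
  proof -
    have "map_of xs j = (if j \<in> S then Some (a j) else None)"
    proof (cases "j \<in> S")
      case True
      then have "map_of (map (\<lambda>j. (j, a j)) js) j = Some (a j)"
        using js by (simp add: map_of_map_restrict)
      then show ?thesis using True by (simp add: xs_def map_add_def split: option.split)
    next
      case False
      then have "j \<notin> fst ` set xs" using that js by (auto simp: xs_def image_iff)
      then show ?thesis using False by (simp add: map_of_eq_None_iff)
    qed
    then show ?thesis by (simp add: b'_def)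
  qed
  have "\<bar>ip p x b - ip p x b'\<bar> \<le> real k * \<eta>" if x: "\<And>j. j < p \<Longrightarrow> \<bar>x j\<bar> \<le> K" for x
  proof -
    have t: "\<bar>x j * (b j - b' j)\<bar> \<le> (if j \<in> S then \<eta> else 0)" if jp: "j < p" for j
    proof (cases "j \<in> S")
      case True
      have K0: "0 \<le> K" using K jp by simp
      have "\<bar>x j * (b j - b' j)\<bar> \<le> K * \<bar>b j - b' j\<bar>"
        using x[OF jp] by (simp add: abs_mult mult_right_mono)
      also have "\<dots> \<le> \<eta>"
      proof (cases "K = 0")
        case False
        have "K * \<bar>b j - b' j\<bar> = \<bar>K * b j - \<eta> * real_of_int (a j)\<bar>"
          using K0 False b'[OF jp] True by (simp add: abs_mult_pos' right_diff_distrib)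
        also have "\<dots> = \<eta> * \<bar>K * b j / \<eta> - real_of_int (a j)\<bar>"
          using \<open>0 < \<eta>\<close> by (simp add: abs_mult_pos' right_diff_distrib)
        also have "\<dots> \<le> \<eta> * 1"
          using \<open>0 < \<eta>\<close> unfolding a_def by (intro mult_left_mono) linarith+
        finally show ?thesis by simp
      qed (use \<open>0 < \<eta>\<close> in simp)
      finally show ?thesis using True by simp
    next
      case False
      then show ?thesis using b'[OF jp] jp by (simp add: S_def)
    qed
    have "\<bar>ip p x b - ip p x b'\<bar> = \<bar>\<Sum>j<p. x j * (b j - b' j)\<bar>"
      by (simp add: ip_def sum_subtractf right_diff_distrib)
    also have "\<dots> \<le> (\<Sum>j<p. \<bar>x j * (b j - b' j)\<bar>)" by (rule sum_abs)
    also have "\<dots> \<le> (\<Sum>j<p. if j \<in> S then \<eta> else 0)" using t by (intro sum_mono) auto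
    also have "\<dots> = real (card ({..<p} \<inter> S)) * \<eta>" by (simp add: sum.If_cases)
    also have "{..<p} \<inter> S = S" by (auto simp: S_def)
    also have "real (card S) * \<eta> \<le> real k * \<eta>" using cS \<open>0 < \<eta>\<close> by simp
    finally show ?thesis .
  qed
  with in_net show ?thesis by (rule that)
qed

section \<open>The model under overlap\<close>

text \<open>Gathers the restrictions that involve neither the sample size nor the estimators, so
  that the properties of the score can be derived for each law separately.\<close>

locale overlap_model =
  fixes Zs :: "'z measure" and G :: "'z dgp" and C c' :: real
  assumes model: "model Zs G" and C_pos: "0 < C" and c'_pos: "0 < c'" and c'_half: "c' < 1 / 2"
    and AE_g_le: "AE w in law G. \<bar>gfun G (dd w) (zz w)\<bar> \<le> C"
    and AE_y_le: "AE w in law G. \<bar>yy w\<bar> \<le> C"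
    and overlap: "measure (law G) {w \<in> space (law G). c' \<le> mfun G (zz w) \<and> mfun G (zz w) \<le> 1 - c'} = 1"
begin

abbreviation "Q \<equiv> law G"

definition \<zeta> :: "'z obs \<Rightarrow> real" where "\<zeta> w = yy w - gfun G (dd w) (zz w)"
definition g0 :: "'z obs \<Rightarrow> real" where "g0 w = gfun G 0 (zz w)"
definition m :: "'z obs \<Rightarrow> real" where "m w = mfun G (zz w)"

sublocale prob_space "law G"
  using model by (simp add: model_def Let_def)

lemma sets_Q [measurable_cong]: "sets Q = sets (borel \<Otimes>\<^sub>M (borel \<Otimes>\<^sub>M Zs))"
  using model by (simp add: model_def Let_def obs_space_def)

lemma measurable_obs [measurable]:
  "yy \<in> borel_measurable Q" "dd \<in> borel_measurable Q" "zz \<in> measurable Q Zs"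
  unfolding yy_def[abs_def] dd_def[abs_def] zz_def[abs_def] by measurable

lemma measurable_gfun2 [measurable]: "case_prod (gfun G) \<in> borel_measurable (borel \<Otimes>\<^sub>M Zs)"
  and measurable_mfun [measurable]: "mfun G \<in> borel_measurable Zs"
  using model by (simp_all add: model_def Let_def)

lemma measurable_gfun [measurable (raw)]:
  assumes [measurable]: "f \<in> borel_measurable M" "h \<in> measurable M Zs"
  shows "(\<lambda>x. gfun G (f x) (h x)) \<in> borel_measurable M"
proof -
  have "(\<lambda>x. case_prod (gfun G) (f x, h x)) \<in> borel_measurable M" by measurable
  then show ?thesis by simp
qed

lemma measurable_model [measurable]:
  "\<zeta> \<in> borel_measurable Q" "g0 \<in> borel_measurable Q" "m \<in> borel_measurable Q"
  unfolding \<zeta>_def[abs_def] g0_def[abs_def] m_def[abs_def] by measurable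

lemma AE_d: "AE w in Q. dd w \<in> {0, 1}"
  using model by (simp add: model_def Let_def)

lemma AE_m: "AE w in Q. c' \<le> m w \<and> m w \<le> 1 - c'"
proof -
  have "{w \<in> space Q. c' \<le> m w \<and> m w \<le> 1 - c'} \<in> events" by measurable
  then show ?thesis using overlap prob_Collect_eq_1[of "\<lambda>w. c' \<le> m w \<and> m w \<le> 1 - c'"] by (simp add: m_def)
qed

lemma AE_zeta_le: "AE w in Q. \<bar>\<zeta> w\<bar> \<le> 2 * C"
  using AE_g_le AE_y_le by eventually_elim (simp add: \<zeta>_def)

section \<open>Orthogonality and overlap\<close>

text \<open>By the tower property, because \<open>f (X w)\<close> is measurable for the
  sigma-algebra generated by \<open>X\<close>. This turns the two conditional mean restrictions into
  orthogonality to functions of the conditioning variables, the form in which they are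
  applied.\<close>

lemma integral_cond_exp_zero:
  assumes X[measurable]: "X \<in> measurable Q N" and f: "f \<in> borel_measurable N"
    and [measurable]: "h \<in> borel_measurable Q" and "integrable Q (\<lambda>w. f (X w) * h w)"
    and zero: "AE w in Q. real_cond_exp Q (vimage_algebra (space Q) X N) h w = 0"
  shows "(\<integral>w. f (X w) * h w \<partial>Q) = 0"
proof -
  let ?F = "vimage_algebra (space Q) X N"
  have XS: "X \<in> space Q \<rightarrow> space N" using measurable_space[OF X] by auto
  have "subalgebra Q ?F"
    unfolding subalgebra_def using X by (auto simp: sets_vimage_algebra2[OF XS] intro: measurable_sets)
  then interpret S: finite_measure_subalgebra Q ?F by unfold_locales
  have "(\<lambda>w. f (X w)) \<in> borel_measurable ?F"
    by (rule measurable_compose[OF measurable_vimage_algebra1[OF XS] f])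
  then have "(\<integral>w. f (X w) * h w \<partial>Q) = (\<integral>w. f (X w) * real_cond_exp Q ?F h w \<partial>Q)"
    using assms(3,4) by (intro S.real_cond_exp_intg(2)[symmetric]) auto
  also have "\<dots> = 0"
    using zero by (intro integral_eq_zero_AE) (auto elim: eventually_mono)
  finally show ?thesis .
qed

lemma integral_zeta_zero:
  assumes [measurable]: "f \<in> borel_measurable (borel \<Otimes>\<^sub>M Zs)" and bd: "AE w in Q. \<bar>f (dd w, zz w)\<bar> \<le> B"
  shows "(\<integral>w. f (dd w, zz w) * \<zeta> w \<partial>Q) = 0"
proof (rule integral_cond_exp_zero[where X = "\<lambda>w. (dd w, zz w)"])
  show "integrable Q (\<lambda>w. f (dd w, zz w) * \<zeta> w)"
  proof (rule integrable_AE_bounded[where B = "B * (2 * C)"])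
    show "AE w in Q. \<bar>f (dd w, zz w) * \<zeta> w\<bar> \<le> B * (2 * C)"
      using bd AE_zeta_le by eventually_elim (auto simp: abs_mult intro!: mult_mono)
  qed measurable
  show "AE w in Q. real_cond_exp Q (vimage_algebra (space Q) (\<lambda>w. (dd w, zz w)) (borel \<Otimes>\<^sub>M Zs)) \<zeta> w = 0"
    using model by (simp add: model_def Let_def \<zeta>_def[abs_def])
qed auto

lemma integral_v_zero:
  assumes [measurable]: "f \<in> borel_measurable Zs" and bd: "AE w in Q. \<bar>f (zz w)\<bar> \<le> B"
  shows "(\<integral>w. f (zz w) * (dd w - m w) \<partial>Q) = 0"
proof (rule integral_cond_exp_zero[where X = zz])
  show "integrable Q (\<lambda>w. f (zz w) * (dd w - m w))"
  proof (rule integrable_AE_bounded[where B = "B * 1"])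
    show "AE w in Q. \<bar>f (zz w) * (dd w - m w)\<bar> \<le> B * 1"
      using bd AE_d AE_m
    proof eventually_elim
      case (elim w)
      then have "\<bar>dd w - m w\<bar> \<le> 1" using c'_pos by auto
      then show ?case unfolding abs_mult using elim by (intro mult_mono) auto
    qed
  qed measurable
  show "AE w in Q. real_cond_exp Q (vimage_algebra (space Q) zz Zs) (\<lambda>w. dd w - m w) w = 0"
    using model by (simp add: model_def Let_def m_def[abs_def])
qed auto

text \<open>Orthogonality of \<open>d - m\<close> to functions of \<open>z\<close> replaces
  \<open>d\<close> by \<open>m\<close> under the integral, and both \<open>m\<close> and
  \<open>1 - m\<close> are at least \<open>c'\<close>. Second moments over one treatment arm thereby
  control those over the whole population.\<close>

lemma overlap_le:
  assumes [measurable]: "u \<in> borel_measurable Zs" and bd: "AE w in Q. \<bar>u (zz w)\<bar> \<le> B" and nn: "\<And>z. 0 \<le> u z"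
  shows "c' * (\<integral>w. u (zz w) \<partial>Q) \<le> (\<integral>w. dd w * u (zz w) \<partial>Q)"
    and "c' * (\<integral>w. u (zz w) \<partial>Q) \<le> (\<integral>w. (1 - dd w) * u (zz w) \<partial>Q)"
proof -
  have iu: "integrable Q (\<lambda>w. u (zz w))" by (rule integrable_AE_bounded[OF _ bd]) simp
  have id: "integrable Q (\<lambda>w. dd w * u (zz w))"
    using bd AE_d by (intro integrable_AE_bounded[where B = B]) (auto elim!: eventually_elim2)
  have im: "integrable Q (\<lambda>w. m w * u (zz w))"
  proof (rule integrable_AE_bounded[where B = B])
    show "AE w in Q. \<bar>m w * u (zz w)\<bar> \<le> B"
      using bd AE_m
    proof eventually_elim
      case (elim w)
      then have "\<bar>m w\<bar> * \<bar>u (zz w)\<bar> \<le> 1 * \<bar>u (zz w)\<bar>" using c'_pos by (intro mult_right_mono) auto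
      then show ?case using elim by (simp add: abs_mult)
    qed
  qed measurable
  have "(\<integral>w. u (zz w) * (dd w - m w) \<partial>Q) = 0" by (rule integral_v_zero[OF _ bd]) simp
  moreover have "(\<integral>w. u (zz w) * (dd w - m w) \<partial>Q) = (\<integral>w. dd w * u (zz w) \<partial>Q) - (\<integral>w. m w * u (zz w) \<partial>Q)"
    using id im by (simp add: algebra_simps)
  ultimately have eq: "(\<integral>w. dd w * u (zz w) \<partial>Q) = (\<integral>w. m w * u (zz w) \<partial>Q)" by simp
  have "(\<integral>w. c' * u (zz w) \<partial>Q) \<le> (\<integral>w. m w * u (zz w) \<partial>Q)"
    using iu im AE_m nn by (intro integral_mono_AE) (auto elim!: eventually_mono intro: mult_right_mono)
  then show "c' * (\<integral>w. u (zz w) \<partial>Q) \<le> (\<integral>w. dd w * u (zz w) \<partial>Q)"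
    using eq by simp
  have "(\<integral>w. c' * u (zz w) \<partial>Q) \<le> (\<integral>w. u (zz w) - m w * u (zz w) \<partial>Q)"
  proof (rule integral_mono_AE)
    show "AE w in Q. c' * u (zz w) \<le> u (zz w) - m w * u (zz w)"
      using AE_m
    proof eventually_elim
      case (elim w)
      then have "c' * u (zz w) \<le> (1 - m w) * u (zz w)" using nn by (intro mult_right_mono) auto
      then show ?case by (simp add: algebra_simps)
    qed
  qed (use iu im in auto)
  also have "\<dots> = (\<integral>w. (1 - dd w) * u (zz w) \<partial>Q)"
    using iu im id eq by (simp add: algebra_simps)
  finally show "c' * (\<integral>w. u (zz w) \<partial>Q) \<le> (\<integral>w. (1 - dd w) * u (zz w) \<partial>Q)" by simp
qed

text \<open>Overlap applied to the indicator of the exceptional set: if the untreated give it no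
  mass, nobody does. The conditions bound \<open>g\<close> and its approximation error at the
  observed treatment, while the score evaluates the untreated regression for everyone.\<close>

lemma AE_untreated_imp_AE:
  assumes "{z \<in> space Zs. R z} \<in> sets Zs" and "AE w in Q. dd w = 0 \<longrightarrow> R (zz w)"
  shows "AE w in Q. R (zz w)"
proof -
  let ?A = "space Zs - {z \<in> space Zs. R z}"
  let ?u = "indicator ?A :: 'z \<Rightarrow> real"
  have A[measurable]: "?A \<in> sets Zs" using assms(1) by auto
  have bd: "AE w in Q. \<bar>?u (zz w)\<bar> \<le> 1" by (auto simp: indicator_def)
  have zs: "zz w \<in> space Zs" if "w \<in> space Q" for w using that measurable_obs(3) by (meson measurable_space)
  have "(\<integral>w. (1 - dd w) * ?u (zz w) \<partial>Q) = 0"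
    using assms(2) AE_d AE_space by (intro integral_eq_zero_AE) (auto simp: zs indicator_def)
  then have "c' * (\<integral>w. ?u (zz w) \<partial>Q) \<le> 0" using overlap_le(2)[of ?u 1] bd by simp
  then have "(\<integral>w. ?u (zz w) \<partial>Q) \<le> 0" using c'_pos by (simp add: mult_le_0_iff)
  moreover have "(\<integral>w. ?u (zz w) \<partial>Q) \<ge> 0" by (intro Bochner_Integration.integral_nonneg) auto
  moreover have "integrable Q (\<lambda>w. ?u (zz w))" by (rule integrable_AE_bounded[OF _ bd]) measurable
  ultimately have "AE w in Q. ?u (zz w) = 0"
    by (subst (asm) order_antisym_conv) (auto simp: integral_nonneg_eq_0_iff_AE)
  then show ?thesis using AE_space by eventually_elim (auto simp: zs indicator_def split: if_splits)
qed

lemma AE_g0_le: "AE w in Q. \<bar>g0 w\<bar> \<le> C"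
  unfolding g0_def
  by (rule AE_untreated_imp_AE) (measurable, use AE_g_le in \<open>auto elim: eventually_mono\<close>)

end

section \<open>The simplified score, its centring and its variance\<close>

text \<open>The weight \<open>d - m * (1 - d) / (1 - m)\<close> equals
  \<open>(d - m) / (1 - m)\<close> as a rational identity, for every real \<open>d\<close>. When
  \<open>\<mu> = 0\<close>, both sides vanish by the convention for division.\<close>

lemma phi_t_eq:
  assumes "m \<noteq> 1"
  shows "phi_t \<gamma> y d g0 g1 m \<mu> = ((y - g0) * ((d - m) / (1 - m)) - \<gamma> * d) / \<mu>"
proof (cases "\<mu> = 0")
  case False
  have "(d - m) / (1 - m) = d - m * (1 - d) / (1 - m)" using assms by (simp add: field_simps)
  then show ?thesis using False assms unfolding phi_t_def
    by (simp add: divide_simps) (simp add: algebra_simps)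
qed (simp add: phi_t_def)

text \<open>Origin of the two constants: \<open>\<psi>\<close> and \<open>gamma0 G * d\<close> are
  each at most \<open>2 * C / c'\<close> and are divided by \<open>mu0 G \<ge> c'\<close>; and
  \<open>sigma_lower\<close> combines \<open>\<bar>h\<bar> \<ge> c'\<close> with the lower bound
  \<open>c^2 / (2 * C)^2\<close> for the second moment of \<open>\<zeta>\<close>. They stand outside
  the locale so that their independence of the law is visible.\<close>

definition score_bound :: "real \<Rightarrow> real \<Rightarrow> real" where "score_bound C c' = 4 * C / c'\<^sup>2"
definition sigma_lower :: "real \<Rightarrow> real \<Rightarrow> real \<Rightarrow> real" where "sigma_lower C c c' = c' * c / (2 * C)"

context overlap_model
begin

definition h :: "'z obs \<Rightarrow> real" where "h w = (dd w - m w) / (1 - m w)"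
definition \<psi> :: "'z obs \<Rightarrow> real" where "\<psi> w = (yy w - g0 w) * h w"
definition \<phi> :: "'z obs \<Rightarrow> real" where
  "\<phi> w = phi_t (gamma0 G) (yy w) (dd w) (gfun G 0 (zz w)) (gfun G 1 (zz w)) (mfun G (zz w)) (mu0 G)"

lemma measurable_score [measurable]:
  "h \<in> borel_measurable Q" "\<psi> \<in> borel_measurable Q" "\<phi> \<in> borel_measurable Q"
  unfolding h_def[abs_def] \<psi>_def[abs_def] \<phi>_def[abs_def] phi_t_def by measurable

text \<open>The weight is 1 on the treated and \<open>- m / (1 - m)\<close> on the untreated. Its
  lower bound is what keeps the variance of the score away from zero.\<close>

lemma h_bounds:
  assumes "dd w \<in> {0, 1}" "c' \<le> m w" "m w \<le> 1 - c'"
  shows "\<bar>h w\<bar> \<le> 1 / c'" "c' \<le> \<bar>h w\<bar>"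
proof -
  have "c' \<le> 1" "1 - m w > 0" "m w > 0" using c'_half c'_pos assms by auto
  moreover have "m w / (1 - m w) \<le> 1 / c'" using assms c'_pos by (intro frac_le) auto
  moreover have "c' / 1 \<le> m w / (1 - m w)" using assms c'_pos by (intro frac_le) auto
  ultimately show "\<bar>h w\<bar> \<le> 1 / c'" "c' \<le> \<bar>h w\<bar>"
    using assms c'_pos by (auto simp: h_def)
qed

lemma AE_h: "AE w in Q. \<bar>h w\<bar> \<le> 1 / c' \<and> c' \<le> \<bar>h w\<bar>"
  using AE_d AE_m by eventually_elim (use h_bounds in auto)

lemma integrable_d: "integrable Q dd" and integrable_m: "integrable Q m"
proof -
  show "integrable Q dd"
    using AE_d by (intro integrable_AE_bounded[where B = 1]) (auto elim!: eventually_mono)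
  show "integrable Q m"
  proof (rule integrable_AE_bounded[where B = 1])
    show "AE w in Q. \<bar>m w\<bar> \<le> 1" using AE_m by eventually_elim (use c'_pos in auto)
  qed simp
qed

lemma mu0_eq: "mu0 G = expectation m" by (simp add: mu0_def m_def[abs_def])

lemma mu0_bounds: "c' \<le> mu0 G" "mu0 G \<le> 1 - c'"
  unfolding mu0_eq
  using AE_m integrable_m by (auto intro!: integral_ge_const integral_le_const elim: eventually_mono)

lemma expectation_d: "expectation dd = mu0 G"
proof -
  have "(\<integral>w. 1 * (dd w - m w) \<partial>Q) = 0" by (rule integral_v_zero[where f = "\<lambda>_. 1" and B = 1]) auto
  then show ?thesis using integrable_d integrable_m by (simp add: mu0_eq)
qed

text \<open>Almost everywhere this is the treatment effect on the treated and 0 on the untreated.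
  The form with the factor \<open>h\<close> makes the splitting of \<open>\<psi>\<close> into noise
  and a function of \<open>(d, z)\<close> purely algebraic.\<close>

definition u :: "'z obs \<Rightarrow> real" where "u w = (gfun G (dd w) (zz w) - g0 w) * h w"

lemma measurable_u [measurable]: "u \<in> borel_measurable Q"
  unfolding u_def[abs_def] by measurable

lemma AE_u: "AE w in Q. \<bar>u w\<bar> \<le> 2 * C"
  using AE_g_le AE_g0_le AE_d AE_m
proof eventually_elim
  case (elim w)
  have "1 - m w > 0" using elim c'_pos by auto
  then have "dd w = 1 \<Longrightarrow> h w = 1" by (simp add: h_def)
  then show ?case using elim C_pos by (auto simp: u_def g0_def)
qed

lemma psi_eq: "\<psi> w = h w * \<zeta> w + u w"
  by (simp add: \<psi>_def \<zeta>_def u_def algebra_simps)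

text \<open>Conditioning on \<open>d = 1\<close> divides by the probability of treatment, which is
  the mean of \<open>d\<close> and hence, by orthogonality, that of \<open>m\<close>.\<close>

lemma gamma0_eq: "gamma0 G = expectation u / mu0 G"
proof -
  have "{w \<in> space Q. dd w = 1} \<in> events" by measurable
  then have "prob {w \<in> space Q. dd w = 1} = expectation (indicator {w \<in> space Q. dd w = 1})" by simp
  also have "\<dots> = expectation dd"
    using AE_d AE_space by (intro integral_cong_AE) (auto elim!: eventually_elim2 simp: indicator_def)
  finally have 1: "prob {w \<in> space Q. dd w = 1} = mu0 G" by (simp add: expectation_d)
  have 2: "(\<integral>w. indicator {w. dd w = 1} w * (gfun G 1 (zz w) - gfun G 0 (zz w)) \<partial>Q) = expectation u"
  proof (rule integral_cong_AE)
    have [measurable]: "{w \<in> space Q. dd w = 1} \<in> events" by measurable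
    have "(\<lambda>w. indicator {w \<in> space Q. dd w = 1} w * (gfun G 1 (zz w) - gfun G 0 (zz w))) \<in> borel_measurable Q"
      by measurable
    then show "(\<lambda>w. indicator {w. dd w = 1} w * (gfun G 1 (zz w) - gfun G 0 (zz w))) \<in> borel_measurable Q"
      by (rule measurable_cong[THEN iffD1, rotated]) (simp add: indicator_def)
    show "AE w in Q. indicator {w. dd w = 1} w * (gfun G 1 (zz w) - gfun G 0 (zz w)) = u w"
      using AE_d AE_m
    proof eventually_elim
      case (elim w)
      have "1 - m w > 0" using elim c'_pos by auto
      then show ?case using elim by (auto simp: u_def h_def g0_def)
    qed
  qed simp
  show ?thesis unfolding gamma0_def 1 2 ..
qed

lemma integrable_u: "integrable Q u" by (rule integrable_AE_bounded[OF _ AE_u]) simp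

lemma gamma0_le: "\<bar>gamma0 G\<bar> \<le> 2 * C / c'"
proof -
  have "\<bar>expectation u\<bar> \<le> expectation (\<lambda>w. \<bar>u w\<bar>)" using integral_norm_bound[of Q u] by simp
  also have "\<dots> \<le> 2 * C" using AE_u integrable_u by (intro integral_le_const) auto
  finally show ?thesis
    unfolding gamma0_eq abs_divide using mu0_bounds c'_pos C_pos by (intro frac_le) auto
qed

lemma phi_eq: "m w \<noteq> 1 \<Longrightarrow> \<phi> w = (\<psi> w - gamma0 G * dd w) / mu0 G"
  by (simp add: \<phi>_def phi_t_eq \<psi>_def h_def g0_def m_def)

lemma AE_phi_eq: "AE w in Q. \<phi> w = (h w * \<zeta> w + (u w - gamma0 G * dd w)) / mu0 G"
  using AE_m by eventually_elim (use phi_eq psi_eq c'_pos in auto)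

lemma AE_psi_le: "AE w in Q. \<bar>\<psi> w\<bar> \<le> 2 * C / c'"
  using AE_y_le AE_g0_le AE_h
proof eventually_elim
  case (elim w)
  have "\<bar>yy w - g0 w\<bar> * \<bar>h w\<bar> \<le> (2 * C) * (1 / c')"
    using elim C_pos by (intro mult_mono) auto
  then show ?case by (simp add: \<psi>_def abs_mult)
qed

abbreviation phi_bound :: real where "phi_bound \<equiv> score_bound C c'"

lemma phi_bound_pos: "0 < phi_bound" using C_pos c'_pos by (simp add: score_bound_def)

lemma phi_le:
  assumes "m w \<noteq> 1" "dd w \<in> {0, 1}" "\<bar>\<psi> w\<bar> \<le> 2 * C / c'"
  shows "\<bar>\<phi> w\<bar> \<le> phi_bound"
proof -
  have "\<bar>gamma0 G * dd w\<bar> \<le> 2 * C / c'" using gamma0_le assms(2) C_pos c'_pos by auto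
  then have "\<bar>\<psi> w - gamma0 G * dd w\<bar> \<le> 4 * C / c'" using assms(3) by simp
  moreover have "\<bar>\<phi> w\<bar> = \<bar>\<psi> w - gamma0 G * dd w\<bar> / mu0 G"
    using assms mu0_bounds c'_pos by (simp add: phi_eq)
  moreover have "\<bar>\<psi> w - gamma0 G * dd w\<bar> / mu0 G \<le> (4 * C / c') / c'"
    using mu0_bounds c'_pos C_pos calculation(1) by (intro frac_le) auto
  ultimately have "\<bar>\<phi> w\<bar> \<le> (4 * C / c') / c'" by simp
  then show ?thesis by (simp add: score_bound_def power2_eq_square)
qed

lemma AE_phi_le: "AE w in Q. \<bar>\<phi> w\<bar> \<le> phi_bound"
  using AE_m AE_d AE_psi_le by eventually_elim (rule phi_le, use c'_pos in auto)

lemma AE_h_zeta_le: "AE w in Q. \<bar>h w * \<zeta> w\<bar> \<le> 1 / c' * (2 * C)"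
  using AE_h AE_zeta_le
proof eventually_elim
  case (elim w)
  then show ?case unfolding abs_mult using c'_pos by (intro mult_mono) auto
qed

lemma integrable_h_zeta: "integrable Q (\<lambda>w. h w * \<zeta> w)"
  by (rule integrable_AE_bounded[OF _ AE_h_zeta_le]) measurable

lemma expectation_h_zeta:
  assumes "f \<in> borel_measurable (borel \<Otimes>\<^sub>M Zs)" "AE w in Q. \<bar>f (dd w, zz w)\<bar> \<le> B"
  shows "expectation (\<lambda>w. f (dd w, zz w) * h w * \<zeta> w) = 0"
proof -
  let ?f = "\<lambda>t. f t * ((fst t - mfun G (snd t)) / (1 - mfun G (snd t)))"
  have "(\<integral>w. ?f (dd w, zz w) * \<zeta> w \<partial>Q) = 0"
  proof (rule integral_zeta_zero[where B = "B * (1 / c')"])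
    show "?f \<in> borel_measurable (borel \<Otimes>\<^sub>M Zs)" using assms(1) by measurable
    show "AE w in Q. \<bar>?f (dd w, zz w)\<bar> \<le> B * (1 / c')"
      using assms(2) AE_h
    proof eventually_elim
      case (elim w)
      then have "\<bar>f (dd w, zz w)\<bar> * \<bar>h w\<bar> \<le> B * (1 / c')" by (intro mult_mono) auto
      then show ?case by (simp add: h_def m_def abs_mult)
    qed
  qed
  then show ?thesis by (simp add: h_def m_def)
qed

text \<open>The noise part \<open>h * \<zeta>\<close> is centred given \<open>(d, z)\<close>, and
  \<open>gamma0 G * mu0 G\<close> is exactly the mean of \<open>u\<close>.\<close>

lemma expectation_phi: "expectation \<phi> = 0"
proof -
  have hz: "expectation (\<lambda>w. h w * \<zeta> w) = 0"
    using expectation_h_zeta[where f = "\<lambda>_. 1" and B = 1] by simp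
  have "expectation \<phi> = expectation (\<lambda>w. (h w * \<zeta> w + (u w - gamma0 G * dd w)) / mu0 G)"
    using AE_phi_eq by (intro integral_cong_AE) auto
  also have "\<dots> = (expectation u - gamma0 G * mu0 G) / mu0 G"
    using integrable_h_zeta integrable_u integrable_d by (simp add: hz expectation_d)
  also have "\<dots> = 0" using mu0_bounds c'_pos by (simp add: gamma0_eq)
  finally show ?thesis .
qed

lemma sigma2_eq: "sigma2 G = expectation (\<lambda>w. (\<phi> w)\<^sup>2)"
  by (simp add: sigma2_def \<phi>_def)

text \<open>Up to the factor \<open>mu0 G\<close>, the score is \<open>h * \<zeta>\<close> plus a
  function \<open>k\<close> of \<open>(d, z)\<close>. The cross term vanishes, so the variance is at
  least that of the noise part, and there \<open>\<bar>h\<bar> \<ge> c'\<close> and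
  \<open>mu0 G \<le> 1\<close> apply.\<close>

lemma sigma2_lower:
  assumes "0 < c" "c \<le> L2norm Q (\<lambda>w. (\<zeta> w)\<^sup>2)"
  shows "(sigma_lower C c c')\<^sup>2 \<le> sigma2 G"
proof -
  define k where "k w = u w - gamma0 G * dd w" for w
  have kbd: "AE w in Q. \<bar>k w\<bar> \<le> 2 * C + 2 * C / c'"
    using AE_u AE_d
  proof eventually_elim
    case (elim w)
    have "\<bar>gamma0 G * dd w\<bar> \<le> 2 * C / c'" using gamma0_le elim C_pos c'_pos by auto
    then show ?case using elim by (simp add: k_def)
  qed
  have [measurable]: "k \<in> borel_measurable Q" unfolding k_def by measurable
  let ?k = "\<lambda>t. (gfun G (fst t) (snd t) - gfun G 0 (snd t)) * ((fst t - mfun G (snd t)) / (1 - mfun G (snd t))) - gamma0 G * fst t"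
  have k_fun: "k w = ?k (dd w, zz w)" for w by (simp add: k_def u_def h_def g0_def m_def)
  have cross: "expectation (\<lambda>w. k w * h w * \<zeta> w) = 0"
    unfolding k_fun by (rule expectation_h_zeta[where f = ?k, OF _ kbd[unfolded k_fun]]) measurable
  have zint: "integrable Q (\<lambda>w. (\<zeta> w)\<^sup>2)" by (rule integrable_square_AE_bounded[OF _ AE_zeta_le]) simp
  have hzint: "integrable Q (\<lambda>w. (h w * \<zeta> w)\<^sup>2)" by (rule integrable_square_AE_bounded[OF _ AE_h_zeta_le]) measurable
  have kint: "integrable Q (\<lambda>w. (k w)\<^sup>2)" by (rule integrable_square_AE_bounded[OF _ kbd]) measurable
  have xint: "integrable Q (\<lambda>w. k w * h w * \<zeta> w)"
  proof (rule integrable_AE_bounded)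
    show "AE w in Q. \<bar>k w * h w * \<zeta> w\<bar> \<le> (2 * C + 2 * C / c') * (1 / c' * (2 * C))"
      using kbd AE_h_zeta_le
    proof eventually_elim
      case (elim w)
      then have "\<bar>k w\<bar> * \<bar>h w * \<zeta> w\<bar> \<le> (2 * C + 2 * C / c') * (1 / c' * (2 * C))"
        by (intro mult_mono) (auto intro: order_trans[OF abs_ge_zero])
      then show ?case by (simp add: abs_mult mult.assoc)
    qed
  qed measurable
  have "sigma2 G = expectation (\<lambda>w. ((h w * \<zeta> w)\<^sup>2 + (2 * (k w * h w * \<zeta> w) + (k w)\<^sup>2)) / (mu0 G)\<^sup>2)"
    unfolding sigma2_eq
  proof (rule integral_cong_AE)
    show "AE w in Q. (\<phi> w)\<^sup>2 = ((h w * \<zeta> w)\<^sup>2 + (2 * (k w * h w * \<zeta> w) + (k w)\<^sup>2)) / (mu0 G)\<^sup>2"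
      using AE_phi_eq[folded k_def]
      by eventually_elim (simp add: power_divide power2_eq_square algebra_simps)
  qed measurable
  also have "\<dots> = (expectation (\<lambda>w. (h w * \<zeta> w)\<^sup>2) + (2 * expectation (\<lambda>w. k w * h w * \<zeta> w) + expectation (\<lambda>w. (k w)\<^sup>2))) / (mu0 G)\<^sup>2"
    using hzint kint xint by simp
  also have "\<dots> = (expectation (\<lambda>w. (h w * \<zeta> w)\<^sup>2) + expectation (\<lambda>w. (k w)\<^sup>2)) / (mu0 G)\<^sup>2"
    unfolding cross by simp
  finally have s: "sigma2 G = (expectation (\<lambda>w. (h w * \<zeta> w)\<^sup>2) + expectation (\<lambda>w. (k w)\<^sup>2)) / (mu0 G)\<^sup>2" .
  have mu2: "0 < (mu0 G)\<^sup>2" "(mu0 G)\<^sup>2 \<le> 1"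
    using mu0_bounds c'_pos by (auto simp: power_le_one)
  have "c'\<^sup>2 * expectation (\<lambda>w. (\<zeta> w)\<^sup>2) = expectation (\<lambda>w. c'\<^sup>2 * (\<zeta> w)\<^sup>2)" by simp
  also have "\<dots> \<le> expectation (\<lambda>w. (h w * \<zeta> w)\<^sup>2)"
  proof (rule integral_mono_AE)
    show "AE w in Q. c'\<^sup>2 * (\<zeta> w)\<^sup>2 \<le> (h w * \<zeta> w)\<^sup>2"
      using AE_h
    proof eventually_elim
      case (elim w)
      then have "c'\<^sup>2 \<le> \<bar>h w\<bar>\<^sup>2" using c'_pos by (intro power_mono) auto
      then show ?case by (simp add: power_mult_distrib mult_right_mono)
    qed
  qed (use zint hzint in auto)
  finally have 1: "c'\<^sup>2 * expectation (\<lambda>w. (\<zeta> w)\<^sup>2) \<le> expectation (\<lambda>w. (h w * \<zeta> w)\<^sup>2)" .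
  have "c\<^sup>2 \<le> (L2norm Q (\<lambda>w. (\<zeta> w)\<^sup>2))\<^sup>2" using assms by (intro power_mono) auto
  also have "\<dots> = expectation (\<lambda>w. ((\<zeta> w)\<^sup>2)\<^sup>2)"
    unfolding L2norm_def by (intro real_sqrt_pow2 Bochner_Integration.integral_nonneg) auto
  \<comment> \<open>The hypothesis bounds a fourth moment from below;
    \<open>\<bar>\<zeta>\<bar> \<le> 2 * C\<close> trades two of the four factors for a constant and
    leaves the second moment.\<close>
  also have "\<dots> \<le> expectation (\<lambda>w. (2 * C)\<^sup>2 * (\<zeta> w)\<^sup>2)"
  proof (rule integral_mono_AE)
    have z2: "AE w in Q. (\<zeta> w)\<^sup>2 \<le> (2 * C)\<^sup>2"
      using AE_zeta_le by eventually_elim (use abs_le_square_iff C_pos in fastforce)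
    then show "AE w in Q. ((\<zeta> w)\<^sup>2)\<^sup>2 \<le> (2 * C)\<^sup>2 * (\<zeta> w)\<^sup>2"
      by eventually_elim (subst power2_eq_square, intro mult_right_mono, auto)
    show "integrable Q (\<lambda>w. ((\<zeta> w)\<^sup>2)\<^sup>2)"
      by (rule integrable_square_AE_bounded[where B = "(2 * C)\<^sup>2"]) (use z2 in auto)
  qed (use zint in auto)
  also have "\<dots> = (2 * C)\<^sup>2 * expectation (\<lambda>w. (\<zeta> w)\<^sup>2)" by simp
  finally have "c\<^sup>2 / (2 * C)\<^sup>2 \<le> expectation (\<lambda>w. (\<zeta> w)\<^sup>2)" using C_pos by (simp add: field_simps)
  then have "c'\<^sup>2 * (c\<^sup>2 / (2 * C)\<^sup>2) \<le> c'\<^sup>2 * expectation (\<lambda>w. (\<zeta> w)\<^sup>2)" by (intro mult_left_mono) auto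
  then have "(c' * c / (2 * C))\<^sup>2 \<le> expectation (\<lambda>w. (h w * \<zeta> w)\<^sup>2)"
    using 1 by (simp add: power_mult_distrib power_divide)
  also have "\<dots> \<le> expectation (\<lambda>w. (h w * \<zeta> w)\<^sup>2) + expectation (\<lambda>w. (k w)\<^sup>2)" by simp
  also have "\<dots> \<le> sigma2 G"
    unfolding s using mu2 frac_le[OF _ order_refl mu2] by simp
  finally show ?thesis by (simp add: sigma_lower_def)
qed

end

section \<open>First-stage errors at a fixed sample size\<close>

lemma inverse_diff_le:
  fixes a b \<alpha> \<beta> :: real
  assumes "a \<le> 1 - \<alpha>" "b \<le> 1 - \<beta>" "0 < \<alpha>" "0 < \<beta>"
  shows "\<bar>1 / (1 - a) - 1 / (1 - b)\<bar> \<le> \<bar>a - b\<bar> / (\<alpha> * \<beta>)"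
proof -
  have pos: "0 < 1 - a" "0 < 1 - b" using assms by auto
  have "1 / (1 - a) - 1 / (1 - b) = (a - b) / ((1 - a) * (1 - b))"
    using pos by (simp add: field_simps)
  then have "\<bar>1 / (1 - a) - 1 / (1 - b)\<bar> = \<bar>a - b\<bar> / ((1 - a) * (1 - b))"
    using pos by (simp add: abs_mult)
  also have "\<dots> \<le> \<bar>a - b\<bar> / (\<alpha> * \<beta>)"
    using assms pos by (intro divide_left_mono mult_mono mult_pos_pos) auto
  finally show ?thesis .
qed

text \<open>Neyman orthogonality: no first-order error term of the score has a nonzero mean.\<close>
lemma score_diff:
  fixes y d g gd m m' a :: real
  assumes "(1 - d) * (gd - g) = 0" "m \<noteq> 1" "m' \<noteq> 1"
  shows "(y - (g + a)) * ((d - m') / (1 - m')) - (y - g) * ((d - m) / (1 - m))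
    = - ((1 - d) * (y - gd) * (1 / (1 - m') - 1 / (1 - m))) - a * ((d - m) / (1 - m))
      + (1 - d) * a * (1 / (1 - m') - 1 / (1 - m))"
proof -
  define q q' where "q = 1 / (1 - m)" and "q' = 1 / (1 - m')"
  have e: "(d - m) / (1 - m) = 1 - (1 - d) * q" "(d - m') / (1 - m') = 1 - (1 - d) * q'"
    using assms by (simp_all add: q_def q'_def field_simps)
  have "(1 - d) * gd = (1 - d) * g" using assms(1) by (simp add: algebra_simps)
  then have y: "(1 - d) * (y - gd) = (1 - d) * (y - g)" by (simp add: right_diff_distrib)
  show ?thesis unfolding e y q_def[symmetric] q'_def[symmetric] by (simp add: algebra_simps)
qed

lemma (in prob_space) second_moment_le:
  fixes f a b :: "'a \<Rightarrow> real"
  assumes [measurable]: "f \<in> borel_measurable M" "a \<in> borel_measurable M" "b \<in> borel_measurable M"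
    and a: "AE x in M. \<bar>a x\<bar> \<le> A" and b: "AE x in M. \<bar>b x\<bar> \<le> B"
    and f: "AE x in M. \<bar>f x\<bar> \<le> L * (\<bar>a x\<bar> + \<bar>b x\<bar>)" and "0 \<le> L"
  shows "expectation (\<lambda>x. (f x)\<^sup>2) \<le> 2 * L\<^sup>2 * (expectation (\<lambda>x. (a x)\<^sup>2) + expectation (\<lambda>x. (b x)\<^sup>2))"
proof -
  have ia: "integrable M (\<lambda>x. (a x)\<^sup>2)" and ib: "integrable M (\<lambda>x. (b x)\<^sup>2)"
    by (rule integrable_square_AE_bounded[OF _ a], simp) (rule integrable_square_AE_bounded[OF _ b], simp)
  have fb: "AE x in M. \<bar>f x\<bar> \<le> L * (A + B)"
    using a b f
  proof eventually_elim
    case (elim x)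
    then have "L * (\<bar>a x\<bar> + \<bar>b x\<bar>) \<le> L * (A + B)" using \<open>0 \<le> L\<close> by (intro mult_left_mono) auto
    then show ?case using elim by simp
  qed
  have ifs: "integrable M (\<lambda>x. (f x)\<^sup>2)" by (rule integrable_square_AE_bounded[OF _ fb]) simp
  have "expectation (\<lambda>x. (f x)\<^sup>2) \<le> expectation (\<lambda>x. 2 * L\<^sup>2 * ((a x)\<^sup>2 + (b x)\<^sup>2))"
  proof (rule integral_mono_AE[OF ifs])
    show "AE x in M. (f x)\<^sup>2 \<le> 2 * L\<^sup>2 * ((a x)\<^sup>2 + (b x)\<^sup>2)"
      using f
    proof eventually_elim
      case (elim x)
      have "(f x)\<^sup>2 = \<bar>f x\<bar>\<^sup>2" by simp
      also have "\<dots> \<le> (L * (\<bar>a x\<bar> + \<bar>b x\<bar>))\<^sup>2" using elim by (intro power_mono) auto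
      also have "\<dots> = L\<^sup>2 * (\<bar>a x\<bar> + \<bar>b x\<bar>)\<^sup>2" by (simp add: power_mult_distrib)
      also have "\<dots> \<le> L\<^sup>2 * (2 * ((a x)\<^sup>2 + (b x)\<^sup>2))"
        using sum_squares_bound[of "\<bar>a x\<bar>" "\<bar>b x\<bar>"]
        by (intro mult_left_mono) (auto simp: power2_sum)
      finally show ?case by (simp add: algebra_simps)
    qed
  qed (use ia ib in auto)
  also have "\<dots> = 2 * L\<^sup>2 * (expectation (\<lambda>x. (a x)\<^sup>2) + expectation (\<lambda>x. (b x)\<^sup>2))"
    using ia ib by simp
  finally show ?thesis .
qed

text \<open>A single constant that dominates \<open>1 / c'\<close>, \<open>1 / c'^2\<close> and
  \<open>4 * C / c'^2\<close>, the factors by which first-stage errors are magnified in the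
  score.\<close>

definition lip_const :: "real \<Rightarrow> real \<Rightarrow> real" where "lip_const C c' = (4 * C + 1) / c'\<^sup>2"

text \<open>The bound \<open>k\<close> on the sparsity of an estimation error is twice the one for a
  single vector; \<open>\<eta>\<close> is the rounding error per coordinate and \<open>e\<close> the
  total one in an inner product. They are parameters fixed by equations because the assumption
  \<open>small\<close> mentions them. That assumption has two effects: the centred error terms are
  bounded by 1, as exponent 1 in the Chernoff bound requires, and perturbed propensities stay away
  from 1.\<close>

locale hte =
  fixes \<delta> \<Delta> K s :: "nat \<Rightarrow> real" and p :: "nat \<Rightarrow> nat" and C c c' :: real
    and Zs :: "'z measure" and P :: "nat \<Rightarrow> 'z \<Rightarrow> nat \<Rightarrow> real" and \<Lambda> :: "real \<Rightarrow> real"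
    and bhg1 bhg0 bhm :: "nat \<Rightarrow> (nat \<Rightarrow> 'z obs) \<Rightarrow> nat \<Rightarrow> real"
    and n :: nat and G :: "'z dgp" and k :: nat and \<eta> e lip :: real
  defines "k \<equiv> nat \<lfloor>2 * C * s n\<rfloor>" and "\<eta> \<equiv> 1 / (real n)\<^sup>2" and "e \<equiv> real k * \<eta>"
    and "lip \<equiv> lip_const C c'"
  assumes C: "0 < C" and c: "0 < c" and c': "0 < c'" "c' < 1 / 2"
    and Lip: "\<And>u v. \<bar>\<Lambda> u - \<Lambda> v\<bar> \<le> \<bar>u - v\<bar>"
    and P_meas: "\<And>j. (\<lambda>z. P n z j) \<in> borel_measurable Zs"
    and G: "G \<in> Pclass Zs \<delta> \<Delta> K s p C c c' \<Lambda> P bhg1 bhg0 bhm n"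
    and n_pos: "0 < n" and \<delta>_pos: "0 < \<delta> n"
    and small: "lip * (2 * \<delta> n + e) \<le> 1"
begin

sublocale overlap_model Zs G C c'
  using G C c' by unfold_locales (auto simp: Pclass_def HTE_def Let_def)

definition lin :: "(nat \<Rightarrow> real) \<Rightarrow> 'z obs \<Rightarrow> real" where "lin b w = ip (p n) (P n (zz w)) b"
definition r0 :: "'z obs \<Rightarrow> real" where "r0 w = g0 w - lin (bg0 G) w"
definition rm :: "'z obs \<Rightarrow> real" where "rm w = m w - \<Lambda> (lin (bm G) w)"
definition xt :: "(nat \<Rightarrow> real) \<Rightarrow> (nat \<Rightarrow> real) \<Rightarrow> 'z obs \<Rightarrow> real" where
  "xt b1 b0 w = xtb (p n) (P n (zz w)) (dd w) b1 b0"
definition rg :: "'z obs \<Rightarrow> real" where "rg w = gfun G (dd w) (zz w) - xt (bg1 G) (bg0 G) w"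
definition rate :: real where "rate = \<delta> n * real n powr (-1/4)"

lemma xt_eq: "xt b1 b0 w = dd w * lin b1 w + (1 - dd w) * lin b0 w"
  by (simp add: xt_def xtb_def lin_def)

lemma lin_diff: "lin (\<lambda>j. a j - b j) w = lin a w - lin b w"
  by (simp add: lin_def ip_diff)

lemma rate_sq: "rate\<^sup>2 = (\<delta> n)\<^sup>2 / sqrt (real n)"
proof -
  have "(real n powr (-1/4))\<^sup>2 = real n powr (-1/2)"
    using n_pos by (simp add: power2_eq_square powr_add[symmetric])
  also have "\<dots> = 1 / sqrt (real n)"
    using n_pos by (simp add: powr_half_sqrt[symmetric] powr_minus_divide)
  finally show ?thesis by (simp add: rate_def power_mult_distrib)
qed

lemma eta_pos: "0 < \<eta>" using n_pos by (simp add: \<eta>_def)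

lemma e_nonneg: "0 \<le> e" using eta_pos by (simp add: e_def)

lemma lip_ge: "1 / c'\<^sup>2 \<le> lip" "4 * C / c'\<^sup>2 \<le> lip" "1 / c' \<le> lip" "0 < lip"
proof -
  show "1 / c'\<^sup>2 \<le> lip" "4 * C / c'\<^sup>2 \<le> lip" "0 < lip"
    using C c' by (auto simp: lip_def lip_const_def divide_simps)
  have "1 / c' \<le> 1 / c'\<^sup>2" using c' by (simp add: field_simps power2_eq_square)
  with \<open>1 / c'\<^sup>2 \<le> lip\<close> show "1 / c' \<le> lip" by simp
qed

lemma small': "2 * \<delta> n + e \<le> c' / 2" "2 * \<delta> n + e \<le> 1 / 2"
proof -
  have "(1 / c'\<^sup>2) * (2 * \<delta> n + e) \<le> lip * (2 * \<delta> n + e)"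
    using lip_ge \<delta>_pos e_nonneg by (intro mult_right_mono) auto
  then have "(1 / c'\<^sup>2) * (2 * \<delta> n + e) \<le> 1" using small by linarith
  then have "2 * \<delta> n + e \<le> c'\<^sup>2" using c' by (simp add: divide_le_eq)
  moreover have "c'\<^sup>2 \<le> c' / 2" using c' by (simp add: power2_eq_square)
  ultimately show "2 * \<delta> n + e \<le> c' / 2" "2 * \<delta> n + e \<le> 1 / 2" using c' by linarith+
qed

lemma measurable_Lambda [measurable]: "\<Lambda> \<in> borel_measurable borel"
proof (rule borel_measurable_continuous_onI)
  have "1-lipschitz_on UNIV \<Lambda>"
    using Lip by (intro lipschitz_onI) (auto simp: dist_real_def)
  then show "continuous_on UNIV \<Lambda>" by (rule lipschitz_on_continuous_on)
qed

lemma measurable_ip [measurable]: "(\<lambda>z. ip (p n) (P n z) b) \<in> borel_measurable Zs"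
  unfolding ip_def using P_meas by measurable

lemma measurable_lin [measurable]:
  "lin b \<in> borel_measurable Q" "r0 \<in> borel_measurable Q" "rm \<in> borel_measurable Q"
  "xt b1 b0 \<in> borel_measurable Q" "rg \<in> borel_measurable Q"
  unfolding lin_def[abs_def] r0_def[abs_def] rm_def[abs_def] xt_def[abs_def] xtb_def rg_def[abs_def]
  by measurable

lemma HTE_i: "L2norm Q rg \<le> rate" "AE w in Q. \<bar>rg w\<bar> \<le> \<delta> n" "L2norm Q rm \<le> rate" "AE w in Q. \<bar>rm w\<bar> \<le> \<delta> n"
  using G unfolding Pclass_def HTE_def Let_def rate_def rg_def[abs_def] xt_def[abs_def] rm_def[abs_def] m_def lin_def
  by auto

lemma HTE_l0: "real (l0 (p n) (bg1 G) + l0 (p n) (bg0 G)) \<le> C * s n" "real (l0 (p n) (bm G)) \<le> C * s n"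
  using G unfolding Pclass_def HTE_def Let_def by auto

lemma HTE_x: "AE w in Q. \<forall>j<p n. \<bar>P n (zz w) j\<bar> \<le> K n"
proof -
  have "\<forall>j\<in>{..<p n}. AE w in Q. \<bar>P n (zz w) j\<bar> \<le> K n"
    using G unfolding Pclass_def HTE_def Let_def by auto
  then have "AE w in Q. \<forall>j\<in>{..<p n}. \<bar>P n (zz w) j\<bar> \<le> K n"
    by (intro AE_finite_allI) auto
  then show ?thesis by eventually_elim auto
qed

lemma HTE_zeta: "c \<le> L2norm Q (\<lambda>w. (\<zeta> w)\<^sup>2)"
  using G unfolding Pclass_def HTE_def Let_def \<zeta>_def by auto

definition \<theta>1 :: "(nat \<Rightarrow> 'z obs) \<Rightarrow> nat \<Rightarrow> real" where "\<theta>1 \<omega> j = bhg1 n \<omega> j - bg1 G j"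
definition \<theta>0 :: "(nat \<Rightarrow> 'z obs) \<Rightarrow> nat \<Rightarrow> real" where "\<theta>0 \<omega> j = bhg0 n \<omega> j - bg0 G j"
definition \<theta>m :: "(nat \<Rightarrow> 'z obs) \<Rightarrow> nat \<Rightarrow> real" where "\<theta>m \<omega> j = bhm n \<omega> j - bm G j"

definition first_stage :: "(nat \<Rightarrow> 'z obs) \<Rightarrow> bool" where
  "first_stage \<omega> \<longleftrightarrow>
     Pn2norm n \<omega> (xt (\<theta>1 \<omega>) (\<theta>0 \<omega>)) \<le> rate \<and> Pn2norm n \<omega> (lin (\<theta>m \<omega>)) \<le> rate \<and>
     K n * (l1 (p n) (\<theta>1 \<omega>) + l1 (p n) (\<theta>0 \<omega>)) \<le> \<delta> n \<and> K n * l1 (p n) (\<theta>m \<omega>) \<le> \<delta> n \<and>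
     real (l0 (p n) (bhg1 n \<omega>) + l0 (p n) (bhg0 n \<omega>)) \<le> C * s n \<and> real (l0 (p n) (bhm n \<omega>)) \<le> C * s n \<and>
     (\<forall>b1 b0. real (l0 (p n) b1 + l0 (p n) b0) \<le> 2 * C * s n \<and> L2norm Q (xt b1 b0) \<noteq> 0 \<longrightarrow>
        \<bar>Pn2norm n \<omega> (xt b1 b0) / L2norm Q (xt b1 b0) - 1\<bar> \<le> \<delta> n)"

lemma whp_first_stage: "whp (sample n Q) (\<Delta> n) first_stage"
proof -
  have "\<exists>A \<in> sets (sample n Q). measure (sample n Q) A \<ge> 1 - \<Delta> n \<and> A \<subseteq> {\<omega> \<in> space (sample n Q). first_stage \<omega>}"
    using G unfolding Pclass_def HTE_def Let_def first_stage_def xt_def[abs_def] lin_def[abs_def] \<theta>1_def[abs_def]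
      \<theta>0_def[abs_def] \<theta>m_def[abs_def] rate_def mem_Collect_eq by (elim conjE)
  then show ?thesis unfolding whp_def by blast
qed

section \<open>Almost sure bounds and population second moments\<close>

text \<open>All almost sure properties in one predicate, including those transferred from the
  untreated to everyone. At sample points that satisfy it, the later estimates are deterministic
  inequalities.\<close>

definition regular :: "'z obs \<Rightarrow> bool" where
  "regular w \<longleftrightarrow> dd w \<in> {0, 1} \<and> \<bar>yy w\<bar> \<le> C \<and> \<bar>gfun G (dd w) (zz w)\<bar> \<le> C \<and> \<bar>g0 w\<bar> \<le> C
     \<and> c' \<le> m w \<and> m w \<le> 1 - c' \<and> \<bar>r0 w\<bar> \<le> \<delta> n \<and> \<bar>rm w\<bar> \<le> \<delta> n \<and> \<bar>rg w\<bar> \<le> \<delta> n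
     \<and> (\<forall>j<p n. \<bar>P n (zz w) j\<bar> \<le> K n)"

lemma AE_r0: "AE w in Q. \<bar>r0 w\<bar> \<le> \<delta> n"
  unfolding r0_def g0_def lin_def
proof (rule AE_untreated_imp_AE[where R = "\<lambda>z. \<bar>gfun G 0 z - ip (p n) (P n z) (bg0 G)\<bar> \<le> \<delta> n"])
  show "AE w in Q. dd w = 0 \<longrightarrow> \<bar>gfun G 0 (zz w) - ip (p n) (P n (zz w)) (bg0 G)\<bar> \<le> \<delta> n"
    using HTE_i(2) by eventually_elim (auto simp: rg_def xt_def xtb_def)
qed measurable

lemma AE_regular: "AE w in Q. regular w"
  using AE_d AE_y_le AE_g_le AE_g0_le AE_m AE_r0 HTE_i(2) HTE_i(4) HTE_x
  by eventually_elim (simp add: regular_def)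

lemma whp_regular: "whp (sample n Q) 0 (\<lambda>\<omega>. \<forall>i<n. regular (\<omega> i))"
  unfolding sample_def by (intro whp_AE prob_space_power AE_power AE_regular)

text \<open>The sign of \<open>K n\<close> is not assumed: it follows from bounding the absolute
  value of at least one regressor. Without regressors \<open>K n\<close> may be negative, but then
  every \<open>l1\<close> norm is 0.\<close>

lemma K_nonneg: "0 < p n \<Longrightarrow> 0 \<le> K n"
proof -
  assume "0 < p n"
  then have "AE w in Q. 0 \<le> K n"
    by (intro eventually_mono[OF HTE_x]) (use abs_ge_zero order_trans in blast)
  then show ?thesis by simp
qed

lemma regular_lin_le: "regular w \<Longrightarrow> \<bar>lin b w\<bar> \<le> K n * l1 (p n) b"
  unfolding lin_def by (rule abs_ip_le_l1) (simp add: regular_def)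

lemma AE_lin_le: "AE w in Q. \<bar>lin b w\<bar> \<le> K n * l1 (p n) b"
  using AE_regular by eventually_elim (rule regular_lin_le)

lemma L2norm_sq: "(L2norm Q f)\<^sup>2 = expectation (\<lambda>w. (f w)\<^sup>2)"
  unfolding L2norm_def by (intro real_sqrt_pow2 Bochner_Integration.integral_nonneg) auto

lemma L2norm_le_imp: "L2norm Q f \<le> r \<Longrightarrow> expectation (\<lambda>w. (f w)\<^sup>2) \<le> r\<^sup>2"
  unfolding L2norm_sq[symmetric]
  by (intro power_mono) (auto simp: L2norm_def intro!: Bochner_Integration.integral_nonneg)

lemma rm_moment: "expectation (\<lambda>w. (rm w)\<^sup>2) \<le> rate\<^sup>2" and rg_moment: "expectation (\<lambda>w. (rg w)\<^sup>2) \<le> rate\<^sup>2"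
  using HTE_i by (auto intro: L2norm_le_imp)

text \<open>On the untreated \<open>r0\<close> coincides with \<open>rg\<close>, whose second moment
  is given; overlap extends the bound to everyone at the price of the factor
  \<open>1 / c'\<close>.\<close>

lemma r0_moment: "expectation (\<lambda>w. (r0 w)\<^sup>2) \<le> rate\<^sup>2 / c'"
proof -
  let ?u = "\<lambda>z. (gfun G 0 z - ip (p n) (P n z) (bg0 G))\<^sup>2"
  have u: "?u (zz w) = (r0 w)\<^sup>2" for w by (simp add: r0_def g0_def lin_def)
  have bd: "AE w in Q. \<bar>?u (zz w)\<bar> \<le> (\<delta> n)\<^sup>2"
    unfolding u using AE_r0 by eventually_elim (use abs_le_square_iff \<delta>_pos in fastforce)
  have "c' * expectation (\<lambda>w. (r0 w)\<^sup>2) \<le> expectation (\<lambda>w. (1 - dd w) * (r0 w)\<^sup>2)"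
    using overlap_le(2)[OF _ bd] unfolding u by simp
  also have "\<dots> \<le> expectation (\<lambda>w. (rg w)\<^sup>2)"
  proof (rule integral_mono_AE)
    show "integrable Q (\<lambda>w. (1 - dd w) * (r0 w)\<^sup>2)"
    proof (rule integrable_AE_bounded[where B = "(\<delta> n)\<^sup>2"])
      show "AE w in Q. \<bar>(1 - dd w) * (r0 w)\<^sup>2\<bar> \<le> (\<delta> n)\<^sup>2"
        using bd AE_d unfolding u by eventually_elim auto
    qed measurable
    show "integrable Q (\<lambda>w. (rg w)\<^sup>2)" by (rule integrable_square_AE_bounded[OF _ HTE_i(2)]) simp
    show "AE w in Q. (1 - dd w) * (r0 w)\<^sup>2 \<le> (rg w)\<^sup>2"
      using AE_d by eventually_elim (auto simp: rg_def r0_def g0_def xt_eq)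
  qed
  also have "\<dots> \<le> rate\<^sup>2" by (rule rg_moment)
  finally show ?thesis using c' by (simp add: field_simps)
qed

text \<open>As \<open>d\<close> is 0 or 1, the square of \<open>xt\<close> is the sum of the squares
  of its two blocks, each restricted to one treatment arm; overlap lifts the restriction.\<close>

lemma lin_moment_le_xt:
  "c' * expectation (\<lambda>w. (lin b0 w)\<^sup>2) \<le> expectation (\<lambda>w. (xt b1 b0 w)\<^sup>2)"
  "c' * expectation (\<lambda>w. (lin b1 w)\<^sup>2) \<le> expectation (\<lambda>w. (xt b1 b0 w)\<^sup>2)"
proof -
  have u: "AE w in Q. \<bar>(ip (p n) (P n (zz w)) b)\<^sup>2\<bar> \<le> (K n * l1 (p n) b)\<^sup>2" for b
    using AE_lin_le[of b] unfolding lin_def by eventually_elim (use abs_le_square_iff in fastforce)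
  have i: "integrable Q (\<lambda>w. (lin b w)\<^sup>2)" for b by (rule integrable_square_AE_bounded[OF _ AE_lin_le]) simp
  have ix: "integrable Q (\<lambda>w. (xt b1 b0 w)\<^sup>2)"
  proof (rule integrable_square_AE_bounded)
    show "AE w in Q. \<bar>xt b1 b0 w\<bar> \<le> \<bar>K n * l1 (p n) b1\<bar> + \<bar>K n * l1 (p n) b0\<bar>"
      using AE_d AE_lin_le[of b1] AE_lin_le[of b0] by eventually_elim (auto simp: xt_eq)
  qed measurable
  have "c' * expectation (\<lambda>w. (lin b0 w)\<^sup>2) \<le> expectation (\<lambda>w. (1 - dd w) * (lin b0 w)\<^sup>2)"
    unfolding lin_def by (rule overlap_le(2)[OF _ u]) auto
  also have "\<dots> \<le> expectation (\<lambda>w. (xt b1 b0 w)\<^sup>2)"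
  proof (rule integral_mono_AE[OF _ ix])
    show "AE w in Q. (1 - dd w) * (lin b0 w)\<^sup>2 \<le> (xt b1 b0 w)\<^sup>2"
      using AE_d by eventually_elim (auto simp: xt_eq)
    show "integrable Q (\<lambda>w. (1 - dd w) * (lin b0 w)\<^sup>2)"
      using AE_d by (intro Bochner_Integration.integrable_bound[OF i[of b0]]) (auto elim!: eventually_mono)
  qed
  finally show "c' * expectation (\<lambda>w. (lin b0 w)\<^sup>2) \<le> expectation (\<lambda>w. (xt b1 b0 w)\<^sup>2)" .
  have "c' * expectation (\<lambda>w. (lin b1 w)\<^sup>2) \<le> expectation (\<lambda>w. dd w * (lin b1 w)\<^sup>2)"
    unfolding lin_def by (rule overlap_le(1)[OF _ u]) auto
  also have "\<dots> \<le> expectation (\<lambda>w. (xt b1 b0 w)\<^sup>2)"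
  proof (rule integral_mono_AE[OF _ ix])
    show "AE w in Q. dd w * (lin b1 w)\<^sup>2 \<le> (xt b1 b0 w)\<^sup>2"
      using AE_d by eventually_elim (auto simp: xt_eq)
    show "integrable Q (\<lambda>w. dd w * (lin b1 w)\<^sup>2)"
      using AE_d by (intro Bochner_Integration.integrable_bound[OF i[of b1]]) (auto elim!: eventually_mono)
  qed
  finally show "c' * expectation (\<lambda>w. (lin b1 w)\<^sup>2) \<le> expectation (\<lambda>w. (xt b1 b0 w)\<^sup>2)" .
qed

text \<open>With \<open>\<delta> n \<le> 1/2\<close> the restricted isometry bounds the population
  norm by twice the empirical one. Norm zero is split off because the isometry is stated as a
  ratio.\<close>

lemma first_stage_moment:
  assumes "first_stage \<omega>" "real (l0 (p n) b1 + l0 (p n) b0) \<le> 2 * C * s n" "Pn2norm n \<omega> (xt b1 b0) \<le> rate"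
  shows "expectation (\<lambda>w. (xt b1 b0 w)\<^sup>2) \<le> 4 * rate\<^sup>2"
proof (cases "L2norm Q (xt b1 b0) = 0")
  case True
  then show ?thesis using L2norm_sq[of "xt b1 b0"] by simp
next
  case False
  let ?L = "L2norm Q (xt b1 b0)" and ?N = "Pn2norm n \<omega> (xt b1 b0)"
  have "\<bar>?N / ?L - 1\<bar> \<le> \<delta> n" using assms False unfolding first_stage_def by blast
  then have "1 / 2 \<le> ?N / ?L" using small'(2) e_nonneg by linarith
  moreover have "0 < ?L" using False by (simp add: L2norm_def order_less_le)
  ultimately have "?L \<le> 2 * ?N" by (simp add: field_simps)
  then have "?L \<le> 2 * rate" using assms(3) by simp
  then have "expectation (\<lambda>w. (xt b1 b0 w)\<^sup>2) \<le> (2 * rate)\<^sup>2" by (rule L2norm_le_imp)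
  then show ?thesis by (simp add: power_mult_distrib)
qed

lemma Pn2norm_mono:
  assumes "\<And>i. i < n \<Longrightarrow> \<bar>f (\<omega> i)\<bar> \<le> \<bar>f' (\<omega> i)\<bar>"
  shows "Pn2norm n \<omega> f \<le> Pn2norm n \<omega> f'"
  unfolding Pn2norm_def En_def using assms
  by (intro real_sqrt_le_mono divide_right_mono sum_mono) (auto simp: abs_le_square_iff)

lemma l0_zero: "l0 q (\<lambda>_. 0) = 0" by (simp add: l0_def)

text \<open>For the propensity score the isometry is applied to \<open>(\<theta>m, 0)\<close> and not to \<open>(\<theta>m, \<theta>m)\<close>, which
  would exceed the sparsity \<open>2 C s\<close>; overlap makes up for the lost factor \<open>d\<close>.\<close>
lemma first_stage_lin_moment:
  assumes fs: "first_stage \<omega>" and reg: "\<forall>i<n. regular (\<omega> i)"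
  shows "expectation (\<lambda>w. (lin (\<theta>m \<omega>) w)\<^sup>2) \<le> 4 * rate\<^sup>2 / c'"
    and "expectation (\<lambda>w. (lin (\<theta>0 \<omega>) w)\<^sup>2) \<le> 4 * rate\<^sup>2 / c'"
proof -
  have lm: "real (l0 (p n) (\<theta>m \<omega>)) \<le> 2 * C * s n"
    using fs HTE_l0(2) l0_diff_le[of "p n" "bhm n \<omega>" "bm G"] unfolding first_stage_def \<theta>m_def[abs_def] by linarith
  have lg: "real (l0 (p n) (\<theta>1 \<omega>) + l0 (p n) (\<theta>0 \<omega>)) \<le> 2 * C * s n"
    using fs HTE_l0(1) l0_diff_le[of "p n" "bhg0 n \<omega>" "bg0 G"] l0_diff_le[of "p n" "bhg1 n \<omega>" "bg1 G"]
    unfolding first_stage_def \<theta>0_def[abs_def] \<theta>1_def[abs_def] by linarith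
  have "Pn2norm n \<omega> (xt (\<theta>m \<omega>) (\<lambda>_. 0)) \<le> Pn2norm n \<omega> (lin (\<theta>m \<omega>))"
    using reg by (intro Pn2norm_mono) (auto simp: xt_eq regular_def lin_def ip_def)
  also have "\<dots> \<le> rate" using fs by (simp add: first_stage_def)
  finally have "expectation (\<lambda>w. (xt (\<theta>m \<omega>) (\<lambda>_. 0) w)\<^sup>2) \<le> 4 * rate\<^sup>2"
    using lm by (intro first_stage_moment[OF fs]) (auto simp: l0_zero)
  then have "c' * expectation (\<lambda>w. (lin (\<theta>m \<omega>) w)\<^sup>2) \<le> 4 * rate\<^sup>2"
    using lin_moment_le_xt(2)[of "\<theta>m \<omega>" "\<lambda>_. 0"] by linarith
  then show "expectation (\<lambda>w. (lin (\<theta>m \<omega>) w)\<^sup>2) \<le> 4 * rate\<^sup>2 / c'" using c' by (simp add: field_simps)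
  have "expectation (\<lambda>w. (xt (\<theta>1 \<omega>) (\<theta>0 \<omega>) w)\<^sup>2) \<le> 4 * rate\<^sup>2"
    using fs lg by (intro first_stage_moment[OF fs]) (auto simp: first_stage_def)
  then have "c' * expectation (\<lambda>w. (lin (\<theta>0 \<omega>) w)\<^sup>2) \<le> 4 * rate\<^sup>2"
    using lin_moment_le_xt(1)[of "\<theta>0 \<omega>" "\<theta>1 \<omega>"] by linarith
  then show "expectation (\<lambda>w. (lin (\<theta>0 \<omega>) w)\<^sup>2) \<le> 4 * rate\<^sup>2 / c'" using c' by (simp add: field_simps)
qed

section \<open>Centred error terms over the admissible net points\<close>

text \<open>\<open>fA b\<close> is the noise times the change of the inverse propensity weight when
  the propensity index is off by \<open>b\<close>; \<open>fB b\<close> below is the error of the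
  untreated regression times \<open>h\<close>. For deterministic \<open>b\<close> both have mean
  zero, which fails to make sense once \<open>b\<close> depends on the sample; this is why
  \<open>b\<close> is a parameter.\<close>

definition fA :: "(nat \<Rightarrow> real) \<Rightarrow> 'z obs \<Rightarrow> real" where
  "fA b w = (1 - dd w) * \<zeta> w * (1 / (1 - \<Lambda> (lin (bm G) w + lin b w)) - 1 / (1 - m w))"
definition fB :: "(nat \<Rightarrow> real) \<Rightarrow> 'z obs \<Rightarrow> real" where
  "fB b w = (lin b w - r0 w) * h w"

lemma measurable_f [measurable]: "fA b \<in> borel_measurable Q" "fB b \<in> borel_measurable Q"
  unfolding fA_def[abs_def] fB_def[abs_def] by measurable

text \<open>The Lipschitz property keeps the perturbed propensity within
  \<open>2 * \<delta> n + e \<le> c' / 2\<close> of the true one, which is at most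
  \<open>1 - c'\<close>. For the identity link nothing else would stop the index from reaching
  1.\<close>

lemma Lambda_shift:
  assumes "regular w" "\<bar>lin b w\<bar> \<le> \<delta> n + e"
  shows "\<bar>\<Lambda> (lin (bm G) w + lin b w) - m w\<bar> \<le> \<bar>lin b w\<bar> + \<bar>rm w\<bar>"
    and "\<Lambda> (lin (bm G) w + lin b w) \<le> 1 - c' / 2"
proof -
  show 1: "\<bar>\<Lambda> (lin (bm G) w + lin b w) - m w\<bar> \<le> \<bar>lin b w\<bar> + \<bar>rm w\<bar>"
    using Lip[of "lin (bm G) w + lin b w" "lin (bm G) w"] by (simp add: rm_def)
  show "\<Lambda> (lin (bm G) w + lin b w) \<le> 1 - c' / 2"
  proof -
    have "m w \<le> 1 - c'" "\<bar>rm w\<bar> \<le> \<delta> n" using assms(1) by (auto simp: regular_def)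
    then show ?thesis using 1 assms(2) small'(1) by linarith
  qed
qed

lemma inverse_shift_le:
  assumes "regular w" "\<bar>lin b w\<bar> \<le> \<delta> n + e"
  shows "\<bar>1 / (1 - \<Lambda> (lin (bm G) w + lin b w)) - 1 / (1 - m w)\<bar> \<le> 2 / c'\<^sup>2 * (\<bar>lin b w\<bar> + \<bar>rm w\<bar>)"
proof -
  let ?L = "\<Lambda> (lin (bm G) w + lin b w)"
  have "\<bar>1 / (1 - ?L) - 1 / (1 - m w)\<bar> \<le> \<bar>?L - m w\<bar> / (c' / 2 * c')"
    using Lambda_shift(2)[OF assms] assms(1) c' by (intro inverse_diff_le) (auto simp: regular_def)
  also have "\<dots> = 2 / c'\<^sup>2 * \<bar>?L - m w\<bar>" using c' by (simp add: power2_eq_square)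
  also have "\<dots> \<le> 2 / c'\<^sup>2 * (\<bar>lin b w\<bar> + \<bar>rm w\<bar>)"
    using Lambda_shift(1)[OF assms] c' by (intro mult_left_mono) auto
  finally show ?thesis .
qed

lemma regular_zeta: "regular w \<Longrightarrow> \<bar>\<zeta> w\<bar> \<le> 2 * C"
  by (auto simp: regular_def \<zeta>_def)

lemma regular_h: "regular w \<Longrightarrow> \<bar>h w\<bar> \<le> 1 / c'"
  by (intro h_bounds(1)) (auto simp: regular_def)

lemma regular_1d: "regular w \<Longrightarrow> \<bar>1 - dd w\<bar> \<le> 1"
  by (auto simp: regular_def)

lemma fA_le:
  assumes "regular w" "\<bar>lin b w\<bar> \<le> \<delta> n + e"
  shows "\<bar>fA b w\<bar> \<le> lip * (\<bar>lin b w\<bar> + \<bar>rm w\<bar>)"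
proof -
  have "\<bar>(1 - dd w) * \<zeta> w\<bar> \<le> 1 * (2 * C)"
    unfolding abs_mult using regular_1d[OF assms(1)] regular_zeta[OF assms(1)] by (intro mult_mono) auto
  then have "\<bar>fA b w\<bar> \<le> (2 * C) * (2 / c'\<^sup>2 * (\<bar>lin b w\<bar> + \<bar>rm w\<bar>))"
    unfolding fA_def abs_mult[of "(1 - dd w) * \<zeta> w"] using inverse_shift_le[OF assms] C
    by (intro mult_mono) auto
  also have "\<dots> = 4 * C / c'\<^sup>2 * (\<bar>lin b w\<bar> + \<bar>rm w\<bar>)" by simp
  also have "\<dots> \<le> lip * (\<bar>lin b w\<bar> + \<bar>rm w\<bar>)" using lip_ge by (intro mult_right_mono) auto
  finally show ?thesis .
qed

lemma fB_le:
  assumes "regular w"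
  shows "\<bar>fB b w\<bar> \<le> lip * (\<bar>lin b w\<bar> + \<bar>r0 w\<bar>)"
proof -
  have "\<bar>fB b w\<bar> \<le> (\<bar>lin b w\<bar> + \<bar>r0 w\<bar>) * lip"
    unfolding fB_def abs_mult using regular_h[OF assms] lip_ge(3) by (intro mult_mono) auto
  then show ?thesis by (simp add: mult.commute)
qed

definition net :: "(nat \<Rightarrow> real) set" where
  "net = sparse_net (p n) k (\<eta> / K n) (nat \<lceil>\<delta> n / \<eta> + 1\<rceil>)"

text \<open>The net itself contains points far from any estimation error, whose variances would be
  too large. Retained are those with the bounds that rounding a first-stage error preserves:
  \<open>8 * rate^2 / c' + 2 * e^2\<close> is twice the sum of \<open>4 * rate^2 / c'\<close> and
  \<open>e^2\<close>. The resulting set does not depend on the sample.\<close>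

definition adm :: "(nat \<Rightarrow> real) set" where
  "adm = {b \<in> net. (AE w in Q. \<bar>lin b w\<bar> \<le> \<delta> n + e) \<and> expectation (\<lambda>w. (lin b w)\<^sup>2) \<le> 8 * rate\<^sup>2 / c' + 2 * e\<^sup>2}"

lemma finite_adm: "finite adm" and card_adm: "card adm \<le> card net"
proof -
  have "finite net" by (simp add: net_def finite_sparse_net)
  then show "finite adm" "card adm \<le> card net" by (auto simp: adm_def intro!: card_mono)
qed

text \<open>The rounded vector moves every inner product at regular points by at most
  \<open>e\<close>, so it inherits the sup bound up to \<open>e\<close> and the second moment up to
  a factor 2 and \<open>2 * e^2\<close>; hence it is admissible.\<close>

lemma adm_approx:
  assumes l0: "real (l0 (p n) b) \<le> 2 * C * s n" and l1: "K n * l1 (p n) b \<le> \<delta> n"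
    and mom: "expectation (\<lambda>w. (lin b w)\<^sup>2) \<le> 4 * rate\<^sup>2 / c'"
  obtains b' where "b' \<in> adm" and "\<And>w. regular w \<Longrightarrow> \<bar>lin b w - lin b' w\<bar> \<le> e"
proof -
  have "l0 (p n) b \<le> k" using l0 unfolding k_def by (intro le_nat_floor) simp
  moreover have "\<delta> n / \<eta> + 1 \<le> real (nat \<lceil>\<delta> n / \<eta> + 1\<rceil>)" by (rule real_nat_ceiling_ge)
  ultimately obtain b' where b': "b' \<in> net"
    and ap: "\<And>x. (\<And>j. j < p n \<Longrightarrow> \<bar>x j\<bar> \<le> K n) \<Longrightarrow> \<bar>ip (p n) x b - ip (p n) x b'\<bar> \<le> real k * \<eta>"
    using sparse_net_approx[of "p n" b k \<eta> "K n" "\<delta> n"] eta_pos K_nonneg l1 unfolding net_def by metis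
  have near: "\<bar>lin b w - lin b' w\<bar> \<le> e" if "regular w" for w
    using that ap unfolding lin_def e_def regular_def by blast
  have le: "\<bar>lin b' w\<bar> \<le> \<delta> n + e" if "regular w" for w
    using near[OF that] regular_lin_le[OF that, of b] l1 by linarith
  have "expectation (\<lambda>w. (lin b' w)\<^sup>2) \<le> 2 * 1\<^sup>2 * (expectation (\<lambda>w. (lin b w)\<^sup>2) + expectation (\<lambda>w. e\<^sup>2))"
  proof (rule second_moment_le[OF _ _ _ AE_lin_le])
    show "AE w in Q. \<bar>e\<bar> \<le> e" using e_nonneg by simp
    show "AE w in Q. \<bar>lin b' w\<bar> \<le> 1 * (\<bar>lin b w\<bar> + \<bar>e\<bar>)"
      using AE_regular by eventually_elim (use near in fastforce)
  qed auto
  then have "expectation (\<lambda>w. (lin b' w)\<^sup>2) \<le> 8 * rate\<^sup>2 / c' + 2 * e\<^sup>2" using mom by (simp add: prob_space)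
  then have "b' \<in> adm" using b' le AE_regular by (auto simp: adm_def elim: eventually_mono)
  then show ?thesis using near by (rule that)
qed

text \<open>Common variance bound for \<open>fA\<close> and \<open>fB\<close>: the 9 collects 8 from
  the admissible direction and 1 from the approximation error, and \<open>2 * lip^2\<close> stems
  from squaring a Lipschitz bound with two summands.\<close>

definition V :: real where "V = 2 * lip\<^sup>2 * (9 * rate\<^sup>2 / c' + 2 * e\<^sup>2)"

text \<open>The Chernoff bound is applied with exponent 1, which \<open>small\<close> permits
  because it bounds each \<open>fA b\<close> by 1.\<close>

lemma whp_fA:
  "whp (sample n Q) (2 * real (card adm) * exp (real n * V - a)) (\<lambda>\<omega>. \<forall>b\<in>adm. \<bar>\<Sum>i<n. fA b (\<omega> i)\<bar> \<le> a)"
proof -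
  have "whp (sample n Q) (2 * real (card adm) * exp (real n * 1\<^sup>2 * V - 1 * a)) (\<lambda>\<omega>. \<forall>b\<in>adm. \<bar>\<Sum>i<n. fA b (\<omega> i)\<bar> \<le> a)"
    unfolding sample_def
  proof (rule chernoff_power_finite[where B = "lip * (2 * \<delta> n + e)"])
    fix b assume b: "b \<in> adm"
    have bl: "AE w in Q. \<bar>lin b w\<bar> \<le> \<delta> n + e" using b by (simp add: adm_def)
    have fl: "AE w in Q. \<bar>fA b w\<bar> \<le> lip * (\<bar>lin b w\<bar> + \<bar>rm w\<bar>)"
      using bl AE_regular by eventually_elim (rule fA_le)
    show "AE w in Q. \<bar>fA b w\<bar> \<le> lip * (2 * \<delta> n + e)"
      using bl fl HTE_i(4)
    proof eventually_elim
      case (elim w)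
      then have "lip * (\<bar>lin b w\<bar> + \<bar>rm w\<bar>) \<le> lip * (2 * \<delta> n + e)" using lip_ge by (intro mult_left_mono) auto
      then show ?case using elim by simp
    qed
    \<comment> \<open>The factor in front of the noise, written as a function of
      \<open>(d, z)\<close>, as the orthogonality of \<open>\<zeta>\<close> demands.\<close>
    let ?f = "\<lambda>t. (1 - fst t) * (1 / (1 - \<Lambda> (ip (p n) (P n (snd t)) (bm G) + ip (p n) (P n (snd t)) b)) - 1 / (1 - mfun G (snd t)))"
    have "(\<integral>w. ?f (dd w, zz w) * \<zeta> w \<partial>Q) = 0"
    proof (rule integral_zeta_zero[where B = "1 * (2 / c'\<^sup>2 * (2 * \<delta> n + e))"])
      show "AE w in Q. \<bar>?f (dd w, zz w)\<bar> \<le> 1 * (2 / c'\<^sup>2 * (2 * \<delta> n + e))"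
        using bl AE_regular
      proof eventually_elim
        case (elim w)
        have "2 / c'\<^sup>2 * (\<bar>lin b w\<bar> + \<bar>rm w\<bar>) \<le> 2 / c'\<^sup>2 * (2 * \<delta> n + e)"
          using elim by (intro mult_left_mono) (auto simp: regular_def)
        then have "\<bar>1 / (1 - \<Lambda> (lin (bm G) w + lin b w)) - 1 / (1 - m w)\<bar> \<le> 2 / c'\<^sup>2 * (2 * \<delta> n + e)"
          using inverse_shift_le[of w b] elim by linarith
        then have "\<bar>1 - dd w\<bar> * \<bar>1 / (1 - \<Lambda> (lin (bm G) w + lin b w)) - 1 / (1 - m w)\<bar> \<le> 1 * (2 / c'\<^sup>2 * (2 * \<delta> n + e))"
          using regular_1d[of w] elim by (intro mult_mono) auto
        then show ?case by (simp add: abs_mult lin_def m_def)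
      qed
    qed measurable
    then show "expectation (fA b) = 0" unfolding fA_def[abs_def] by (simp add: lin_def m_def mult.assoc mult.commute)
    have "expectation (\<lambda>w. (fA b w)\<^sup>2) \<le> 2 * lip\<^sup>2 * (expectation (\<lambda>w. (lin b w)\<^sup>2) + expectation (\<lambda>w. (rm w)\<^sup>2))"
      using lip_ge by (intro second_moment_le[OF _ _ _ bl HTE_i(4) fl]) auto
    also have "\<dots> \<le> V"
    proof -
      have "rate\<^sup>2 \<le> rate\<^sup>2 / c'" using c' by (simp add: pos_le_divide_eq mult_left_le)
      then have "expectation (\<lambda>w. (lin b w)\<^sup>2) + expectation (\<lambda>w. (rm w)\<^sup>2) \<le> 9 * rate\<^sup>2 / c' + 2 * e\<^sup>2"
        using b rm_moment by (simp add: adm_def)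
      then show ?thesis unfolding V_def by (intro mult_left_mono) auto
    qed
    finally show "expectation (\<lambda>w. (fA b w)\<^sup>2) \<le> V" .
  qed (use finite_adm small in auto)
  then show ?thesis by simp
qed

text \<open>Here the centring comes from the treatment equation: \<open>fB b\<close> is
  \<open>d - m\<close> times a function of \<open>z\<close> alone, so the outcome noise does not
  enter.\<close>

lemma whp_fB:
  "whp (sample n Q) (2 * real (card adm) * exp (real n * V - a)) (\<lambda>\<omega>. \<forall>b\<in>adm. \<bar>\<Sum>i<n. fB b (\<omega> i)\<bar> \<le> a)"
proof -
  have "whp (sample n Q) (2 * real (card adm) * exp (real n * 1\<^sup>2 * V - 1 * a)) (\<lambda>\<omega>. \<forall>b\<in>adm. \<bar>\<Sum>i<n. fB b (\<omega> i)\<bar> \<le> a)"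
    unfolding sample_def
  proof (rule chernoff_power_finite[where B = "lip * (2 * \<delta> n + e)"])
    fix b assume b: "b \<in> adm"
    have bl: "AE w in Q. \<bar>lin b w\<bar> \<le> \<delta> n + e" using b by (simp add: adm_def)
    have fl: "AE w in Q. \<bar>fB b w\<bar> \<le> lip * (\<bar>lin b w\<bar> + \<bar>r0 w\<bar>)"
      using AE_regular by eventually_elim (rule fB_le)
    show "AE w in Q. \<bar>fB b w\<bar> \<le> lip * (2 * \<delta> n + e)"
      using bl fl AE_r0
    proof eventually_elim
      case (elim w)
      then have "lip * (\<bar>lin b w\<bar> + \<bar>r0 w\<bar>) \<le> lip * (2 * \<delta> n + e)" using lip_ge by (intro mult_left_mono) auto
      then show ?case using elim by simp
    qed
    let ?f = "\<lambda>z. (ip (p n) (P n z) b - (gfun G 0 z - ip (p n) (P n z) (bg0 G))) / (1 - mfun G z)"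
    have "(\<integral>w. ?f (zz w) * (dd w - m w) \<partial>Q) = 0"
    proof (rule integral_v_zero[where B = "(2 * \<delta> n + e) / c'"])
      show "AE w in Q. \<bar>?f (zz w)\<bar> \<le> (2 * \<delta> n + e) / c'"
        using bl AE_r0 AE_m
      proof eventually_elim
        case (elim w)
        have "\<bar>lin b w - r0 w\<bar> \<le> 2 * \<delta> n + e" using elim by linarith
        moreover have "c' \<le> \<bar>1 - m w\<bar>" using elim c' by linarith
        ultimately have "\<bar>lin b w - r0 w\<bar> / \<bar>1 - m w\<bar> \<le> (2 * \<delta> n + e) / c'"
          using c' by (intro frac_le) auto
        then show ?case by (simp add: lin_def r0_def m_def g0_def abs_divide)
      qed
    qed measurable
    then show "expectation (fB b) = 0" unfolding fB_def[abs_def] by (simp add: lin_def m_def r0_def g0_def h_def)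
    have "expectation (\<lambda>w. (fB b w)\<^sup>2) \<le> 2 * lip\<^sup>2 * (expectation (\<lambda>w. (lin b w)\<^sup>2) + expectation (\<lambda>w. (r0 w)\<^sup>2))"
      using lip_ge by (intro second_moment_le[OF _ _ _ bl AE_r0 fl]) auto
    also have "\<dots> \<le> V"
    proof -
      have "expectation (\<lambda>w. (lin b w)\<^sup>2) + expectation (\<lambda>w. (r0 w)\<^sup>2) \<le> 9 * rate\<^sup>2 / c' + 2 * e\<^sup>2"
        using b r0_moment by (simp add: adm_def)
      then show ?thesis unfolding V_def by (intro mult_left_mono) auto
    qed
    finally show "expectation (\<lambda>w. (fB b w)\<^sup>2) \<le> V" .
  qed (use finite_adm small in auto)
  then show ?thesis by simp
qed

section \<open>The estimated score and the product of the two errors\<close>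

definition psih :: "(nat \<Rightarrow> 'z obs) \<Rightarrow> 'z obs \<Rightarrow> real" where
  "psih \<omega> w = (yy w - lin (bhg0 n \<omega>) w) * ((dd w - \<Lambda> (lin (bhm n \<omega>) w)) / (1 - \<Lambda> (lin (bhm n \<omega>) w)))"

lemma first_stage_lin_le:
  assumes "first_stage \<omega>" "regular w"
  shows "\<bar>lin (\<theta>m \<omega>) w\<bar> \<le> \<delta> n" "\<bar>lin (\<theta>0 \<omega>) w\<bar> \<le> \<delta> n"
proof -
  show "\<bar>lin (\<theta>m \<omega>) w\<bar> \<le> \<delta> n"
    using regular_lin_le[OF assms(2), of "\<theta>m \<omega>"] assms(1) by (simp add: first_stage_def)
  have "0 \<le> K n * l1 (p n) (\<theta>1 \<omega>)"
    using K_nonneg by (cases "p n = 0") (auto simp: l1_def intro!: mult_nonneg_nonneg sum_nonneg)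
  then show "\<bar>lin (\<theta>0 \<omega>) w\<bar> \<le> \<delta> n"
    using regular_lin_le[OF assms(2), of "\<theta>0 \<omega>"] assms(1) by (simp add: first_stage_def algebra_simps)
qed

lemma lin_hat:
  "lin (bhg0 n \<omega>) w = g0 w + (lin (\<theta>0 \<omega>) w - r0 w)" "lin (bhm n \<omega>) w = lin (bm G) w + lin (\<theta>m \<omega>) w"
  by (simp_all add: \<theta>0_def[abs_def] \<theta>m_def[abs_def] lin_diff r0_def)

lemma mhat_le: "first_stage \<omega> \<Longrightarrow> regular w \<Longrightarrow> \<Lambda> (lin (bhm n \<omega>) w) \<le> 1 - c' / 2"
  unfolding lin_hat by (rule Lambda_shift(2)) (use first_stage_lin_le[of \<omega> w] e_nonneg in auto)

definition cross :: "(nat \<Rightarrow> 'z obs) \<Rightarrow> 'z obs \<Rightarrow> real" where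
  "cross \<omega> w = (1 - dd w) * (lin (\<theta>0 \<omega>) w - r0 w) * (1 / (1 - \<Lambda> (lin (bhm n \<omega>) w)) - 1 / (1 - m w))"

lemma psih_diff:
  assumes "first_stage \<omega>" "regular w"
  shows "psih \<omega> w - \<psi> w = - fA (\<theta>m \<omega>) w - fB (\<theta>0 \<omega>) w + cross \<omega> w"
proof -
  have d: "(1 - dd w) * (gfun G (dd w) (zz w) - g0 w) = 0" using assms(2) by (auto simp: regular_def g0_def)
  have 1: "m w \<noteq> 1" using assms(2) c' by (auto simp: regular_def)
  have 2: "\<Lambda> (lin (bhm n \<omega>) w) \<noteq> 1" using mhat_le[OF assms] c' by auto
  show ?thesis
    using score_diff[OF d 1 2, of "yy w" "lin (\<theta>0 \<omega>) w - r0 w"]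
    by (simp add: psih_def \<psi>_def fA_def fB_def cross_def h_def lin_hat \<zeta>_def)
qed

text \<open>Two bounds for two purposes: the quadratic one is summed over the sample and gains from
  the rates, the pointwise one yields consistency of the variance estimate.\<close>

lemma cross_le:
  assumes "first_stage \<omega>" "regular w"
  shows "\<bar>cross \<omega> w\<bar> \<le> 2 * lip * ((xt (\<theta>1 \<omega>) (\<theta>0 \<omega>) w)\<^sup>2 + (rg w)\<^sup>2 + (lin (\<theta>m \<omega>) w)\<^sup>2 + (rm w)\<^sup>2)"
    and "\<bar>cross \<omega> w\<bar> \<le> 4 * lip * \<delta> n"
proof -
  let ?D = "1 / (1 - \<Lambda> (lin (bhm n \<omega>) w)) - 1 / (1 - m w)"
  let ?a = "(1 - dd w) * (lin (\<theta>0 \<omega>) w - r0 w)"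
  let ?t = "lin (\<theta>m \<omega>) w" and ?x = "xt (\<theta>1 \<omega>) (\<theta>0 \<omega>) w"
  have D: "\<bar>?D\<bar> \<le> 2 / c'\<^sup>2 * (\<bar>?t\<bar> + \<bar>rm w\<bar>)"
    unfolding lin_hat by (rule inverse_shift_le) (use assms first_stage_lin_le[of \<omega> w] e_nonneg in auto)
  \<comment> \<open>The factor \<open>1 - d\<close> is what makes this possible: on the untreated
    the regression error can be written through \<open>xt\<close> and \<open>rg\<close>, whose sums
    of squares over the sample are controlled.\<close>
  have a: "\<bar>?a\<bar> \<le> \<bar>?x\<bar> + \<bar>rg w\<bar>"
    using assms(2) by (auto simp: regular_def xt_eq rg_def r0_def g0_def)
  have sq: "(\<bar>u\<bar> + \<bar>v\<bar>)\<^sup>2 \<le> 2 * (u\<^sup>2 + v\<^sup>2)" for u v :: real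
    using sum_squares_bound[of "\<bar>u\<bar>" "\<bar>v\<bar>"] by (simp add: power2_sum)
  have "\<bar>cross \<omega> w\<bar> \<le> (\<bar>?x\<bar> + \<bar>rg w\<bar>) * (2 / c'\<^sup>2 * (\<bar>?t\<bar> + \<bar>rm w\<bar>))"
    unfolding cross_def abs_mult[of ?a] using D a by (intro mult_mono) auto
  also have "\<dots> = 1 / c'\<^sup>2 * (2 * (\<bar>?x\<bar> + \<bar>rg w\<bar>) * (\<bar>?t\<bar> + \<bar>rm w\<bar>))" by (simp add: algebra_simps)
  also have "\<dots> \<le> 1 / c'\<^sup>2 * ((\<bar>?x\<bar> + \<bar>rg w\<bar>)\<^sup>2 + (\<bar>?t\<bar> + \<bar>rm w\<bar>)\<^sup>2)"
    by (intro mult_left_mono sum_squares_bound) auto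
  also have "\<dots> \<le> lip * (2 * (?x\<^sup>2 + (rg w)\<^sup>2) + 2 * (?t\<^sup>2 + (rm w)\<^sup>2))"
    using lip_ge by (intro mult_mono add_mono sq) auto
  finally show "\<bar>cross \<omega> w\<bar> \<le> 2 * lip * (?x\<^sup>2 + (rg w)\<^sup>2 + ?t\<^sup>2 + (rm w)\<^sup>2)"
    by (simp add: algebra_simps)
  note l = first_stage_lin_le[OF assms]
  have r: "\<bar>r0 w\<bar> \<le> \<delta> n" "\<bar>rm w\<bar> \<le> \<delta> n" using assms(2) by (auto simp: regular_def)
  have "\<bar>lin (\<theta>0 \<omega>) w - r0 w\<bar> \<le> 1"
    using l r small'(2) e_nonneg by linarith
  then have "\<bar>?a\<bar> \<le> 1 * 1"
    unfolding abs_mult using regular_1d[OF assms(2)] by (intro mult_mono) auto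
  moreover have "\<bar>?D\<bar> \<le> 2 / c'\<^sup>2 * (2 * \<delta> n)"
  proof -
    have "\<bar>?t\<bar> + \<bar>rm w\<bar> \<le> 2 * \<delta> n"
      using l r by linarith
    then have "2 / c'\<^sup>2 * (\<bar>?t\<bar> + \<bar>rm w\<bar>) \<le> 2 / c'\<^sup>2 * (2 * \<delta> n)" by (intro mult_left_mono) auto
    with D show ?thesis by simp
  qed
  ultimately have "\<bar>cross \<omega> w\<bar> \<le> 1 * (2 / c'\<^sup>2 * (2 * \<delta> n))"
    unfolding cross_def abs_mult[of ?a] by (intro mult_mono) auto
  also have "\<dots> = 1 / c'\<^sup>2 * (4 * \<delta> n)" by simp
  also have "\<dots> \<le> lip * (4 * \<delta> n)" using lip_ge \<delta>_pos by (intro mult_right_mono) auto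
  finally show "\<bar>cross \<omega> w\<bar> \<le> 4 * lip * \<delta> n" by simp
qed

text \<open>The constant is \<open>2 + 2 + 4\<close>, from the two centred terms and the product
  term.\<close>

lemma psih_close:
  assumes "first_stage \<omega>" "regular w"
  shows "\<bar>psih \<omega> w - \<psi> w\<bar> \<le> 8 * lip * \<delta> n"
proof -
  note l = first_stage_lin_le[OF assms]
  have "\<bar>rm w\<bar> \<le> \<delta> n" "\<bar>r0 w\<bar> \<le> \<delta> n" using assms(2) by (auto simp: regular_def)
  then have "lip * (\<bar>lin (\<theta>m \<omega>) w\<bar> + \<bar>rm w\<bar>) \<le> lip * (2 * \<delta> n)"
    "lip * (\<bar>lin (\<theta>0 \<omega>) w\<bar> + \<bar>r0 w\<bar>) \<le> lip * (2 * \<delta> n)"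
    using l lip_ge by (auto intro!: mult_left_mono)
  moreover have "\<bar>fA (\<theta>m \<omega>) w\<bar> \<le> lip * (\<bar>lin (\<theta>m \<omega>) w\<bar> + \<bar>rm w\<bar>)"
    using l e_nonneg by (intro fA_le assms) auto
  moreover have "\<bar>fB (\<theta>0 \<omega>) w\<bar> \<le> lip * (\<bar>lin (\<theta>0 \<omega>) w\<bar> + \<bar>r0 w\<bar>)"
    by (intro fB_le assms)
  ultimately show ?thesis
    using cross_le(2)[OF assms] psih_diff[OF assms] by linarith
qed

text \<open>Both propensities stay below \<open>1 - c' / 2\<close>, so their inverse weights differ
  by at most \<open>4 / c'^2\<close> times \<open>e\<close>; the noise contributes a further
  \<open>2 * C\<close>.\<close>

lemma fA_approx:
  assumes "first_stage \<omega>" "regular w" "\<bar>lin (\<theta>m \<omega>) w - lin b w\<bar> \<le> e"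
  shows "\<bar>fA (\<theta>m \<omega>) w - fA b w\<bar> \<le> 2 * lip * e"
proof -
  note l = first_stage_lin_le(1)[OF assms(1,2)]
  let ?L = "\<lambda>b. \<Lambda> (lin (bm G) w + lin b w)"
  have "\<bar>lin b w\<bar> \<le> \<delta> n + e" using l assms(3) by linarith
  then have "\<bar>1 / (1 - ?L (\<theta>m \<omega>)) - 1 / (1 - ?L b)\<bar> \<le> \<bar>?L (\<theta>m \<omega>) - ?L b\<bar> / (c' / 2 * (c' / 2))"
    using c' l e_nonneg by (intro inverse_diff_le Lambda_shift(2) assms(2)) auto
  also have "\<dots> = 4 / c'\<^sup>2 * \<bar>?L (\<theta>m \<omega>) - ?L b\<bar>" by (simp add: power2_eq_square)
  also have "\<dots> \<le> 4 / c'\<^sup>2 * e"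
    using Lip[of "lin (bm G) w + lin (\<theta>m \<omega>) w" "lin (bm G) w + lin b w"] assms(3)
    by (intro mult_left_mono) auto
  finally have D: "\<bar>1 / (1 - ?L (\<theta>m \<omega>)) - 1 / (1 - ?L b)\<bar> \<le> 4 / c'\<^sup>2 * e" .
  have "\<bar>(1 - dd w) * \<zeta> w\<bar> \<le> 1 * (2 * C)"
    unfolding abs_mult using regular_1d[OF assms(2)] regular_zeta[OF assms(2)] by (intro mult_mono) auto
  then have "\<bar>(1 - dd w) * \<zeta> w\<bar> * \<bar>1 / (1 - ?L (\<theta>m \<omega>)) - 1 / (1 - ?L b)\<bar> \<le> (2 * C) * (4 / c'\<^sup>2 * e)"
    using D C by (intro mult_mono) auto
  moreover have "fA (\<theta>m \<omega>) w - fA b w = (1 - dd w) * \<zeta> w * (1 / (1 - ?L (\<theta>m \<omega>)) - 1 / (1 - ?L b))"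
    by (simp add: fA_def algebra_simps)
  ultimately have "\<bar>fA (\<theta>m \<omega>) w - fA b w\<bar> \<le> (2 * C) * (4 / c'\<^sup>2 * e)" by (simp add: abs_mult)
  also have "\<dots> = 4 * C / c'\<^sup>2 * (2 * e)" by simp
  also have "\<dots> \<le> lip * (2 * e)" using lip_ge e_nonneg by (intro mult_right_mono) auto
  finally show ?thesis by simp
qed

lemma fB_approx:
  assumes "regular w" "\<bar>lin b w - lin b' w\<bar> \<le> e"
  shows "\<bar>fB b w - fB b' w\<bar> \<le> lip * e"
proof -
  have "fB b w - fB b' w = (lin b w - lin b' w) * h w" by (simp add: fB_def algebra_simps)
  then have "\<bar>fB b w - fB b' w\<bar> = \<bar>lin b w - lin b' w\<bar> * \<bar>h w\<bar>" by (simp add: abs_mult)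
  also have "\<dots> \<le> e * lip"
    using assms(2) regular_h[OF assms(1)] lip_ge(3) e_nonneg by (intro mult_mono) auto
  finally show ?thesis by (simp add: mult.commute)
qed

lemma sum_sq_le:
  assumes "Pn2norm n \<omega> f \<le> rate"
  shows "(\<Sum>i<n. (f (\<omega> i))\<^sup>2) \<le> (\<delta> n)\<^sup>2 * sqrt (real n)"
proof -
  have "En n \<omega> (\<lambda>w. (f w)\<^sup>2) = (Pn2norm n \<omega> f)\<^sup>2"
    unfolding Pn2norm_def En_def by (subst real_sqrt_pow2) (auto intro!: divide_nonneg_nonneg sum_nonneg)
  also have "\<dots> \<le> rate\<^sup>2"
    using assms by (intro power_mono) (auto simp: Pn2norm_def En_def intro!: divide_nonneg_nonneg sum_nonneg)
  finally have "(\<Sum>i<n. (f (\<omega> i))\<^sup>2) \<le> rate\<^sup>2 * real n" using n_pos by (simp add: En_def field_simps)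
  also have "\<dots> = (\<delta> n)\<^sup>2 * (real n / sqrt (real n))" unfolding rate_sq by simp
  finally show ?thesis by (simp add: real_div_sqrt)
qed

lemma abs_sum_diff_le:
  fixes f f' :: "'b \<Rightarrow> real"
  assumes "\<And>i. i < n \<Longrightarrow> \<bar>f (\<omega> i) - f' (\<omega> i)\<bar> \<le> r"
  shows "\<bar>\<Sum>i<n. f (\<omega> i)\<bar> \<le> \<bar>\<Sum>i<n. f' (\<omega> i)\<bar> + real n * r"
proof -
  have "\<bar>\<Sum>i<n. f (\<omega> i) - f' (\<omega> i)\<bar> \<le> (\<Sum>i<n. \<bar>f (\<omega> i) - f' (\<omega> i)\<bar>)" by (rule sum_abs)
  also have "\<dots> \<le> (\<Sum>i<n. r)" using assms by (intro sum_mono) auto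
  finally show ?thesis by (simp add: sum_subtractf)
qed

section \<open>The favourable event and its probability\<close>

text \<open>The only random input to the final expansion. \<open>\<kappa>\<close> is the tolerance
  for everything that must vanish; \<open>A\<close> bounds the normalised leading sum, which gets
  multiplied by the errors of the treated share and of the variance estimate.\<close>

definition good :: "real \<Rightarrow> real \<Rightarrow> (nat \<Rightarrow> 'z obs) \<Rightarrow> bool" where
  "good \<kappa> A \<omega> \<longleftrightarrow> (\<forall>i<n. regular (\<omega> i)) \<and> first_stage \<omega>
     \<and> (\<Sum>i<n. (rg (\<omega> i))\<^sup>2) \<le> \<kappa> * sqrt (real n) \<and> (\<Sum>i<n. (rm (\<omega> i))\<^sup>2) \<le> \<kappa> * sqrt (real n)
     \<and> (\<forall>b\<in>adm. \<bar>\<Sum>i<n. fA b (\<omega> i)\<bar> \<le> \<kappa> * sqrt (real n)) \<and> (\<forall>b\<in>adm. \<bar>\<Sum>i<n. fB b (\<omega> i)\<bar> \<le> \<kappa> * sqrt (real n))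
     \<and> \<bar>(\<Sum>i<n. dd (\<omega> i)) / real n - mu0 G\<bar> \<le> \<kappa> \<and> \<bar>(\<Sum>i<n. (\<phi> (\<omega> i))\<^sup>2) / real n - sigma2 G\<bar> \<le> \<kappa>
     \<and> \<bar>\<Sum>i<n. \<phi> (\<omega> i)\<bar> \<le> A * sqrt (real n)"

text \<open>Budget of the remainder: \<open>2 * \<kappa>\<close> for the centred terms at net
  points, \<open>4 * lip * \<kappa>\<close> for the approximation errors in the product,
  \<open>3 * lip\<close> times the normalised rounding error, and
  \<open>4 * lip * (\<delta> n)^2\<close> for the estimation errors in the product.\<close>

definition rem :: "real \<Rightarrow> real" where
  "rem \<kappa> = (2 + 4 * lip) * \<kappa> + 3 * lip * (sqrt (real n) * e) + 4 * lip * (\<delta> n)\<^sup>2"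

text \<open>For each favourable outcome the two estimation errors are replaced by admissible
  neighbours. The neighbours depend on the outcome, which is harmless because the bounds in
  \<open>good\<close> hold for all admissible points at once.\<close>

lemma psih_sum:
  assumes "good \<kappa> A \<omega>"
  shows "\<bar>\<Sum>i<n. psih \<omega> (\<omega> i) - \<psi> (\<omega> i)\<bar> \<le> sqrt (real n) * rem \<kappa>"
proof -
  let ?s = "sqrt (real n)"
  have reg: "\<forall>i<n. regular (\<omega> i)" and fs: "first_stage \<omega>" using assms by (auto simp: good_def)
  have ss: "real n * t = ?s * (?s * t)" for t by (simp add: mult.assoc[symmetric])
  have lm: "real (l0 (p n) (\<theta>m \<omega>)) \<le> 2 * C * s n"
    using fs HTE_l0(2) l0_diff_le[of "p n" "bhm n \<omega>" "bm G"] unfolding first_stage_def \<theta>m_def[abs_def] by linarith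
  have lg: "real (l0 (p n) (\<theta>0 \<omega>)) \<le> 2 * C * s n"
    using fs HTE_l0(1) l0_diff_le[of "p n" "bhg0 n \<omega>" "bg0 G"]
    unfolding first_stage_def \<theta>0_def[abs_def] by linarith
  have "0 \<le> K n * l1 (p n) (\<theta>1 \<omega>)"
    using K_nonneg by (cases "p n = 0") (auto simp: l1_def intro!: mult_nonneg_nonneg sum_nonneg)
  then have l1: "K n * l1 (p n) (\<theta>m \<omega>) \<le> \<delta> n" "K n * l1 (p n) (\<theta>0 \<omega>) \<le> \<delta> n"
    using fs by (simp_all add: first_stage_def algebra_simps)
  note mom = first_stage_lin_moment[OF fs reg]
  obtain b where b: "b \<in> adm" "\<And>w. regular w \<Longrightarrow> \<bar>lin (\<theta>m \<omega>) w - lin b w\<bar> \<le> e"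
    using adm_approx[OF lm l1(1) mom(1)] by blast
  obtain b' where b': "b' \<in> adm" "\<And>w. regular w \<Longrightarrow> \<bar>lin (\<theta>0 \<omega>) w - lin b' w\<bar> \<le> e"
    using adm_approx[OF lg l1(2) mom(2)] by blast
  have A: "\<bar>\<Sum>i<n. fA (\<theta>m \<omega>) (\<omega> i)\<bar> \<le> \<kappa> * ?s + real n * (2 * lip * e)"
  proof -
    have "\<bar>\<Sum>i<n. fA b (\<omega> i)\<bar> \<le> \<kappa> * ?s" using assms b(1) by (simp add: good_def)
    moreover have "\<bar>fA (\<theta>m \<omega>) (\<omega> i) - fA b (\<omega> i)\<bar> \<le> 2 * lip * e" if "i < n" for i
      using reg that by (intro fA_approx[OF fs] b(2)) auto
    then have "\<bar>\<Sum>i<n. fA (\<theta>m \<omega>) (\<omega> i)\<bar> \<le> \<bar>\<Sum>i<n. fA b (\<omega> i)\<bar> + real n * (2 * lip * e)"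
      by (rule abs_sum_diff_le)
    ultimately show ?thesis by linarith
  qed
  have B: "\<bar>\<Sum>i<n. fB (\<theta>0 \<omega>) (\<omega> i)\<bar> \<le> \<kappa> * ?s + real n * (lip * e)"
  proof -
    have "\<bar>\<Sum>i<n. fB b' (\<omega> i)\<bar> \<le> \<kappa> * ?s" using assms b'(1) by (simp add: good_def)
    moreover have "\<bar>fB (\<theta>0 \<omega>) (\<omega> i) - fB b' (\<omega> i)\<bar> \<le> lip * e" if "i < n" for i
      using reg that by (intro fB_approx b'(2)) auto
    then have "\<bar>\<Sum>i<n. fB (\<theta>0 \<omega>) (\<omega> i)\<bar> \<le> \<bar>\<Sum>i<n. fB b' (\<omega> i)\<bar> + real n * (lip * e)"
      by (rule abs_sum_diff_le)
    ultimately show ?thesis by linarith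
  qed
  have "\<bar>\<Sum>i<n. cross \<omega> (\<omega> i)\<bar> \<le> (\<Sum>i<n. \<bar>cross \<omega> (\<omega> i)\<bar>)" by (rule sum_abs)
  also have "\<dots> \<le> (\<Sum>i<n. 2 * lip * ((xt (\<theta>1 \<omega>) (\<theta>0 \<omega>) (\<omega> i))\<^sup>2 + (rg (\<omega> i))\<^sup>2 + (lin (\<theta>m \<omega>) (\<omega> i))\<^sup>2 + (rm (\<omega> i))\<^sup>2))"
    using reg by (intro sum_mono cross_le(1)[OF fs]) auto
  also have "\<dots> = 2 * lip * ((\<Sum>i<n. (xt (\<theta>1 \<omega>) (\<theta>0 \<omega>) (\<omega> i))\<^sup>2) + (\<Sum>i<n. (rg (\<omega> i))\<^sup>2)
      + (\<Sum>i<n. (lin (\<theta>m \<omega>) (\<omega> i))\<^sup>2) + (\<Sum>i<n. (rm (\<omega> i))\<^sup>2))"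
    by (simp only: sum_distrib_left[symmetric] sum.distrib)
  also have "\<dots> \<le> 2 * lip * ((\<delta> n)\<^sup>2 * ?s + \<kappa> * ?s + (\<delta> n)\<^sup>2 * ?s + \<kappa> * ?s)"
    using assms fs lip_ge unfolding good_def first_stage_def by (intro mult_left_mono add_mono sum_sq_le) auto
  finally have X: "\<bar>\<Sum>i<n. cross \<omega> (\<omega> i)\<bar> \<le> 2 * lip * ((\<delta> n)\<^sup>2 * ?s + \<kappa> * ?s + (\<delta> n)\<^sup>2 * ?s + \<kappa> * ?s)" .
  have "(\<Sum>i<n. psih \<omega> (\<omega> i) - \<psi> (\<omega> i)) = (\<Sum>i<n. - fA (\<theta>m \<omega>) (\<omega> i) - fB (\<theta>0 \<omega>) (\<omega> i) + cross \<omega> (\<omega> i))"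
    using reg by (intro sum.cong psih_diff[OF fs]) auto
  also have "\<dots> = - (\<Sum>i<n. fA (\<theta>m \<omega>) (\<omega> i)) - (\<Sum>i<n. fB (\<theta>0 \<omega>) (\<omega> i)) + (\<Sum>i<n. cross \<omega> (\<omega> i))"
    by (simp add: sum.distrib sum_subtractf sum_negf)
  finally have "\<bar>\<Sum>i<n. psih \<omega> (\<omega> i) - \<psi> (\<omega> i)\<bar>
     \<le> \<kappa> * ?s + real n * (2 * lip * e) + (\<kappa> * ?s + real n * (lip * e))
       + 2 * lip * ((\<delta> n)\<^sup>2 * ?s + \<kappa> * ?s + (\<delta> n)\<^sup>2 * ?s + \<kappa> * ?s)"
    using A B X by linarith
  also have "\<dots> = ?s * rem \<kappa>" unfolding ss rem_def by (simp add: algebra_simps)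
  finally show ?thesis .
qed

text \<open>The restrictions on \<open>\<kappa>\<close> are the admissibility conditions of the law
  of large numbers for \<open>d\<close> (bound 1) and for the squared score (bound
  \<open>phi_bound^2\<close>); the one on \<open>n\<close> admits the exponent
  \<open>1 / sqrt n\<close> for the leading sum.\<close>

lemma whp_good:
  assumes \<kappa>: "0 < \<kappa>" "\<kappa> \<le> 4" "\<kappa> \<le> 4 * phi_bound\<^sup>2" and pn: "phi_bound \<le> sqrt (real n)"
  shows "whp (sample n Q) (\<Delta> n + 2 * (\<delta> n)\<^sup>2 / \<kappa> + 4 * real (card net) * exp (real n * V - \<kappa> * sqrt (real n))
     + 2 * exp (- real n * \<kappa>\<^sup>2 / 16) + 2 * exp (- real n * \<kappa>\<^sup>2 / (16 * (phi_bound\<^sup>2)\<^sup>2)) + 2 * exp (phi_bound\<^sup>2 - A)) (good \<kappa> A)"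
proof -
  let ?s = "sqrt (real n)"
  have s: "0 < ?s" "real n = ?s * ?s" using n_pos by auto
  have PS: "prob_space (sample n Q)" unfolding sample_def by (rule prob_space_power)
  have mk: "whp (sample n Q) ((\<delta> n)\<^sup>2 / \<kappa>) (\<lambda>\<omega>. (\<Sum>i<n. (f (\<omega> i))\<^sup>2) \<le> \<kappa> * ?s)"
    if [measurable]: "f \<in> borel_measurable Q" and bd: "AE w in Q. \<bar>f w\<bar> \<le> \<delta> n"
      and mom: "expectation (\<lambda>w. (f w)\<^sup>2) \<le> rate\<^sup>2" for f
  proof -
    have b2: "AE w in Q. \<bar>(f w)\<^sup>2\<bar> \<le> (\<delta> n)\<^sup>2"
      using bd by eventually_elim (use abs_le_square_iff \<delta>_pos in fastforce)
    have "whp (sample n Q) (real n * expectation (\<lambda>w. (f w)\<^sup>2) / (\<kappa> * ?s)) (\<lambda>\<omega>. (\<Sum>i<n. (f (\<omega> i))\<^sup>2) \<le> \<kappa> * ?s)"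
      unfolding sample_def using \<kappa> s by (intro markov_power[OF _ b2]) auto
    then show ?thesis
    proof (rule whp_mono)
      have "real n * expectation (\<lambda>w. (f w)\<^sup>2) / (\<kappa> * ?s) \<le> real n * rate\<^sup>2 / (\<kappa> * ?s)"
        using \<kappa> s mom by (intro divide_right_mono mult_left_mono) auto
      also have "\<dots> = (\<delta> n)\<^sup>2 / \<kappa>" unfolding rate_sq using s \<kappa> by (simp add: divide_simps)
      finally show "real n * expectation (\<lambda>w. (f w)\<^sup>2) / (\<kappa> * ?s) \<le> (\<delta> n)\<^sup>2 / \<kappa>" .
    qed
  qed
  have w3: "whp (sample n Q) ((\<delta> n)\<^sup>2 / \<kappa>) (\<lambda>\<omega>. (\<Sum>i<n. (rg (\<omega> i))\<^sup>2) \<le> \<kappa> * ?s)"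
    by (rule mk[OF _ HTE_i(2) rg_moment]) simp
  have w4: "whp (sample n Q) ((\<delta> n)\<^sup>2 / \<kappa>) (\<lambda>\<omega>. (\<Sum>i<n. (rm (\<omega> i))\<^sup>2) \<le> \<kappa> * ?s)"
    by (rule mk[OF _ HTE_i(4) rm_moment]) simp
  have w7: "whp (sample n Q) (2 * exp (- real n * \<kappa>\<^sup>2 / 16)) (\<lambda>\<omega>. \<bar>(\<Sum>i<n. dd (\<omega> i)) / real n - mu0 G\<bar> \<le> \<kappa>)"
  proof -
    have "AE w in Q. \<bar>dd w\<bar> \<le> 1" using AE_d by eventually_elim auto
    then show ?thesis
      using lln_power[of dd 1 \<kappa> n] \<kappa> n_pos by (simp add: sample_def expectation_d)
  qed
  have w8: "whp (sample n Q) (2 * exp (- real n * \<kappa>\<^sup>2 / (16 * (phi_bound\<^sup>2)\<^sup>2)))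
      (\<lambda>\<omega>. \<bar>(\<Sum>i<n. (\<phi> (\<omega> i))\<^sup>2) / real n - sigma2 G\<bar> \<le> \<kappa>)"
  proof -
    have "AE w in Q. \<bar>(\<phi> w)\<^sup>2\<bar> \<le> phi_bound\<^sup>2"
      using AE_phi_le by eventually_elim (use abs_le_square_iff phi_bound_pos in fastforce)
    then show ?thesis
      unfolding sample_def sigma2_eq using \<kappa> n_pos phi_bound_pos by (intro lln_power) auto
  qed
  have w9: "whp (sample n Q) (2 * exp (phi_bound\<^sup>2 - A)) (\<lambda>\<omega>. \<bar>\<Sum>i<n. \<phi> (\<omega> i)\<bar> \<le> A * ?s)"
  proof -
    have "AE w in Q. (\<phi> w)\<^sup>2 \<le> phi_bound\<^sup>2"
      using AE_phi_le by eventually_elim (use abs_le_square_iff phi_bound_pos in fastforce)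
    moreover have "integrable Q (\<lambda>w. (\<phi> w)\<^sup>2)" by (rule integrable_square_AE_bounded[OF _ AE_phi_le]) simp
    ultimately have "expectation (\<lambda>w. (\<phi> w)\<^sup>2) \<le> phi_bound\<^sup>2" by (intro integral_le_const) auto
    \<comment> \<open>With exponent \<open>1 / sqrt n\<close> the variance contributes
      \<open>phi_bound^2\<close> and the deviation \<open>A\<close>, so the tail bound does not
      depend on \<open>n\<close>.\<close>
    then have "whp (sample n Q) (2 * real (card {()}) * exp (real n * (1 / ?s)\<^sup>2 * phi_bound\<^sup>2 - 1 / ?s * (A * ?s)))
       (\<lambda>\<omega>. \<forall>b\<in>{()}. \<bar>\<Sum>i<n. \<phi> (\<omega> i)\<bar> \<le> A * ?s)"
      unfolding sample_def using AE_phi_le expectation_phi s pn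
      by (intro chernoff_power_finite[where B = phi_bound]) auto
    moreover have "real n * (1 / ?s)\<^sup>2 * phi_bound\<^sup>2 - 1 / ?s * (A * ?s) = phi_bound\<^sup>2 - A"
      using n_pos by (simp add: power_divide)
    ultimately show ?thesis by simp
  qed
  note c = whp_conj[OF PS]
  have "whp (sample n Q) (0 + (\<Delta> n + ((\<delta> n)\<^sup>2 / \<kappa> + ((\<delta> n)\<^sup>2 / \<kappa>
     + (2 * real (card adm) * exp (real n * V - \<kappa> * ?s) + (2 * real (card adm) * exp (real n * V - \<kappa> * ?s)
     + (2 * exp (- real n * \<kappa>\<^sup>2 / 16) + (2 * exp (- real n * \<kappa>\<^sup>2 / (16 * (phi_bound\<^sup>2)\<^sup>2)) + 2 * exp (phi_bound\<^sup>2 - A)))))))))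
     (good \<kappa> A)"
    unfolding good_def[abs_def]
    by (intro c whp_regular whp_first_stage w3 w4 whp_fA whp_fB w7 w8 w9)
  then show ?thesis
  proof (rule whp_mono)
    have "real (card adm) * exp (real n * V - \<kappa> * ?s) \<le> real (card net) * exp (real n * V - \<kappa> * ?s)"
      using card_adm by (intro mult_right_mono) auto
    then show "0 + (\<Delta> n + ((\<delta> n)\<^sup>2 / \<kappa> + ((\<delta> n)\<^sup>2 / \<kappa>
     + (2 * real (card adm) * exp (real n * V - \<kappa> * ?s) + (2 * real (card adm) * exp (real n * V - \<kappa> * ?s)
     + (2 * exp (- real n * \<kappa>\<^sup>2 / 16) + (2 * exp (- real n * \<kappa>\<^sup>2 / (16 * (phi_bound\<^sup>2)\<^sup>2)) + 2 * exp (phi_bound\<^sup>2 - A))))))))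
     \<le> \<Delta> n + 2 * (\<delta> n)\<^sup>2 / \<kappa> + 4 * real (card net) * exp (real n * V - \<kappa> * ?s)
     + 2 * exp (- real n * \<kappa>\<^sup>2 / 16) + 2 * exp (- real n * \<kappa>\<^sup>2 / (16 * (phi_bound\<^sup>2)\<^sup>2)) + 2 * exp (phi_bound\<^sup>2 - A)"
      by (simp add: mult.assoc)
  qed
qed

section \<open>Linearisation and studentisation of the estimator\<close>

lemma phi_t_hat:
  assumes "first_stage \<omega>" "regular w"
  shows "phi_t \<gamma> (yy w) (dd w) (ghat p P bhg1 bhg0 n \<omega> 0 (zz w)) (ghat p P bhg1 bhg0 n \<omega> 1 (zz w))
      (mhat \<Lambda> p P bhm n \<omega> (zz w)) \<mu> = (psih \<omega> w - \<gamma> * dd w) / \<mu>"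
proof -
  have "\<Lambda> (lin (bhm n \<omega>) w) \<noteq> 1" using mhat_le[OF assms] c' by auto
  then show ?thesis
    by (subst phi_t_eq) (auto simp: mhat_def ghat_def xtb_def psih_def lin_def)
qed

abbreviation X :: "(nat \<Rightarrow> 'z obs) \<Rightarrow> real" where
  "X \<omega> \<equiv> sqrt (real n) * (gcheck \<Lambda> p P bhg1 bhg0 bhm n \<omega> - gamma0 G)"
abbreviation S :: "(nat \<Rightarrow> 'z obs) \<Rightarrow> real" where
  "S \<omega> \<equiv> (\<Sum>i<n. \<phi> (\<omega> i)) / sqrt (real n)"

text \<open>The estimator is the average of \<open>psih\<close> divided by \<open>muhat\<close>.
  Since the sum of \<open>d\<close> is \<open>n * muhat\<close>, the term with
  \<open>gamma0 G\<close> cancels exactly; what is left is the error of the estimated score and the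
  error of \<open>muhat\<close> times the leading sum, both divided by
  \<open>muhat \<ge> c' / 2\<close>.\<close>

lemma X_close:
  assumes g: "good \<kappa> A \<omega>" and \<kappa>: "\<kappa> \<le> c' / 2" "0 \<le> \<kappa>" and "0 \<le> A"
  shows "\<bar>X \<omega> - S \<omega>\<bar> \<le> (A * \<kappa> + rem \<kappa>) * 2 / c'"
proof -
  let ?s = "sqrt (real n)" and ?mh = "muhat n \<omega>"
  have s: "0 < ?s" "real n = ?s * ?s" using n_pos by auto
  have reg: "\<And>i. i < n \<Longrightarrow> regular (\<omega> i)" and fs: "first_stage \<omega>" using g by (auto simp: good_def)
  have mh: "\<bar>?mh - mu0 G\<bar> \<le> \<kappa>" using g by (simp add: good_def muhat_def En_def)
  then have mh_pos: "c' / 2 \<le> ?mh" using \<kappa> mu0_bounds by linarith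
  then have mh0: "0 < ?mh" using c' by linarith
  have "En n \<omega> (\<lambda>w. dd w / ?mh) = En n \<omega> dd / ?mh" by (simp add: En_def sum_divide_distrib mult.commute)
  also have "\<dots> = 1" using mh0 by (simp add: muhat_def)
  finally have e1: "En n \<omega> (\<lambda>w. dd w / ?mh) = 1" .
  have "emp_moment \<Lambda> p P bhg1 bhg0 bhm n \<omega> 0 = (\<Sum>i<n. psih \<omega> (\<omega> i) / ?mh) / real n"
    unfolding emp_moment_def En_def using phi_t_hat[OF fs reg] by (intro arg_cong2[where f = "(/)"] sum.cong) auto
  also have "\<dots> = (\<Sum>i<n. psih \<omega> (\<omega> i)) / real n / ?mh" by (simp add: sum_divide_distrib divide_divide_eq_left mult.commute)
  finally have gc: "gcheck \<Lambda> p P bhg1 bhg0 bhm n \<omega> = (\<Sum>i<n. psih \<omega> (\<omega> i)) / real n / ?mh"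
    by (simp add: gcheck_def e1)
  have mhs: "(\<Sum>i<n. dd (\<omega> i)) = ?mh * real n" using n_pos by (simp add: muhat_def En_def)
  have "mu0 G * (\<Sum>i<n. \<phi> (\<omega> i)) = (\<Sum>i<n. \<psi> (\<omega> i) - gamma0 G * dd (\<omega> i))"
    unfolding sum_distrib_left
  proof (rule sum.cong)
    fix i assume "i \<in> {..<n}"
    then have "m (\<omega> i) \<noteq> 1" using reg[of i] c' by (auto simp: regular_def)
    then show "mu0 G * \<phi> (\<omega> i) = \<psi> (\<omega> i) - gamma0 G * dd (\<omega> i)"
      using mu0_bounds c' by (simp add: phi_eq)
  qed simp
  also have "\<dots> = (\<Sum>i<n. \<psi> (\<omega> i)) - gamma0 G * (?mh * real n)"
    unfolding mhs[symmetric] by (simp add: sum_subtractf sum_distrib_left)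
  finally have ps: "(\<Sum>i<n. \<psi> (\<omega> i)) = mu0 G * (\<Sum>i<n. \<phi> (\<omega> i)) + gamma0 G * (?mh * real n)" by simp
  define D where "D = (\<Sum>i<n. psih \<omega> (\<omega> i) - \<psi> (\<omega> i))"
  have ph: "(\<Sum>i<n. psih \<omega> (\<omega> i)) = D + (mu0 G * (\<Sum>i<n. \<phi> (\<omega> i)) + gamma0 G * (?mh * real n))"
    unfolding D_def ps[symmetric] by (simp add: sum_subtractf)
  have "X \<omega> - S \<omega> = (D / ?s + (mu0 G - ?mh) * S \<omega>) / ?mh"
  proof -
    obtain r where r: "?s = r" "0 < r" "real n = r * r" using s by blast
    show ?thesis unfolding gc ph r(1) unfolding r(3) using r(2) mh0 by (simp add: field_simps)
  qed
  then have "\<bar>X \<omega> - S \<omega>\<bar> = \<bar>D / ?s + (mu0 G - ?mh) * S \<omega>\<bar> / ?mh" using mh0 by simp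
  also have "\<dots> \<le> (A * \<kappa> + rem \<kappa>) / (c' / 2)"
  proof (rule frac_le)
    have "\<bar>D / ?s\<bar> \<le> rem \<kappa>"
      using psih_sum[OF g] s by (simp add: D_def pos_divide_le_eq mult.commute)
    moreover have "\<bar>(mu0 G - ?mh) * S \<omega>\<bar> \<le> \<kappa> * A"
      unfolding abs_mult
    proof (rule mult_mono)
      show "\<bar>S \<omega>\<bar> \<le> A" using g s by (simp add: good_def pos_divide_le_eq)
    qed (use mh \<kappa> in auto)
    ultimately show le: "\<bar>D / ?s + (mu0 G - ?mh) * S \<omega>\<bar> \<le> A * \<kappa> + rem \<kappa>"
      using abs_triangle_ineq[of "D / ?s" "(mu0 G - ?mh) * S \<omega>"] mult.commute[of \<kappa> A] by linarith
    show "0 \<le> A * \<kappa> + rem \<kappa>" using le by (rule order_trans[OF abs_ge_zero])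
  qed (use mh_pos c' in auto)
  finally show ?thesis by simp
qed

text \<open>Pointwise error of the squared score, of the form \<open>q * (2 * B + q)\<close>, where
  \<open>B\<close> bounds the true score and \<open>q\<close> its estimation error after division by
  \<open>mu0 G \<ge> c'\<close>.\<close>

definition slack :: real where
  "slack = 8 * lip * \<delta> n / c' * (2 * phi_bound + 8 * lip * \<delta> n / c')"

lemma sigma2hat_close:
  assumes g: "good \<kappa> A \<omega>"
  shows "\<bar>sigma2hat \<Lambda> p P bhg1 bhg0 bhm n \<omega> G - sigma2 G\<bar> \<le> \<kappa> + slack"
proof -
  let ?q = "8 * lip * \<delta> n / c'"
  have reg: "\<And>i. i < n \<Longrightarrow> regular (\<omega> i)" and fs: "first_stage \<omega>" using g by (auto simp: good_def)
  define f where "f w = ((psih \<omega> w - gamma0 G * dd w) / mu0 G)\<^sup>2" for w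
  have sh: "sigma2hat \<Lambda> p P bhg1 bhg0 bhm n \<omega> G = (\<Sum>i<n. f (\<omega> i)) / real n"
    unfolding sigma2hat_def En_def f_def using phi_t_hat[OF fs reg]
    by (intro arg_cong2[where f = "(/)"] sum.cong) auto
  have "\<bar>f w - (\<phi> w)\<^sup>2\<bar> \<le> slack" if w: "regular w" for w
  proof -
    let ?p = "(psih \<omega> w - gamma0 G * dd w) / mu0 G"
    have m1: "m w \<noteq> 1" using w c' by (auto simp: regular_def)
    have "\<bar>yy w - g0 w\<bar> * \<bar>h w\<bar> \<le> (2 * C) * (1 / c')"
      using w C regular_h[OF w] by (intro mult_mono) (auto simp: regular_def)
    then have p: "\<bar>\<phi> w\<bar> \<le> phi_bound"
      using w by (intro phi_le m1) (auto simp: regular_def \<psi>_def abs_mult)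
    have "?p - \<phi> w = (psih \<omega> w - \<psi> w) / mu0 G"
      by (simp add: phi_eq[OF m1] diff_divide_distrib)
    then have "\<bar>?p - \<phi> w\<bar> = \<bar>psih \<omega> w - \<psi> w\<bar> / mu0 G" using mu0_bounds c' by simp
    also have "\<dots> \<le> ?q"
      using psih_close[OF fs w] mu0_bounds c' by (intro frac_le) (auto intro: order_trans[OF abs_ge_zero])
    finally have d: "\<bar>?p - \<phi> w\<bar> \<le> ?q" .
    have "f w - (\<phi> w)\<^sup>2 = (?p - \<phi> w) * (2 * \<phi> w + (?p - \<phi> w))"
      unfolding f_def by (simp add: power2_eq_square algebra_simps)
    then have "\<bar>f w - (\<phi> w)\<^sup>2\<bar> = \<bar>?p - \<phi> w\<bar> * \<bar>2 * \<phi> w + (?p - \<phi> w)\<bar>" by (simp only: abs_mult)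
    also have "\<dots> \<le> ?q * (2 * phi_bound + ?q)"
      using d p by (intro mult_mono) (auto intro: order_trans[OF abs_ge_zero])
    finally show ?thesis by (simp add: slack_def)
  qed
  then have "\<bar>\<Sum>i<n. f (\<omega> i) - (\<phi> (\<omega> i))\<^sup>2\<bar> \<le> (\<Sum>i<n. slack)"
    using reg by (intro order_trans[OF sum_abs] sum_mono) auto
  then have "\<bar>(\<Sum>i<n. f (\<omega> i)) / real n - (\<Sum>i<n. (\<phi> (\<omega> i))\<^sup>2) / real n\<bar> \<le> slack"
    using n_pos by (simp add: sum_subtractf diff_divide_distrib[symmetric] pos_divide_le_eq mult.commute)
  moreover have "\<bar>(\<Sum>i<n. (\<phi> (\<omega> i))\<^sup>2) / real n - sigma2 G\<bar> \<le> \<kappa>" using g by (simp add: good_def)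
  ultimately show ?thesis unfolding sh by linarith
qed

abbreviation sl :: real where "sl \<equiv> sigma_lower C c c'"

lemma sl_pos: "0 < sl" using c' c C by (simp add: sigma_lower_def)

lemma sqrt_sigma2_ge: "sl \<le> sqrt (sigma2 G)"
  by (rule real_le_rsqrt) (rule sigma2_lower[OF c HTE_zeta])

definition b1 :: "real \<Rightarrow> real \<Rightarrow> real" where "b1 A \<kappa> = (A * \<kappa> + rem \<kappa>) * 2 / c'"
definition b2 :: "real \<Rightarrow> real" where "b2 \<kappa> = \<kappa> + slack"

text \<open>Under the bound on \<open>b2 \<kappa>\<close> the estimated variance is at least
  \<open>sl^2 / 4\<close>. Rationalising the difference of the reciprocal roots leaves the variance
  error over a product of factors at least \<open>sl / 2\<close>, \<open>sl\<close> and
  \<open>sl\<close>, whence \<open>2 / sl ^ 3\<close>.\<close>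

lemma studentized_close:
  assumes g: "good \<kappa> A \<omega>" and \<kappa>: "\<kappa> \<le> c' / 2" "0 \<le> \<kappa>" and "0 \<le> A" and b2: "b2 \<kappa> \<le> 3 / 4 * sl\<^sup>2"
  shows "sigma2hat \<Lambda> p P bhg1 bhg0 bhm n \<omega> G > 0"
    and "\<bar>X \<omega> / sqrt (sigma2 G) - S \<omega> / sqrt (sigma2 G)\<bar> \<le> b1 A \<kappa> / sl"
    and "\<bar>X \<omega> / sqrt (sigma2hat \<Lambda> p P bhg1 bhg0 bhm n \<omega> G) - S \<omega> / sqrt (sigma2 G)\<bar>
          \<le> b1 A \<kappa> / sl + (A + b1 A \<kappa>) * (2 * b2 \<kappa> / sl ^ 3)"
proof -
  let ?v = "sigma2hat \<Lambda> p P bhg1 bhg0 bhm n \<omega> G"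
  let ?\<sigma> = "sqrt (sigma2 G)" and ?\<tau> = "sqrt ?v"
  have \<sigma>: "sl \<le> ?\<sigma>" by (rule sqrt_sigma2_ge)
  have \<sigma>0: "0 < ?\<sigma>" using \<sigma> sl_pos by linarith
  have s2: "sl\<^sup>2 \<le> sigma2 G" by (rule sigma2_lower[OF c HTE_zeta])
  have vd: "\<bar>?v - sigma2 G\<bar> \<le> b2 \<kappa>" using sigma2hat_close[OF g] by (simp add: b2_def)
  have v: "(sl / 2)\<^sup>2 \<le> ?v" using vd b2 s2 by (simp add: power_divide)
  then show v0: "?v > 0" using sl_pos by (intro less_le_trans[OF _ v]) simp
  have \<tau>: "sl / 2 \<le> ?\<tau>" by (rule real_le_rsqrt[OF v])
  have \<tau>0: "0 < ?\<tau>" using v0 by simp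
  have XS: "\<bar>X \<omega> - S \<omega>\<bar> \<le> b1 A \<kappa>" unfolding b1_def by (rule X_close) fact+
  have "\<bar>X \<omega> / ?\<sigma> - S \<omega> / ?\<sigma>\<bar> = \<bar>X \<omega> - S \<omega>\<bar> / ?\<sigma>"
    using \<sigma>0 by (simp only: diff_divide_distrib[symmetric] abs_divide abs_of_pos)
  also have "\<dots> \<le> b1 A \<kappa> / sl" using XS \<sigma> sl_pos by (intro frac_le) (auto intro: order_trans[OF abs_ge_zero])
  finally show 1: "\<bar>X \<omega> / ?\<sigma> - S \<omega> / ?\<sigma>\<bar> \<le> b1 A \<kappa> / sl" .
  have "\<bar>S \<omega>\<bar> \<le> A" using g n_pos by (simp add: good_def pos_divide_le_eq)
  then have XA: "\<bar>X \<omega>\<bar> \<le> A + b1 A \<kappa>" using XS by linarith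
  have "\<bar>1 / ?\<tau> - 1 / ?\<sigma>\<bar> \<le> 2 * b2 \<kappa> / sl ^ 3"
  proof -
    have "1 / ?\<tau> - 1 / ?\<sigma> = (?\<sigma> - ?\<tau>) / (?\<tau> * ?\<sigma>)" using \<sigma>0 \<tau>0 by (simp add: field_simps)
    also have "\<dots> = ((?\<sigma> - ?\<tau>) * (?\<sigma> + ?\<tau>)) / (?\<tau> * ?\<sigma> * (?\<sigma> + ?\<tau>))"
      using add_pos_pos[OF \<sigma>0 \<tau>0] by simp
    also have "(?\<sigma> - ?\<tau>) * (?\<sigma> + ?\<tau>) = sigma2 G - ?v"
      using \<sigma>0 v0 by (simp add: algebra_simps)
    finally have "\<bar>1 / ?\<tau> - 1 / ?\<sigma>\<bar> = \<bar>sigma2 G - ?v\<bar> / (?\<tau> * ?\<sigma> * (?\<sigma> + ?\<tau>))"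
      using \<sigma>0 \<tau>0 by (simp add: abs_mult)
    also have "\<dots> \<le> b2 \<kappa> / (sl / 2 * sl * sl)"
    proof (rule frac_le)
      show "sl / 2 * sl * sl \<le> ?\<tau> * ?\<sigma> * (?\<sigma> + ?\<tau>)"
        using \<sigma> \<tau> \<sigma>0 \<tau>0 sl_pos by (intro mult_mono) auto
    qed (use vd sl_pos in \<open>auto simp: abs_minus_commute intro: order_trans[OF abs_ge_zero]\<close>)
    finally show ?thesis by (simp add: power3_eq_cube mult.commute)
  qed
  then have "\<bar>X \<omega>\<bar> * \<bar>1 / ?\<tau> - 1 / ?\<sigma>\<bar> \<le> (A + b1 A \<kappa>) * (2 * b2 \<kappa> / sl ^ 3)"
    using XA by (intro mult_mono) (auto intro: order_trans[OF abs_ge_zero])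
  moreover have "X \<omega> / ?\<tau> - X \<omega> / ?\<sigma> = X \<omega> * (1 / ?\<tau> - 1 / ?\<sigma>)" by (simp add: right_diff_distrib)
  ultimately have "\<bar>X \<omega> / ?\<tau> - X \<omega> / ?\<sigma>\<bar> \<le> (A + b1 A \<kappa>) * (2 * b2 \<kappa> / sl ^ 3)" by (simp only: abs_mult)
  with 1 show "\<bar>X \<omega> / ?\<tau> - S \<omega> / ?\<sigma>\<bar> \<le> b1 A \<kappa> / sl + (A + b1 A \<kappa>) * (2 * b2 \<kappa> / sl ^ 3)"
    by linarith
qed

end

section \<open>Explicit rates in terms of the tolerance\<close>

text \<open>The square root of condition (iv). For \<open>n \<ge> 10\<close> the logarithm is at
  least 1, so the bound holds for \<open>s n\<close> alone as well.\<close>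

lemma Pclass_sparsity:
  assumes G: "G \<in> Pclass Zs \<delta> \<Delta> K s p C c c' \<Lambda> P bhg1 bhg0 bhm n"
    and n: "10 \<le> n" and s: "1 \<le> s n"
  shows "s n * ln (max (real (p n)) (real n)) \<le> sqrt (\<delta> n * real n)"
    and "s n \<le> sqrt (\<delta> n * real n)"
proof -
  let ?l = "ln (max (real (p n)) (real n))"
  have "exp 1 \<le> max (real (p n)) (real n)" using exp_le n by simp
  then have l: "1 \<le> ?l" using n by (subst ln_ge_iff) auto
  have "(s n * ?l)\<^sup>2 / real n \<le> \<delta> n" using G by (simp add: Pclass_def HTE_def Let_def)
  then have "(s n * ?l)\<^sup>2 \<le> \<delta> n * real n" using n by (simp add: pos_divide_le_eq)
  then show 1: "s n * ?l \<le> sqrt (\<delta> n * real n)" by (rule real_le_rsqrt)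
  have "s n * 1 \<le> s n * ?l" using l s by (intro mult_left_mono) auto
  with 1 show "s n \<le> sqrt (\<delta> n * real n)" by simp
qed

text \<open>The sparsity is at most of order \<open>sqrt n\<close>, so a mesh of
  \<open>1 / n^2\<close> makes even the normalised rounding error of order \<open>1 / n\<close>,
  while the logarithm of the net size grows by a constant factor only.\<close>

lemma sparsity_mesh_le:
  fixes C s \<delta> :: real and n :: nat
  assumes "0 < C" "0 \<le> s" "s \<le> sqrt (\<delta> * real n)" "\<delta> \<le> 1" "0 < n"
  shows "sqrt (real n) * (real (nat \<lfloor>2 * C * s\<rfloor>) * (1 / (real n)\<^sup>2)) \<le> 2 * C / real n"
proof -
  have "s \<le> sqrt (real n)"
    using assms by (intro order_trans[OF assms(3)] real_sqrt_le_mono) (simp add: mult_left_le_one_le)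
  moreover have "real (nat \<lfloor>2 * C * s\<rfloor>) \<le> 2 * C * s" using assms by (intro of_nat_floor) auto
  ultimately have "real (nat \<lfloor>2 * C * s\<rfloor>) \<le> 2 * C * sqrt (real n)"
    using assms(1) by (smt (verit) mult_left_mono)
  then have "sqrt (real n) * (real (nat \<lfloor>2 * C * s\<rfloor>) * (1 / (real n)\<^sup>2))
     \<le> sqrt (real n) * (2 * C * sqrt (real n) * (1 / (real n)\<^sup>2))"
    by (intro mult_left_mono mult_right_mono) auto
  also have "\<dots> = 2 * C * (sqrt (real n) * sqrt (real n)) / (real n)\<^sup>2" by (simp add: algebra_simps)
  also have "\<dots> = 2 * C / real n" using assms(5) by (simp add: power2_eq_square)
  finally show ?thesis .
qed

text \<open>These constants arise by replacing each rate by \<open>\<kappa>\<close> or by 1: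
  \<open>rem_factor\<close> from \<open>rem\<close>, \<open>slack_factor\<close> from
  \<open>slack\<close>; \<open>net_factor\<close> adds the logarithm of the net size to the leading
  part of \<open>n * V\<close>, whose rounding part is \<open>mesh_const\<close>. None depends on
  \<open>n\<close> or on the law, so limits can be taken uniformly.\<close>

definition rem_factor :: "real \<Rightarrow> real \<Rightarrow> real" where
  "rem_factor C c' = 2 + 8 * lip_const C c' + 6 * lip_const C c' * C"
definition slack_factor :: "real \<Rightarrow> real \<Rightarrow> real" where
  "slack_factor C c' = 8 * lip_const C c' / c' * (2 * score_bound C c' + 8 * lip_const C c' / c')"
definition net_factor :: "real \<Rightarrow> real \<Rightarrow> real" where
  "net_factor C c' = 10 * C + 18 * (lip_const C c')\<^sup>2 / c'"
definition mesh_const :: "real \<Rightarrow> real \<Rightarrow> real" where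
  "mesh_const C c' = 16 * (lip_const C c')\<^sup>2 * C\<^sup>2"

definition err_bound :: "real \<Rightarrow> real \<Rightarrow> real \<Rightarrow> real \<Rightarrow> real \<Rightarrow> real" where
  "err_bound C c c' A \<kappa> = (A + rem_factor C c') * \<kappa> * 2 / c' / sigma_lower C c c'
     + (A + (A + rem_factor C c') * \<kappa> * 2 / c') * (2 * ((1 + slack_factor C c') * \<kappa>) / (sigma_lower C c c') ^ 3)"
definition fail_bound :: "real \<Rightarrow> real \<Rightarrow> nat \<Rightarrow> real \<Rightarrow> real \<Rightarrow> real" where
  "fail_bound C c' n A \<kappa> = 2 * \<kappa> + 4 * exp (mesh_const C c' - \<kappa> * sqrt (real n) / 2)
     + 2 * exp (- real n * \<kappa>\<^sup>2 / 16) + 2 * exp (- real n * \<kappa>\<^sup>2 / (16 * ((score_bound C c')\<^sup>2)\<^sup>2))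
     + 2 * exp ((score_bound C c')\<^sup>2 - A)"

context hte
begin

text \<open>With \<open>mx\<close> the maximum of \<open>p n\<close> and \<open>n\<close>, each list
  position has at most \<open>mx^2 * mx^3 = mx^5\<close> choices and there are at most
  \<open>2 * C * s n\<close> positions; this explains \<open>10 * C\<close>. The bound
  \<open>mx \<ge> 10\<close> pays for all additive constants.\<close>

lemma card_net_le:
  assumes n: "10 \<le> n" and s: "1 \<le> s n" and \<delta>: "\<delta> n \<le> 1"
  shows "real (card net) \<le> exp (10 * C * sqrt (\<delta> n * real n))"
proof -
  define mx where "mx = max (real (p n)) (real n)"
  have mx: "10 \<le> mx" "real (p n) \<le> mx" "real n \<le> mx" using n by (auto simp: mx_def)
  let ?M = "nat \<lceil>\<delta> n / \<eta> + 1\<rceil>"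
  have "0 \<le> \<delta> n / \<eta>" using \<delta>_pos eta_pos by simp
  then have "real ?M \<le> \<delta> n / \<eta> + 2" by linarith
  also have "\<delta> n / \<eta> \<le> (real n)\<^sup>2" using \<delta> by (simp add: \<eta>_def mult_left_le_one_le \<delta>_pos less_imp_le)
  also have "(real n)\<^sup>2 \<le> mx\<^sup>2" using mx by (intro power_mono) auto
  finally have "2 * real ?M + 1 \<le> 2 * mx\<^sup>2 + 5" by simp
  also have "\<dots> \<le> 3 * mx\<^sup>2" using power_mono[OF mx(1), of 2] by simp
  also have "\<dots> \<le> mx * mx\<^sup>2" using mx by (intro mult_right_mono) auto
  finally have M: "2 * real ?M + 1 \<le> mx * mx\<^sup>2" .
  have "real (p n) + 1 \<le> 2 * mx" using mx by linarith
  also have "\<dots> \<le> mx * mx" using mx by (intro mult_right_mono) auto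
  finally have pm: "real (p n) + 1 \<le> mx * mx" .
  have "real (card net) \<le> real (((p n + 1) * (2 * ?M + 1)) ^ k)"
    unfolding net_def using card_sparse_net of_nat_le_iff by blast
  also have "\<dots> = ((real (p n) + 1) * (2 * real ?M + 1)) ^ k"
    by (simp only: of_nat_power of_nat_mult of_nat_add of_nat_1 of_nat_numeral)
  also have "\<dots> \<le> ((mx * mx) * (mx * mx\<^sup>2)) ^ k" using M pm mx by (intro power_mono mult_mono) auto
  also have "(mx * mx) * (mx * mx\<^sup>2) = mx ^ 5" by (simp add: eval_nat_numeral)
  also have "(mx ^ 5) ^ k = exp (real (5 * k) * ln mx)" using mx by (simp add: power_mult[symmetric] exp_of_nat_mult del: of_nat_mult)
  also have "\<dots> \<le> exp (10 * C * (s n * ln mx))"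
  proof -
    have "real k \<le> 2 * C * s n" unfolding k_def using C s by (intro of_nat_floor) auto
    then have "real k * (5 * ln mx) \<le> 2 * C * s n * (5 * ln mx)" using mx by (intro mult_right_mono) auto
    then show ?thesis by (simp add: algebra_simps)
  qed
  also have "\<dots> \<le> exp (10 * C * sqrt (\<delta> n * real n))"
    using Pclass_sparsity(1)[OF G n s] C by (simp add: mx_def)
  finally show ?thesis .
qed

abbreviation D1 :: real where "D1 \<equiv> rem_factor C c'"
abbreviation D2 :: real where "D2 \<equiv> slack_factor C c'"
abbreviation D3 :: real where "D3 \<equiv> net_factor C c'"
abbreviation D4 :: real where "D4 \<equiv> mesh_const C c'"
abbreviation err :: "real \<Rightarrow> real \<Rightarrow> real" where "err \<equiv> err_bound C c c'"
abbreviation fail :: "real \<Rightarrow> real \<Rightarrow> real" where "fail A \<kappa> \<equiv> \<Delta> n + fail_bound C c' n A \<kappa>"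

text \<open>The fourth power in the condition on \<open>\<kappa>\<close> makes entropy and variance
  of order \<open>\<kappa>^2 * sqrt n\<close>, one factor \<open>\<kappa>\<close> below the
  permitted deviation, and it also gives \<open>(\<delta> n)^2 / \<kappa> \<le> \<kappa>\<close> for
  the Markov terms.\<close>

lemma whp_studentized:
  assumes n: "10 \<le> n" and s: "1 \<le> s n" and A: "0 \<le> A"
    and \<kappa>: "0 < \<kappa>" "\<kappa> \<le> 1" "\<kappa> \<le> c' / 2" "\<kappa> \<le> 4 * phi_bound\<^sup>2"
    and pn: "phi_bound \<le> sqrt (real n)"
    and \<kappa>4: "\<delta> n + 1 / real n \<le> \<kappa> ^ 4" and D3\<kappa>: "D3 * \<kappa> \<le> 1 / 2" and D2\<kappa>: "(1 + D2) * \<kappa> \<le> 3 / 4 * sl\<^sup>2"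
  shows "whp (sample n Q) (fail A \<kappa>) (\<lambda>\<omega>. sigma2hat \<Lambda> p P bhg1 bhg0 bhm n \<omega> G > 0
     \<and> \<bar>X \<omega> / sqrt (sigma2 G) - S \<omega> / sqrt (sigma2 G)\<bar> \<le> err A \<kappa>
     \<and> \<bar>X \<omega> / sqrt (sigma2hat \<Lambda> p P bhg1 bhg0 bhm n \<omega> G) - S \<omega> / sqrt (sigma2 G)\<bar> \<le> err A \<kappa>)"
proof -
  let ?s = "sqrt (real n)"
  have kp: "\<kappa> ^ j \<le> \<kappa>" if "0 < j" for j using \<kappa> power_decreasing[of 1 j \<kappa>] that by simp
  have \<delta>4: "\<delta> n \<le> \<kappa> ^ 4" and n4: "1 / real n \<le> \<kappa> ^ 4" using \<kappa>4 \<delta>_pos n by (auto intro: order_trans[rotated])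
  have \<delta>1: "\<delta> n \<le> 1" using \<delta>4 kp[of 4] \<kappa> by simp
  have \<delta>\<kappa>: "\<delta> n \<le> \<kappa>" using \<delta>4 kp[of 4] by simp
  have n\<kappa>: "1 / real n \<le> \<kappa>" using n4 kp[of 4] by simp
  have \<delta>2: "(\<delta> n)\<^sup>2 \<le> \<kappa>\<^sup>2" using \<delta>\<kappa> \<delta>_pos by (intro power_mono) auto
  have \<delta>2': "(\<delta> n)\<^sup>2 \<le> \<kappa>" using \<delta>2 kp[of 2] by simp
  have lp: "0 < lip" by (rule lip_ge)
  have se: "?s * e \<le> 2 * C / real n"
    unfolding e_def \<eta>_def k_def using C s \<delta>1 n_pos Pclass_sparsity(2)[OF G n s] by (intro sparsity_mesh_le) auto
  also have "\<dots> \<le> 2 * C * \<kappa>" using n\<kappa> C mult_left_mono[OF n\<kappa>, of "2 * C"] by simp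
  finally have se\<kappa>: "?s * e \<le> 2 * C * \<kappa>" .
  have rem: "rem \<kappa> \<le> D1 * \<kappa>"
  proof -
    have "3 * lip * (?s * e) \<le> 3 * lip * (2 * C * \<kappa>)" using se\<kappa> lp by (intro mult_left_mono) auto
    moreover have "4 * lip * (\<delta> n)\<^sup>2 \<le> 4 * lip * \<kappa>" using \<delta>2' lp by (intro mult_left_mono) auto
    ultimately show ?thesis by (simp add: rem_def rem_factor_def lip_def[symmetric] algebra_simps)
  qed
  have b1: "b1 A \<kappa> \<le> (A + D1) * \<kappa> * 2 / c'"
    unfolding b1_def using rem c' by (intro divide_right_mono) (auto simp: algebra_simps)
  have slack: "slack \<le> D2 * \<kappa>"
  proof -
    have "8 * lip * \<delta> n / c' \<le> 8 * lip * \<kappa> / c'" "8 * lip * \<delta> n / c' \<le> 8 * lip * 1 / c'"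
      using \<delta>\<kappa> \<delta>1 lp c' by (auto intro!: divide_right_mono mult_left_mono)
    then have "slack \<le> 8 * lip * \<kappa> / c' * (2 * phi_bound + 8 * lip * 1 / c')"
      unfolding slack_def using lp c' \<kappa> \<delta>_pos phi_bound_pos by (intro mult_mono add_mono) auto
    also have "\<dots> = D2 * \<kappa>" by (simp add: slack_factor_def lip_def[symmetric])
    finally show ?thesis .
  qed
  then have b2: "b2 \<kappa> \<le> (1 + D2) * \<kappa>" by (simp add: b2_def algebra_simps)
  have b2s: "b2 \<kappa> \<le> 3 / 4 * sl\<^sup>2" using b2 D2\<kappa> by linarith
  have slack0: "0 \<le> slack" unfolding slack_def using lp c' \<delta>_pos phi_bound_pos by auto
  have rem0: "0 \<le> rem \<kappa>" unfolding rem_def using lp \<kappa> e_nonneg by auto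
  have b10: "0 \<le> b1 A \<kappa>" unfolding b1_def using rem0 A \<kappa> c' by auto
  have e1: "b1 A \<kappa> / sl \<le> (A + D1) * \<kappa> * 2 / c' / sl" using b1 sl_pos by (intro divide_right_mono) auto
  have e2: "(A + b1 A \<kappa>) * (2 * b2 \<kappa> / sl ^ 3) \<le> (A + (A + D1) * \<kappa> * 2 / c') * (2 * ((1 + D2) * \<kappa>) / sl ^ 3)"
    using b1 b2 b10 A sl_pos slack0 \<kappa> by (intro mult_mono add_mono divide_right_mono) (auto simp: b2_def)
  have e20: "0 \<le> (A + (A + D1) * \<kappa> * 2 / c') * (2 * ((1 + D2) * \<kappa>) / sl ^ 3)"
    by (rule order_trans[OF _ e2]) (use b10 A slack0 \<kappa> sl_pos in \<open>auto simp: b2_def\<close>)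
  have "whp (sample n Q) (\<Delta> n + 2 * (\<delta> n)\<^sup>2 / \<kappa> + 4 * real (card net) * exp (real n * V - \<kappa> * ?s)
     + 2 * exp (- real n * \<kappa>\<^sup>2 / 16) + 2 * exp (- real n * \<kappa>\<^sup>2 / (16 * (phi_bound\<^sup>2)\<^sup>2)) + 2 * exp (phi_bound\<^sup>2 - A)) (good \<kappa> A)"
    using \<kappa> pn by (intro whp_good) auto
  then show ?thesis
  proof (rule whp_mono)
    fix \<omega> assume "good \<kappa> A \<omega>"
    from studentized_close[OF this \<kappa>(3) less_imp_le[OF \<kappa>(1)] A b2s]
    show "sigma2hat \<Lambda> p P bhg1 bhg0 bhm n \<omega> G > 0
     \<and> \<bar>X \<omega> / sqrt (sigma2 G) - S \<omega> / sqrt (sigma2 G)\<bar> \<le> err A \<kappa>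
     \<and> \<bar>X \<omega> / sqrt (sigma2hat \<Lambda> p P bhg1 bhg0 bhm n \<omega> G) - S \<omega> / sqrt (sigma2 G)\<bar> \<le> err A \<kappa>"
      using e1 e2 e20 unfolding err_bound_def by linarith
  next
    have 1: "2 * (\<delta> n)\<^sup>2 / \<kappa> \<le> 2 * \<kappa>"
      using \<delta>2 \<kappa> by (simp add: pos_divide_le_eq power2_eq_square)
    have sd: "sqrt (\<delta> n * real n) \<le> \<kappa>\<^sup>2 * ?s"
    proof -
      have "sqrt (\<delta> n) \<le> sqrt ((\<kappa>\<^sup>2)\<^sup>2)" using \<delta>4 by (intro real_sqrt_le_mono) simp
      also have "\<dots> = \<kappa>\<^sup>2" by (rule real_sqrt_unique) auto
      finally show ?thesis by (simp add: real_sqrt_mult mult_right_mono)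
    qed
    have nV: "real n * V \<le> 18 * lip\<^sup>2 / c' * \<kappa>\<^sup>2 * ?s + D4"
    proof -
      have nr: "real n * rate\<^sup>2 = (\<delta> n)\<^sup>2 * ?s"
      proof -
        have "real n * rate\<^sup>2 = (\<delta> n)\<^sup>2 * (real n / ?s)" unfolding rate_sq by simp
        then show ?thesis by (simp only: real_div_sqrt[OF of_nat_0_le_iff])
      qed
      have ne: "real n * e\<^sup>2 = (?s * e)\<^sup>2" by (simp add: power_mult_distrib)
      have "real n * V = 18 * lip\<^sup>2 / c' * (real n * rate\<^sup>2) + 4 * lip\<^sup>2 * (real n * e\<^sup>2)"
        by (simp add: V_def algebra_simps)
      also have "\<dots> = 18 * lip\<^sup>2 / c' * ((\<delta> n)\<^sup>2 * ?s) + 4 * lip\<^sup>2 * (?s * e)\<^sup>2" unfolding nr ne ..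
      also have "\<dots> \<le> 18 * lip\<^sup>2 / c' * (\<kappa>\<^sup>2 * ?s) + 4 * lip\<^sup>2 * (2 * C)\<^sup>2"
      proof (intro add_mono mult_left_mono mult_right_mono power_mono \<delta>2)
        show "?s * e \<le> 2 * C" using se\<kappa> \<kappa>(2) C mult_left_mono[OF \<kappa>(2), of "2 * C"] by linarith
      qed (use e_nonneg c' \<delta>\<kappa> \<delta>_pos in auto)
      also have "\<dots> = 18 * lip\<^sup>2 / c' * \<kappa>\<^sup>2 * ?s + D4" by (simp add: mesh_const_def lip_def[symmetric] power_mult_distrib)
      finally show ?thesis .
    qed
    have "real (card net) * exp (real n * V - \<kappa> * ?s) \<le> exp (10 * C * sqrt (\<delta> n * real n)) * exp (real n * V - \<kappa> * ?s)"
      using card_net_le[OF n s \<delta>1] by (intro mult_right_mono) auto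
    also have "\<dots> = exp (10 * C * sqrt (\<delta> n * real n) + real n * V - \<kappa> * ?s)" by (simp add: exp_add[symmetric])
    \<comment> \<open>By \<open>D3 * \<kappa> \<le> 1/2\<close>, entropy and variance together
      consume at most half of the deviation \<open>\<kappa> * sqrt n\<close>; the other half remains
      in the failure probability.\<close>
    also have "\<dots> \<le> exp (D4 - \<kappa> * ?s / 2)"
    proof (subst exp_le_cancel_iff)
      have "10 * C * sqrt (\<delta> n * real n) \<le> 10 * C * (\<kappa>\<^sup>2 * ?s)" using sd C by (intro mult_left_mono) auto
      then have "10 * C * sqrt (\<delta> n * real n) + real n * V \<le> D3 * \<kappa> * (\<kappa> * ?s) + D4"
        using nV by (simp add: net_factor_def lip_def[symmetric] algebra_simps power2_eq_square)
      also have "D3 * \<kappa> * (\<kappa> * ?s) \<le> 1 / 2 * (\<kappa> * ?s)" using D3\<kappa> \<kappa> by (intro mult_right_mono) auto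
      finally show "10 * C * sqrt (\<delta> n * real n) + real n * V - \<kappa> * ?s \<le> D4 - \<kappa> * ?s / 2" by simp
    qed
    finally have 2: "4 * real (card net) * exp (real n * V - \<kappa> * ?s) \<le> 4 * exp (D4 - \<kappa> * ?s / 2)" by simp
    show "\<Delta> n + 2 * (\<delta> n)\<^sup>2 / \<kappa> + 4 * real (card net) * exp (real n * V - \<kappa> * ?s)
     + 2 * exp (- real n * \<kappa>\<^sup>2 / 16) + 2 * exp (- real n * \<kappa>\<^sup>2 / (16 * (phi_bound\<^sup>2)\<^sup>2)) + 2 * exp (phi_bound\<^sup>2 - A) \<le> fail A \<kappa>"
      unfolding fail_bound_def using 1 2 by linarith
  qed
qed

end

section \<open>Uniform limits\<close>

locale hte_seq =
  fixes \<delta> \<Delta> K s :: "nat \<Rightarrow> real" and p :: "nat \<Rightarrow> nat" and C c c' :: real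
    and Zs :: "'z measure" and P :: "nat \<Rightarrow> 'z \<Rightarrow> nat \<Rightarrow> real" and \<Lambda> :: "real \<Rightarrow> real"
    and bhg1 bhg0 bhm :: "nat \<Rightarrow> (nat \<Rightarrow> 'z obs) \<Rightarrow> nat \<Rightarrow> real"
  assumes \<delta>: "\<And>n. \<delta> n > 0" "\<delta> \<longlonglongrightarrow> 0"
    and \<Delta>: "\<Delta> \<longlonglongrightarrow> 0"
    and s: "\<And>n. s n \<ge> 1"
    and C: "C > 0" and c: "c > 0" and c': "0 < c'" "c' < 1/2"
    and Lip: "\<And>u v. \<bar>\<Lambda> u - \<Lambda> v\<bar> \<le> \<bar>u - v\<bar>"
    and P: "\<And>n j. (\<lambda>z. P n z j) \<in> borel_measurable Zs"
    and bh: "\<And>n j. (\<lambda>\<omega>. bhg1 n \<omega> j) \<in> borel_measurable (sample n (obs_space Zs))"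
      "\<And>n j. (\<lambda>\<omega>. bhg0 n \<omega> j) \<in> borel_measurable (sample n (obs_space Zs))"
      "\<And>n j. (\<lambda>\<omega>. bhm n \<omega> j) \<in> borel_measurable (sample n (obs_space Zs))"
begin

abbreviation "PP n \<equiv> Pclass Zs \<delta> \<Delta> K s p C c c' \<Lambda> P bhg1 bhg0 bhm n"
abbreviation "gch n \<omega> \<equiv> gcheck \<Lambda> p P bhg1 bhg0 bhm n \<omega>"
abbreviation "s2h n G \<omega> \<equiv> sigma2hat \<Lambda> p P bhg1 bhg0 bhm n \<omega> G"
abbreviation "T1 n G \<omega> \<equiv> sqrt (real n) * (gch n \<omega> - gamma0 G) / sqrt (sigma2 G)"
abbreviation "T2 n G \<omega> \<equiv> sqrt (real n) * (gch n \<omega> - gamma0 G) / sqrt (s2h n G \<omega>)"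
abbreviation "T0 n G \<omega> \<equiv> (\<Sum>i<n. overlap_model.\<phi> G (\<omega> i)) / sqrt (real n) / sqrt (sigma2 G)"

lemma measurable_statistics:
  assumes "sets Q = sets (obs_space Zs)"
  shows "gch n \<in> borel_measurable (sample n Q)" "s2h n G \<in> borel_measurable (sample n Q)"
proof -
  have sQ: "sets (sample n Q) = sets (sample n (obs_space Zs))"
    unfolding sample_def by (intro sets_PiM_cong) (simp_all add: assms)
  have comp: "(\<lambda>\<omega>. \<omega> i) \<in> measurable (sample n Q) (borel \<Otimes>\<^sub>M (borel \<Otimes>\<^sub>M Zs))" if "i < n" for i
  proof -
    have "(\<lambda>\<omega>. \<omega> i) \<in> measurable (sample n (obs_space Zs)) (obs_space Zs)"
      unfolding sample_def using that by (intro measurable_component_singleton) simp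
    then show ?thesis by (simp only: measurable_cong_sets[OF sQ refl] obs_space_def)
  qed
  have y: "(\<lambda>\<omega>. yy (\<omega> i)) \<in> borel_measurable (sample n Q)" and d: "(\<lambda>\<omega>. dd (\<omega> i)) \<in> borel_measurable (sample n Q)"
    and z: "(\<lambda>\<omega>. zz (\<omega> i)) \<in> measurable (sample n Q) Zs" if "i < n" for i
    unfolding yy_def dd_def zz_def using comp[OF that] by measurable
  have b: "(\<lambda>\<omega>. bhg1 n \<omega> j) \<in> borel_measurable (sample n Q)" "(\<lambda>\<omega>. bhg0 n \<omega> j) \<in> borel_measurable (sample n Q)"
    "(\<lambda>\<omega>. bhm n \<omega> j) \<in> borel_measurable (sample n Q)" for j
    using bh unfolding measurable_cong_sets[OF sQ refl] by auto
  have Px: "(\<lambda>\<omega>. P n (zz (\<omega> i)) j) \<in> borel_measurable (sample n Q)" if "i < n" for i j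
    by (rule measurable_compose[OF z[OF that] P])
  have ghat: "(\<lambda>\<omega>. ghat p P bhg1 bhg0 n \<omega> t (zz (\<omega> i))) \<in> borel_measurable (sample n Q)" if "i < n" for i t
    unfolding ghat_def xtb_def ip_def using Px[OF that] b by measurable
  have "continuous_on UNIV \<Lambda>"
    by (rule lipschitz_on_continuous_on[of 1]) (use Lip in \<open>auto intro!: lipschitz_onI simp: dist_real_def\<close>)
  then have L: "\<Lambda> \<in> borel_measurable borel" by (rule borel_measurable_continuous_onI)
  have mhat: "(\<lambda>\<omega>. mhat \<Lambda> p P bhm n \<omega> (zz (\<omega> i))) \<in> borel_measurable (sample n Q)" if "i < n" for i
    unfolding mhat_def ip_def
    by (rule measurable_compose[OF _ L]) (use Px[OF that] b in measurable)
  have muh: "muhat n \<in> borel_measurable (sample n Q)"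
    unfolding muhat_def[abs_def] En_def using d by (intro borel_measurable_divide borel_measurable_sum) auto
  have phi: "(\<lambda>\<omega>. phi_t \<gamma> (yy (\<omega> i)) (dd (\<omega> i)) (ghat p P bhg1 bhg0 n \<omega> 0 (zz (\<omega> i)))
      (ghat p P bhg1 bhg0 n \<omega> 1 (zz (\<omega> i))) (mhat \<Lambda> p P bhm n \<omega> (zz (\<omega> i))) (f \<omega>)) \<in> borel_measurable (sample n Q)"
    if "i < n" "f \<in> borel_measurable (sample n Q)" for i \<gamma> f
    unfolding phi_t_def using y[OF that(1)] d[OF that(1)] ghat[OF that(1)] mhat[OF that(1)] that(2) by measurable
  show "gch n \<in> borel_measurable (sample n Q)"
    unfolding gcheck_def[abs_def] emp_moment_def En_def
    by (intro borel_measurable_divide borel_measurable_sum phi muh d) auto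
  show "s2h n G \<in> borel_measurable (sample n Q)"
    unfolding sigma2hat_def En_def
    by (intro borel_measurable_divide borel_measurable_sum borel_measurable_power phi) auto
qed

lemma PP_sets: "G \<in> PP n \<Longrightarrow> sets (law G) = sets (obs_space Zs)"
  and PP_prob: "G \<in> PP n \<Longrightarrow> prob_space (law G)"
  by (auto simp: Pclass_def model_def Let_def)

lemma prob_sample: "G \<in> PP n \<Longrightarrow> prob_space (sample n (law G))"
  unfolding sample_def by (intro prob_space_PiM PP_prob)

lemma measurable_T:
  assumes "G \<in> PP n"
  shows "T1 n G \<in> borel_measurable (sample n (law G))" "T2 n G \<in> borel_measurable (sample n (law G))"
proof -
  note [measurable] = measurable_statistics[OF PP_sets[OF assms]]
  show "T1 n G \<in> borel_measurable (sample n (law G))" "T2 n G \<in> borel_measurable (sample n (law G))" by measurable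
qed

text \<open>The rounding error is at most \<open>2 * C / n\<close> for every member of the class, so
  the threshold beyond which \<open>small\<close> holds does not depend on the law.\<close>

lemma eventually_hte: "\<forall>\<^sub>F n in sequentially. \<forall>G\<in>PP n. hte \<delta> \<Delta> K s p C c c' Zs P \<Lambda> bhg1 bhg0 bhm n G"
proof -
  have "(\<lambda>n. lip_const C c' * (2 * \<delta> n + 2 * C / real n)) \<longlonglongrightarrow> lip_const C c' * (2 * 0 + 0)"
    by (intro tendsto_intros \<delta> lim_const_over_n)
  then have ev1: "\<forall>\<^sub>F n in sequentially. lip_const C c' * (2 * \<delta> n + 2 * C / real n) < 1"
    by (rule order_tendstoD) simp
  have ev2: "\<forall>\<^sub>F n in sequentially. \<delta> n < 1" by (rule order_tendstoD[OF \<delta>(2)]) simp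
  show ?thesis
    using ev1 ev2 eventually_ge_at_top[of 10]
  proof eventually_elim
    case (elim n)
    show ?case
    proof
      fix G assume G: "G \<in> PP n"
      let ?e = "real (nat \<lfloor>2 * C * s n\<rfloor>) * (1 / (real n)\<^sup>2)"
      have "sqrt (real n) * ?e \<le> 2 * C / real n"
        using Pclass_sparsity(2)[OF G elim(3) s] C s[of n] elim by (intro sparsity_mesh_le) auto
      moreover have "1 * ?e \<le> sqrt (real n) * ?e" using elim by (intro mult_right_mono) auto
      ultimately have "?e \<le> 2 * C / real n" by simp
      moreover have "0 \<le> lip_const C c'" using C c' by (simp add: lip_const_def)
      ultimately have "lip_const C c' * (2 * \<delta> n + ?e) \<le> lip_const C c' * (2 * \<delta> n + 2 * C / real n)"
        by (intro mult_left_mono) auto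
      then have "lip_const C c' * (2 * \<delta> n + ?e) \<le> 1" using elim by simp
      then show "hte \<delta> \<Delta> K s p C c c' Zs P \<Lambda> bhg1 bhg0 bhm n G"
        using G C c c' Lip P \<delta> elim by unfold_locales auto
    qed
  qed
qed

text \<open>Any null sequence that dominates \<open>\<delta> n powr (1/2)\<close> and decays more slowly than \<open>n powr (-1/2)\<close>
  would do.\<close>
definition \<kappa> :: "nat \<Rightarrow> real" where "\<kappa> n = root 4 (\<delta> n + 1 / real n)"

lemma kappa_pow: "\<kappa> n ^ 4 = \<delta> n + 1 / real n"
  unfolding \<kappa>_def using \<delta>(1)[of n] by (intro real_root_pow_pos2) (auto intro: add_nonneg_nonneg less_imp_le)

lemma kappa_pos: "0 < \<kappa> n"
  unfolding \<kappa>_def using \<delta>(1)[of n] by (intro real_root_gt_zero) (auto intro: add_pos_nonneg)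

lemma kappa_tendsto: "\<kappa> \<longlonglongrightarrow> 0"
proof -
  have "(\<lambda>n. root 4 (\<delta> n + 1 / real n)) \<longlonglongrightarrow> root 4 (0 + 0)"
    by (intro tendsto_intros \<delta> lim_const_over_n)
  then show ?thesis by (simp add: \<kappa>_def[abs_def])
qed

text \<open>The summand \<open>1 / n\<close> in \<open>\<kappa> n ^ 4\<close> gives
  \<open>n * (\<kappa> n)^2 \<ge> sqrt n\<close>, however fast \<open>\<delta>\<close>
  decays.\<close>

lemma kappa_sq_at_top: "filterlim (\<lambda>n. real n * (\<kappa> n)\<^sup>2) at_top sequentially"
  and kappa_sqrt_at_top: "filterlim (\<lambda>n. \<kappa> n * sqrt (real n)) at_top sequentially"
proof -
  have sq: "sqrt (real n) \<le> real n * (\<kappa> n)\<^sup>2" for n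
  proof (rule real_le_lsqrt)
    have "real n = (real n)\<^sup>2 * (1 / real n)" by (cases "n = 0") (auto simp: power2_eq_square)
    also have "\<dots> \<le> (real n)\<^sup>2 * \<kappa> n ^ 4"
      unfolding kappa_pow using \<delta>(1)[of n] by (intro mult_left_mono) auto
    also have "\<dots> = (real n * (\<kappa> n)\<^sup>2)\<^sup>2" by (simp add: power_mult_distrib)
    finally show "real n \<le> (real n * (\<kappa> n)\<^sup>2)\<^sup>2" .
  qed auto
  have s1: "filterlim (\<lambda>n. sqrt (real n)) at_top sequentially"
    by (rule filterlim_compose[OF sqrt_at_top filterlim_real_sequentially])
  show "filterlim (\<lambda>n. real n * (\<kappa> n)\<^sup>2) at_top sequentially"
    by (rule filterlim_at_top_mono[OF s1]) (simp add: sq)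
  have "filterlim (\<lambda>n. sqrt (sqrt (real n))) at_top sequentially"
    by (rule filterlim_compose[OF sqrt_at_top s1])
  then show "filterlim (\<lambda>n. \<kappa> n * sqrt (real n)) at_top sequentially"
  proof (rule filterlim_at_top_mono)
    have "sqrt (real n * (\<kappa> n)\<^sup>2) = \<kappa> n * sqrt (real n)" for n
      using kappa_pos[of n] by (simp add: real_sqrt_mult)
    then show "\<forall>\<^sub>F n in sequentially. sqrt (sqrt (real n)) \<le> \<kappa> n * sqrt (real n)"
      using sq by (metis (no_types, lifting) always_eventually real_sqrt_le_mono)
  qed
qed

text \<open>For fixed \<open>A\<close> the tail of the leading sum survives in the limit; it is made
  small afterwards by the choice of \<open>A\<close>.\<close>

lemma fail_tendsto: "(\<lambda>n. \<Delta> n + fail_bound C c' n A (\<kappa> n)) \<longlonglongrightarrow> 2 * exp ((score_bound C c')\<^sup>2 - A)"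
proof -
  have b: "0 < 16 * ((score_bound C c')\<^sup>2)\<^sup>2" using C c' by (simp add: score_bound_def)
  have e1: "(\<lambda>n. exp (mesh_const C c' - \<kappa> n * sqrt (real n) / 2)) \<longlonglongrightarrow> 0"
  proof (rule filterlim_compose[OF exp_at_bot])
    have "filterlim (\<lambda>n. - mesh_const C c' + 1/2 * (\<kappa> n * sqrt (real n))) at_top sequentially"
      by (intro filterlim_tendsto_add_at_top[OF tendsto_const] filterlim_tendsto_pos_mult_at_top[OF tendsto_const] kappa_sqrt_at_top) auto
    then show "filterlim (\<lambda>n. mesh_const C c' - \<kappa> n * sqrt (real n) / 2) at_bot sequentially"
      by (subst filterlim_uminus_at_bot) (simp add: algebra_simps)
  qed
  have e2: "(\<lambda>n. exp (- real n * (\<kappa> n)\<^sup>2 / a)) \<longlonglongrightarrow> 0" if "0 < a" for a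
  proof (rule filterlim_compose[OF exp_at_bot])
    have "filterlim (\<lambda>n. 1 / a * (real n * (\<kappa> n)\<^sup>2)) at_top sequentially"
      using that by (intro filterlim_tendsto_pos_mult_at_top[OF tendsto_const] kappa_sq_at_top) auto
    then show "filterlim (\<lambda>n. - real n * (\<kappa> n)\<^sup>2 / a) at_bot sequentially"
      by (subst filterlim_uminus_at_bot) simp
  qed
  have "(\<lambda>n. \<Delta> n + fail_bound C c' n A (\<kappa> n)) \<longlonglongrightarrow> 0 + (2 * 0 + 4 * 0 + 2 * 0 + 2 * 0 + 2 * exp ((score_bound C c')\<^sup>2 - A))"
    unfolding fail_bound_def using b by (intro tendsto_intros \<Delta> kappa_tendsto e1 e2) auto
  then show ?thesis by simp
qed

lemma err_tendsto: "(\<lambda>n. err_bound C c c' A (\<kappa> n)) \<longlonglongrightarrow> 0"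
proof -
  have sl: "sigma_lower C c c' \<noteq> 0" "c' \<noteq> 0" using C c c' by (auto simp: sigma_lower_def)
  have "(\<lambda>n. err_bound C c c' A (\<kappa> n)) \<longlonglongrightarrow> (A + rem_factor C c') * 0 * 2 / c' / sigma_lower C c c'
     + (A + (A + rem_factor C c') * 0 * 2 / c') * (2 * ((1 + slack_factor C c') * 0) / (sigma_lower C c c') ^ 3)"
    unfolding err_bound_def using sl by (intro tendsto_intros kappa_tendsto) auto
  then show ?thesis by simp
qed

lemma eventually_whp:
  assumes "0 < \<epsilon>"
  shows "\<forall>\<^sub>F n in sequentially. \<forall>G\<in>PP n. whp (sample n (law G)) \<epsilon>
    (\<lambda>\<omega>. s2h n G \<omega> > 0 \<and> \<bar>T1 n G \<omega> - T0 n G \<omega>\<bar> < \<epsilon> \<and> \<bar>T2 n G \<omega> - T0 n G \<omega>\<bar> < \<epsilon>)"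
proof -
  let ?pb = "score_bound C c'" and ?sl = "sigma_lower C c c'"
  \<comment> \<open>\<open>A\<close> depends on \<open>\<epsilon>\<close> and the score bound alone
    and is fixed before \<open>n\<close> grows. It leaves a limiting failure probability of at most
    \<open>\<epsilon> / 2\<close>; the maximum with 0 meets the sign requirement on
    \<open>A\<close>.\<close>
  define A where "A = max 0 (?pb\<^sup>2 - ln (\<epsilon> / 4))"
  have "?pb\<^sup>2 - A \<le> ln (\<epsilon> / 4)" by (simp add: A_def)
  then have "exp (?pb\<^sup>2 - A) \<le> \<epsilon> / 4" using assms by (metis exp_le_cancel_iff exp_ln divide_pos_pos zero_less_numeral)
  then have lt: "2 * exp (?pb\<^sup>2 - A) < \<epsilon>" using assms by simp
  have pb: "0 < ?pb" and sl: "0 < ?sl" using C c c' by (auto simp: score_bound_def sigma_lower_def)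
  have p4: "0 < 4 * ?pb\<^sup>2" and s4: "0 < 3 / 4 * ?sl\<^sup>2" using pb sl by simp_all
  have mk: "\<forall>\<^sub>F n in sequentially. a * \<kappa> n < b" if "0 < b" for a b
  proof -
    have "(\<lambda>n. a * \<kappa> n) \<longlonglongrightarrow> a * 0" by (intro tendsto_intros kappa_tendsto)
    then show ?thesis using that by (intro order_tendstoD) auto
  qed
  have sq: "\<forall>\<^sub>F n in sequentially. ?pb \<le> sqrt (real n)"
    using filterlim_compose[OF sqrt_at_top filterlim_real_sequentially] by (simp add: filterlim_at_top)
  show ?thesis
    using eventually_hte eventually_ge_at_top[of 10] sq order_tendstoD(2)[OF fail_tendsto lt]
      order_tendstoD(2)[OF err_tendsto[of A] assms] mk[OF zero_less_one, of 1] mk[OF half_gt_zero[OF c'(1)], of 1]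
      mk[OF p4, of 1] mk[OF half_gt_zero[OF zero_less_one], of "net_factor C c'"] mk[OF s4, of "1 + slack_factor C c'"]
  proof eventually_elim
    case (elim n)
    show ?case
    proof
      fix G assume "G \<in> PP n"
      then interpret hte \<delta> \<Delta> K s p C c c' Zs P \<Lambda> bhg1 bhg0 bhm n G "nat \<lfloor>2 * C * s n\<rfloor>" "1 / (real n)\<^sup>2"
        "real (nat \<lfloor>2 * C * s n\<rfloor>) * (1 / (real n)\<^sup>2)" "lip_const C c'"
        using elim by auto
      have "whp (sample n (law G)) (fail A (\<kappa> n)) (\<lambda>\<omega>. s2h n G \<omega> > 0
         \<and> \<bar>X \<omega> / sqrt (sigma2 G) - S \<omega> / sqrt (sigma2 G)\<bar> \<le> err A (\<kappa> n)
         \<and> \<bar>X \<omega> / sqrt (s2h n G \<omega>) - S \<omega> / sqrt (sigma2 G)\<bar> \<le> err A (\<kappa> n))"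
        using elim pb sl c' kappa_pos[of n] hte_seq.s hte_seq_axioms
        by (intro whp_studentized) (auto simp: A_def kappa_pow)
      then show "whp (sample n (law G)) \<epsilon>
        (\<lambda>\<omega>. s2h n G \<omega> > 0 \<and> \<bar>T1 n G \<omega> - T0 n G \<omega>\<bar> < \<epsilon> \<and> \<bar>T2 n G \<omega> - T0 n G \<omega>\<bar> < \<epsilon>)"
        by (rule whp_mono) (use elim in linarith)+
    qed
  qed
qed

section \<open>Convergence in distribution and coverage\<close>

text \<open>Dividing by the standard deviation standardises the score, and the lower bound on the
  variance bounds the result by \<open>score_bound C c' / sigma_lower C c c'\<close>, the same for
  all laws in the class.\<close>

lemma eventually_T0_cdf:
  assumes "0 < \<epsilon>"
  shows "\<forall>\<^sub>F n in sequentially. \<forall>G\<in>PP n. T0 n G \<in> borel_measurable (sample n (law G)) \<and>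
    \<bar>measure (sample n (law G)) {\<omega> \<in> space (sample n (law G)). T0 n G \<omega> \<le> x} - cdf std_normal_distribution x\<bar> \<le> \<epsilon>"
  using eventually_hte clt_power_uniform[where 'a = "'z obs", OF assms, of "score_bound C c' / sigma_lower C c c'" x]
proof eventually_elim
  case (elim n)
  show ?case
  proof
    fix G assume "G \<in> PP n"
    then interpret hte \<delta> \<Delta> K s p C c c' Zs P \<Lambda> bhg1 bhg0 bhm n G "nat \<lfloor>2 * C * s n\<rfloor>" "1 / (real n)\<^sup>2"
      "real (nat \<lfloor>2 * C * s n\<rfloor>) * (1 / (real n)\<^sup>2)" "lip_const C c'"
      using elim by auto
    let ?f = "\<lambda>w. \<phi> w / sqrt (sigma2 G)"
    have sg: "0 < sqrt (sigma2 G)" using sqrt_sigma2_ge sl_pos by linarith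
    have m: "?f \<in> borel_measurable Q" by measurable
    have "AE w in Q. \<bar>?f w\<bar> \<le> phi_bound / sl"
      using AE_phi_le
    proof eventually_elim
      case (elim w)
      have "\<bar>\<phi> w\<bar> / sqrt (sigma2 G) \<le> phi_bound / sl"
        using elim sqrt_sigma2_ge sl_pos phi_bound_pos by (intro frac_le) auto
      then show ?case using sg by simp
    qed
    moreover have "expectation ?f = 0" by (simp add: expectation_phi)
    moreover have "expectation (\<lambda>w. (?f w)\<^sup>2) = 1"
      using sg by (simp add: power_divide sigma2_eq[symmetric])
    moreover have "(\<Sum>i<n. ?f (\<omega> i)) / sqrt (real n) = T0 n G \<omega>" for \<omega>
      by (simp add: sum_divide_distrib divide_divide_eq_left mult.commute)
    ultimately have "\<bar>measure (sample n Q) {\<omega> \<in> space (sample n Q). T0 n G \<omega> \<le> x} - cdf std_normal_distribution x\<bar> \<le> \<epsilon>"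
      using elim(2)[rule_format, of Q ?f] m prob_space_axioms unfolding sample_def by simp
    moreover have "T0 n G \<in> borel_measurable (sample n Q)" unfolding sample_def by measurable
    ultimately show "T0 n G \<in> borel_measurable (sample n (law G)) \<and>
      \<bar>measure (sample n (law G)) {\<omega> \<in> space (sample n (law G)). T0 n G \<omega> \<le> x} - cdf std_normal_distribution x\<bar> \<le> \<epsilon>"
      by simp
  qed
qed

lemma eventually_cdf:
  assumes "0 < \<epsilon>"
  shows "\<forall>\<^sub>F n in sequentially. \<forall>G\<in>PP n.
     \<bar>measure (sample n (law G)) {\<omega> \<in> space (sample n (law G)). T1 n G \<omega> \<le> x} - cdf std_normal_distribution x\<bar> \<le> \<epsilon>
   \<and> \<bar>measure (sample n (law G)) {\<omega> \<in> space (sample n (law G)). T2 n G \<omega> \<le> x} - cdf std_normal_distribution x\<bar> \<le> \<epsilon>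
   \<and> \<bar>measure (sample n (law G)) {\<omega> \<in> space (sample n (law G)). T2 n G \<omega> < x} - cdf std_normal_distribution x\<bar> \<le> \<epsilon>"
proof -
  let ?F = "cdf std_normal_distribution"
  have e3: "0 < \<epsilon> / 3" using assms by simp
  obtain d where d: "0 < d" "\<And>y. \<bar>y - x\<bar> < d \<Longrightarrow> \<bar>?F y - ?F x\<bar> < \<epsilon> / 3"
    using isCont_cdf_std_normal[of x] e3 unfolding continuous_at_eps_delta dist_real_def by metis
  define \<eta> where "\<eta> = min (d / 2) (\<epsilon> / 3)"
  have \<eta>: "0 < \<eta>" "\<eta> < d" "\<eta> \<le> \<epsilon> / 3" using d e3 by (auto simp: \<eta>_def)
  have F: "\<bar>?F (x + \<eta>) - ?F x\<bar> \<le> \<epsilon> / 3" "\<bar>?F (x - \<eta>) - ?F x\<bar> \<le> \<epsilon> / 3"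
    using d(2)[of "x + \<eta>"] d(2)[of "x - \<eta>"] \<eta> by auto
  show ?thesis
    using eventually_whp[OF \<eta>(1)] eventually_T0_cdf[OF e3, of "x + \<eta>"] eventually_T0_cdf[OF e3, of "x - \<eta>"]
  proof eventually_elim
    case (elim n)
    show ?case
    proof
      fix G assume G: "G \<in> PP n"
      have w: "whp (sample n (law G)) \<eta> (\<lambda>\<omega>. \<bar>T1 n G \<omega> - T0 n G \<omega>\<bar> < \<eta>)"
        "whp (sample n (law G)) \<eta> (\<lambda>\<omega>. \<bar>T2 n G \<omega> - T0 n G \<omega>\<bar> < \<eta>)"
        by (rule whp_mono[OF bspec[OF elim(1) G]]; simp)+
      note c = cdf_perturb[OF prob_sample[OF G] _ _ _ \<eta>(3), where F = ?F and x = x and Z = "T0 n G"]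
      show "\<bar>measure (sample n (law G)) {\<omega> \<in> space (sample n (law G)). T1 n G \<omega> \<le> x} - ?F x\<bar> \<le> \<epsilon>
       \<and> \<bar>measure (sample n (law G)) {\<omega> \<in> space (sample n (law G)). T2 n G \<omega> \<le> x} - ?F x\<bar> \<le> \<epsilon>
       \<and> \<bar>measure (sample n (law G)) {\<omega> \<in> space (sample n (law G)). T2 n G \<omega> < x} - ?F x\<bar> \<le> \<epsilon>"
        using c[OF measurable_T(1)[OF G] _ w(1)] c[OF measurable_T(2)[OF G] _ w(2)] elim(2,3) G F by auto
    qed
  qed
qed

text \<open>Measurability is asked for eventually, since the laws belong to the class only from some
  index on.\<close>

lemma weak_convI:
  assumes meas: "\<forall>\<^sub>F n in sequentially. T n \<in> borel_measurable (M n)"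
    and cdf: "\<And>\<epsilon> x. 0 < \<epsilon> \<Longrightarrow> \<forall>\<^sub>F n in sequentially. \<bar>measure (M n) {\<omega> \<in> space (M n). T n \<omega> \<le> x} - cdf N x\<bar> \<le> \<epsilon>"
  shows "weak_conv_m (\<lambda>n. distr (M n) borel (T n)) N"
  unfolding weak_conv_m_def weak_conv_def
proof (intro allI impI tendstoI)
  fix x and \<epsilon> :: real assume "0 < \<epsilon>"
  then have "0 < \<epsilon> / 2" by simp
  from cdf[OF this, of x] meas show "\<forall>\<^sub>F n in sequentially. dist (cdf (distr (M n) borel (T n)) x) (cdf N x) < \<epsilon>"
  proof eventually_elim
    case (elim n)
    have "cdf (distr (M n) borel (T n)) x = measure (M n) (T n -` {..x} \<inter> space (M n))"
      unfolding cdf_def using elim(2) by (intro measure_distr) auto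
    also have "T n -` {..x} \<inter> space (M n) = {\<omega> \<in> space (M n). T n \<omega> \<le> x}" by auto
    finally show ?case using elim(1) \<open>0 < \<epsilon>\<close> by (simp add: dist_real_def)
  qed
qed

lemma weak_conv_T:
  assumes G: "\<forall>\<^sub>F n in sequentially. G n \<in> PP n"
  shows "weak_conv_m (\<lambda>n. distr (sample n (law (G n))) borel (T1 n (G n))) std_normal_distribution"
    and "weak_conv_m (\<lambda>n. distr (sample n (law (G n))) borel (T2 n (G n))) std_normal_distribution"
proof -
  have 1: "\<forall>\<^sub>F n in sequentially. T1 n (G n) \<in> borel_measurable (sample n (law (G n)))"
    and 2: "\<forall>\<^sub>F n in sequentially. T2 n (G n) \<in> borel_measurable (sample n (law (G n)))"
    using G by (auto elim!: eventually_mono intro: measurable_T)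
  show "weak_conv_m (\<lambda>n. distr (sample n (law (G n))) borel (T1 n (G n))) std_normal_distribution"
  proof (rule weak_convI[OF 1])
    fix \<epsilon> x :: real assume "0 < \<epsilon>"
    from eventually_cdf[OF this, of x] G
    show "\<forall>\<^sub>F n in sequentially. \<bar>measure (sample n (law (G n)))
        {\<omega> \<in> space (sample n (law (G n))). T1 n (G n) \<omega> \<le> x} - cdf std_normal_distribution x\<bar> \<le> \<epsilon>"
      by eventually_elim (drule (1) bspec, simp only:)
  qed
  show "weak_conv_m (\<lambda>n. distr (sample n (law (G n))) borel (T2 n (G n))) std_normal_distribution"
  proof (rule weak_convI[OF 2])
    fix \<epsilon> x :: real assume "0 < \<epsilon>"
    from eventually_cdf[OF this, of x] G
    show "\<forall>\<^sub>F n in sequentially. \<bar>measure (sample n (law (G n)))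
        {\<omega> \<in> space (sample n (law (G n))). T2 n (G n) \<omega> \<le> x} - cdf std_normal_distribution x\<bar> \<le> \<epsilon>"
      by eventually_elim (drule (1) bspec, simp only:)
  qed
qed

text \<open>Kept in the literal form of the confidence interval, so that unfolding it produces the
  event in the final claim.\<close>

definition covers :: "real \<Rightarrow> nat \<Rightarrow> 'z dgp \<Rightarrow> (nat \<Rightarrow> 'z obs) set" where
  "covers q n G = {\<omega> \<in> space (sample n (law G)).
      gch n \<omega> - q * sqrt (s2h n G \<omega>) / sqrt (real n) \<le> gamma0 G \<and>
      gamma0 G \<le> gch n \<omega> + q * sqrt (s2h n G \<omega>) / sqrt (real n)}"

text \<open>Positivity of the variance estimate permits multiplying through by its root; without it
  the division in \<open>T2\<close> would take its default value.\<close>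

lemma covers_iff:
  assumes "0 < n" "s2h n G \<omega> > 0" "\<omega> \<in> space (sample n (law G))"
  shows "\<omega> \<in> covers q n G \<longleftrightarrow> - q \<le> T2 n G \<omega> \<and> T2 n G \<omega> \<le> q"
proof -
  have s: "0 < sqrt (real n)" "0 < sqrt (s2h n G \<omega>)" using assms by auto
  have "gch n \<omega> - q * sqrt (s2h n G \<omega>) / sqrt (real n) \<le> gamma0 G \<longleftrightarrow> gch n \<omega> - gamma0 G \<le> q * sqrt (s2h n G \<omega>) / sqrt (real n)"
    by linarith
  also have "\<dots> \<longleftrightarrow> T2 n G \<omega> \<le> q"
    by (simp only: pos_le_divide_eq[OF s(1)] pos_divide_le_eq[OF s(2)] mult.commute)
  finally have 1: "gch n \<omega> - q * sqrt (s2h n G \<omega>) / sqrt (real n) \<le> gamma0 G \<longleftrightarrow> T2 n G \<omega> \<le> q" .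
  have "gamma0 G \<le> gch n \<omega> + q * sqrt (s2h n G \<omega>) / sqrt (real n) \<longleftrightarrow> (- q) * sqrt (s2h n G \<omega>) / sqrt (real n) \<le> gch n \<omega> - gamma0 G"
    by (simp only: mult_minus_left minus_divide_left[symmetric]) linarith
  also have "\<dots> \<longleftrightarrow> - q \<le> T2 n G \<omega>"
    by (simp only: pos_divide_le_eq[OF s(1)] pos_le_divide_eq[OF s(2)] mult.commute)
  finally show ?thesis using 1 assms(3) by (auto simp: covers_def)
qed

text \<open>The interval event is \<open>T2 \<le> q\<close> minus \<open>T2 < - q\<close>, so the
  strict version of the distribution bound is applied at \<open>- q\<close>; symmetry gives
  \<open>1 - \<xi>\<close>. One third of \<open>\<epsilon>\<close> goes to each of the two bounds
  and one to the event where the variance estimate might fail to be positive.\<close>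

lemma eventually_coverage:
  assumes \<xi>: "0 < \<xi>" "\<xi> < 1" and "0 < \<epsilon>"
  shows "\<forall>\<^sub>F n in sequentially. \<forall>G\<in>PP n.
    \<bar>measure (sample n (law G)) (covers (Phi_inv (1 - \<xi>/2)) n G) - (1 - \<xi>)\<bar> \<le> \<epsilon>"
proof -
  let ?F = "cdf std_normal_distribution" and ?q = "Phi_inv (1 - \<xi>/2)"
  have Fq: "?F ?q = 1 - \<xi> / 2" using \<xi> by (intro cdf_std_normal_Phi_inv) auto
  have Fmq: "?F (- ?q) = \<xi> / 2" using Fq by (simp add: cdf_std_normal_minus)
  have q: "- ?q < ?q"
  proof (rule ccontr)
    assume "\<not> - ?q < ?q"
    then have "?F ?q \<le> ?F (- ?q)" by (intro std_normal.cdf_nondecreasing) simp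
    then show False using Fq Fmq \<xi> by simp
  qed
  have e3: "0 < \<epsilon> / 3" using \<open>0 < \<epsilon>\<close> by simp
  show ?thesis
    using eventually_whp[OF e3] eventually_cdf[OF e3, of ?q] eventually_cdf[OF e3, of "- ?q"] eventually_gt_at_top[of 0]
  proof eventually_elim
    case (elim n)
    show ?case
    proof
      fix G assume G: "G \<in> PP n"
      let ?M = "sample n (law G)"
      interpret prob_space ?M by (rule prob_sample[OF G])
      note [measurable] = measurable_statistics[OF PP_sets[OF G]] measurable_T(2)[OF G]
      obtain E where E[measurable]: "E \<in> sets ?M" and pE: "prob E \<ge> 1 - \<epsilon> / 3"
        and s: "\<And>\<omega>. \<omega> \<in> E \<Longrightarrow> s2h n G \<omega> > 0"
        using elim(1) G by (auto simp: whp_def)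
      have cE: "prob (space ?M - E) \<le> \<epsilon> / 3" using pE prob_compl[OF E] by simp
      let ?I = "{\<omega> \<in> space ?M. - ?q \<le> T2 n G \<omega> \<and> T2 n G \<omega> \<le> ?q}"
      have cov[measurable]: "covers ?q n G \<in> sets ?M" unfolding covers_def by measurable
      have I[measurable]: "?I \<in> sets ?M" by measurable
      have sub: "covers ?q n G \<subseteq> ?I \<union> (space ?M - E)" "?I \<subseteq> covers ?q n G \<union> (space ?M - E)"
      proof -
        have "\<omega> \<in> covers ?q n G \<longleftrightarrow> \<omega> \<in> ?I" if "\<omega> \<in> E" for \<omega>
          using covers_iff[OF elim(4) s[OF that], of ?q] sets.sets_into_space[OF E] that by auto
        moreover have "covers ?q n G \<subseteq> space ?M" by (auto simp: covers_def)
        ultimately show "covers ?q n G \<subseteq> ?I \<union> (space ?M - E)" "?I \<subseteq> covers ?q n G \<union> (space ?M - E)" by blast+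
      qed
      have "prob (covers ?q n G) \<le> prob (?I \<union> (space ?M - E))"
        by (intro finite_measure_mono sub) measurable
      also have "\<dots> \<le> prob ?I + prob (space ?M - E)" by (intro measure_Un_le) auto
      finally have 1: "prob (covers ?q n G) \<le> prob ?I + \<epsilon> / 3" using cE by simp
      have "prob ?I \<le> prob (covers ?q n G \<union> (space ?M - E))"
        by (intro finite_measure_mono sub) measurable
      also have "\<dots> \<le> prob (covers ?q n G) + prob (space ?M - E)" by (intro measure_Un_le) auto
      finally have 2: "prob ?I \<le> prob (covers ?q n G) + \<epsilon> / 3" using cE by simp
      have "?I = {\<omega> \<in> space ?M. T2 n G \<omega> \<le> ?q} - {\<omega> \<in> space ?M. T2 n G \<omega> < - ?q}" by auto
      moreover have "{\<omega> \<in> space ?M. T2 n G \<omega> < - ?q} \<subseteq> {\<omega> \<in> space ?M. T2 n G \<omega> \<le> ?q}" using q by auto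
      ultimately have 3: "prob ?I = prob {\<omega> \<in> space ?M. T2 n G \<omega> \<le> ?q} - prob {\<omega> \<in> space ?M. T2 n G \<omega> < - ?q}"
        by (simp add: finite_measure_Diff)
      have 4: "\<bar>prob {\<omega> \<in> space ?M. T2 n G \<omega> \<le> ?q} - (1 - \<xi> / 2)\<bar> \<le> \<epsilon> / 3"
        using bspec[OF elim(2) G, unfolded Fq] by (elim conjE)
      have 5: "\<bar>prob {\<omega> \<in> space ?M. T2 n G \<omega> < - ?q} - \<xi> / 2\<bar> \<le> \<epsilon> / 3"
        using bspec[OF elim(3) G, unfolded Fmq] by (elim conjE)
      show "\<bar>prob (covers ?q n G) - (1 - \<xi>)\<bar> \<le> \<epsilon>" using 1 2 3 4 5 by linarith
    qed
  qed
qed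

end

lemma logistic_lipschitz: "\<bar>logistic u - logistic v\<bar> \<le> \<bar>u - v\<bar>"
proof -
  have "1-lipschitz_on UNIV logistic"
  proof (rule bounded_derivative_imp_lipschitz)
    show "(logistic has_derivative (\<lambda>t. exp x / (1 + exp x)\<^sup>2 * t)) (at x within UNIV)" for x
    proof -
      have "1 + exp x \<noteq> 0" using exp_gt_zero[of x] by linarith
      then have "(logistic has_real_derivative exp x / (1 + exp x)\<^sup>2) (at x)"
        unfolding logistic_def[abs_def]
        by (auto intro!: derivative_eq_intros simp: power2_eq_square field_simps)
      then show ?thesis by (simp only: has_field_derivative_def)
    qed
    show "onorm (\<lambda>t. exp x / (1 + exp x)\<^sup>2 * t) \<le> 1" for x :: real
    proof (rule onorm_le)
      have "exp x * 1 \<le> (1 + exp x) * (1 + exp x)" by (intro mult_mono) auto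
      then have "exp x / (1 + exp x)\<^sup>2 \<le> 1" by (simp add: power2_eq_square divide_le_eq_1 add_pos_pos)
      then show "norm (exp x / (1 + exp x)\<^sup>2 * t) \<le> 1 * norm t" for t
        unfolding norm_mult by (intro mult_right_mono) auto
    qed
  qed auto
  then show ?thesis using lipschitz_onD[of 1 UNIV logistic u v] by (simp add: dist_real_def)
qed

text \<open>Suprema in the extended nonnegative reals are defined without boundedness conditions,
  and an empty class contributes 0.\<close>

lemma ennreal_SUP_tendsto_zero:
  assumes "\<And>\<epsilon>. 0 < \<epsilon> \<Longrightarrow> \<forall>\<^sub>F n in sequentially. \<forall>x\<in>A n. \<bar>f n x\<bar> \<le> (\<epsilon>::real)"
  shows "(\<lambda>n. \<Squnion>x\<in>A n. ennreal \<bar>f n x\<bar>) \<longlonglongrightarrow> 0"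
proof (rule order_tendstoI)
  fix a :: ennreal assume "0 < a"
  then obtain b where b: "0 < b" "b < a" using dense by blast
  then obtain r where r: "b = ennreal r" "0 \<le> r" by (cases b) auto
  with b have "0 < r" by simp
  from assms[OF this] show "\<forall>\<^sub>F n in sequentially. (\<Squnion>x\<in>A n. ennreal \<bar>f n x\<bar>) < a"
  proof eventually_elim
    case (elim n)
    then have "(\<Squnion>x\<in>A n. ennreal \<bar>f n x\<bar>) \<le> ennreal r" by (intro SUP_least ennreal_leI) auto
    then show ?case using b r by simp
  qed
qed simp

theorem theorem2:
  fixes \<delta> \<Delta> K s :: "nat \<Rightarrow> real" and p :: "nat \<Rightarrow> nat" and C c c' :: real
    and Zs :: "'z measure" and P :: "nat \<Rightarrow> 'z \<Rightarrow> nat \<Rightarrow> real" and \<Lambda> :: "real \<Rightarrow> real"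
    and bhg1 bhg0 bhm :: "nat \<Rightarrow> (nat \<Rightarrow> 'z obs) \<Rightarrow> nat \<Rightarrow> real"
  assumes "\<forall>n. \<delta> n > 0" and "decseq \<delta>" and "\<delta> \<longlonglongrightarrow> 0"
    and "\<forall>n. \<Delta> n > 0" and "decseq \<Delta>" and "\<Delta> \<longlonglongrightarrow> 0"
    and "\<forall>n. s n \<ge> 1"
    and "C > 0" and "c > 0" and "0 < c'" and "c' < 1/2"
    and "\<Lambda> = (\<lambda>u. u) \<or> \<Lambda> = logistic"
    and "\<forall>n j. (\<lambda>z. P n z j) \<in> borel_measurable Zs"
    and "\<forall>n j. (\<lambda>\<omega>. bhg1 n \<omega> j) \<in> borel_measurable (sample n (obs_space Zs))"
    and "\<forall>n j. (\<lambda>\<omega>. bhg0 n \<omega> j) \<in> borel_measurable (sample n (obs_space Zs))"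
    and "\<forall>n j. (\<lambda>\<omega>. bhm n \<omega> j) \<in> borel_measurable (sample n (obs_space Zs))"
  shows
    "(\<forall>G :: nat \<Rightarrow> 'z dgp.
       (\<forall>\<^sub>F n in sequentially. G n \<in> Pclass Zs \<delta> \<Delta> K s p C c c' \<Lambda> P bhg1 bhg0 bhm n) \<longrightarrow>
       weak_conv_m
         (\<lambda>n. distr (sample n (law (G n))) borel
            (\<lambda>\<omega>. sqrt (real n) * (gcheck \<Lambda> p P bhg1 bhg0 bhm n \<omega> - gamma0 (G n)) / sqrt (sigma2 (G n))))
         std_normal_distribution)
  \<and>
    (\<forall>G :: nat \<Rightarrow> 'z dgp.
       (\<forall>\<^sub>F n in sequentially. G n \<in> Pclass Zs \<delta> \<Delta> K s p C c c' \<Lambda> P bhg1 bhg0 bhm n) \<longrightarrow>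
       weak_conv_m
         (\<lambda>n. distr (sample n (law (G n))) borel
            (\<lambda>\<omega>. sqrt (real n) * (gcheck \<Lambda> p P bhg1 bhg0 bhm n \<omega> - gamma0 (G n))
                   / sqrt (sigma2hat \<Lambda> p P bhg1 bhg0 bhm n \<omega> (G n))))
         std_normal_distribution)
  \<and>
    (\<forall>\<xi>. 0 < \<xi> \<and> \<xi> < 1 \<longrightarrow>
       (\<lambda>n. \<Squnion>G \<in> Pclass Zs \<delta> \<Delta> K s p C c c' \<Lambda> P bhg1 bhg0 bhm n.
          ennreal \<bar>measure (sample n (law G))
             {\<omega> \<in> space (sample n (law G)).
                gcheck \<Lambda> p P bhg1 bhg0 bhm n \<omega>
                  - Phi_inv (1 - \<xi>/2) * sqrt (sigma2hat \<Lambda> p P bhg1 bhg0 bhm n \<omega> G) / sqrt (real n)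
                  \<le> gamma0 G \<and>
                gamma0 G \<le> gcheck \<Lambda> p P bhg1 bhg0 bhm n \<omega>
                  + Phi_inv (1 - \<xi>/2) * sqrt (sigma2hat \<Lambda> p P bhg1 bhg0 bhm n \<omega> G) / sqrt (real n)}
           - (1 - \<xi>)\<bar>) \<longlonglongrightarrow> 0)"
proof -
  \<comment> \<open>Both link functions enter through their 1-Lipschitz property, so a single
    argument serves them.\<close>
  interpret hte_seq \<delta> \<Delta> K s p C c c' Zs P \<Lambda> bhg1 bhg0 bhm
    by unfold_locales (use assms logistic_lipschitz in auto)
  show ?thesis
    by (intro conjI allI impI weak_conv_T ennreal_SUP_tendsto_zero eventually_coverage[unfolded covers_def]) auto
qed

end
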